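(* Assume that $f \in L^2(\mathbb{R}) \cap C(\mathbb{R})$ is bandlimited with bandwidth $\delta \in (0,\pi)$. Let $m \in \mathbb{N} \setminus \{1\}$ be given and let $\varphi_{\mathrm{Gauss}}(t) := \mathrm{e}^{-t^2/(2\sigma^2)}$, $t \in \mathbb{R}$, be the Gaussian function with variance $\sigma^2 = \frac{m}{\pi - \delta}$. Then the Gaussian regularized Shannon sampling formula $R_{\mathrm{Gauss},m} f := R_{\varphi_{\mathrm{Gauss}},m} f$ satisfies the error estimate $$\big\| f - R_{\mathrm{Gauss},m} f \big\|_{C_0(\mathbb{R})} \le \frac{2\sqrt{2}}{\sqrt{\pi m (\pi - \delta)}}\, \mathrm{e}^{-m(\pi-\delta)/2}\, \| f \|_{L^2(\mathbb{R})}.$$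
   Context: $\mathbb{N} = \{1,2,3,\ldots\}$. The Fourier transform is $\hat{g}(\omega) := \frac{1}{\sqrt{2\pi}} \int_{\mathbb{R}} g(t)\, \mathrm{e}^{-\mathrm{i} t\omega}\, \mathrm{d}t$, $\omega \in \mathbb{R}$ (extended to $L^2(\mathbb{R})$ in the usual way). A function $f \in L^2(\mathbb{R}) \cap C(\mathbb{R})$ is called bandlimited with bandwidth $\delta > 0$ if $\hat{f}(\omega) = 0$ for all $|\omega| \ge \delta$. The cardinal sine function is $\mathrm{sinc}(t) := \frac{\sin(\pi t)}{\pi t}$ for $t \ne 0$ and $\mathrm{sinc}(0) := 1$. Let $\mathbf{1}_{[-m,m]}$ denote the characteristic function of $[-m,m]$. For a window function $\varphi : \mathbb{R} \to [0,1]$, the $\varphi$-regularized Shannon sampling formula with truncation parameter $m \in \mathbb{N} \setminus \{1\}$ is $$(R_{\varphi,m} f)(t) := \sum_{k \in \mathbb{Z}} f(k)\, \mathrm{sinc}(t-k)\, \varphi(t-k)\, \mathbf{1}_{[-m,m]}(t-k), \quad t \in \mathbb{R}.$$ $C_0(\mathbb{R})$ is the Banach space of continuous functions $g : \mathbb{R} \to \mathbb{C}$ vanishing as $|t| \to \infty$, with norm $\|g\|_{C_0(\mathbb{R})} := \max_{t \in \mathbb{R}} |g(t)|$. *)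

theory Defs
  imports "HOL-Analysis.Analysis"
begin

definition square_integrable :: "(real \<Rightarrow> complex) \<Rightarrow> bool" where
  "square_integrable f \<longleftrightarrow>
     f \<in> borel_measurable lborel \<and> integrable lborel (\<lambda>t. (cmod (f t))\<^sup>2)"

definition norm_L2 :: "(real \<Rightarrow> complex) \<Rightarrow> real" where
  "norm_L2 f = sqrt (LINT t|lborel. (cmod (f t))\<^sup>2)"

text \<open>Convergence in mean square. The extended nonnegative integral is used because the
  Bochner integral of a non-integrable function is 0.\<close>

definition tendsto_L2 :: "(nat \<Rightarrow> real \<Rightarrow> complex) \<Rightarrow> (real \<Rightarrow> complex) \<Rightarrow> bool" where
  "tendsto_L2 h f \<longleftrightarrow>
     (\<lambda>n. \<integral>\<^sup>+ t. ennreal ((cmod (h n t - f t))\<^sup>2) \<partial>lborel) \<longlonglongrightarrow> 0"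

definition fourier_L1 :: "(real \<Rightarrow> complex) \<Rightarrow> real \<Rightarrow> complex" where
  "fourier_L1 g \<omega> =
     complex_of_real (1 / sqrt (2 * pi)) *
       (LINT t|lborel. g t * exp (- (\<i> * complex_of_real t * complex_of_real \<omega>)))"

text \<open>The transform on \<open>L\<^sup>2\<close> is the extension by density (continuity) of the integral transform on
  \<open>L\<^sup>1 \<inter> L\<^sup>2\<close>. It is stated as a relation because the transform is an equivalence class: by
  Plancherel's theorem every square-integrable \<open>f\<close> has a transform \<open>g\<close>, unique up to null sets and
  independent of the approximating sequence \<open>h\<close>.\<close>

definition has_fourier_L2 :: "(real \<Rightarrow> complex) \<Rightarrow> (real \<Rightarrow> complex) \<Rightarrow> bool" where
  "has_fourier_L2 f g \<longleftrightarrow>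
     square_integrable f \<and> square_integrable g \<and>
     (\<exists>h. (\<forall>n. integrable lborel (h n) \<and> square_integrable (h n)) \<and>
          tendsto_L2 h f \<and> tendsto_L2 (\<lambda>n. fourier_L1 (h n)) g)"

text \<open>As \<open>g\<close> is only determined up to null sets, its vanishing is required almost everywhere.\<close>

definition bandlimited :: "real \<Rightarrow> (real \<Rightarrow> complex) \<Rightarrow> bool" where
  "bandlimited \<delta> f \<longleftrightarrow>
     0 < \<delta> \<and> square_integrable f \<and> continuous_on UNIV f \<and>
     (\<exists>g. has_fourier_L2 f g \<and> (AE \<omega> in lborel. \<bar>\<omega>\<bar> \<ge> \<delta> \<longrightarrow> g \<omega> = 0))"

text \<open>The normalized cardinal sine, unlike the constant \<open>sinc\<close> of HOL-Probability.\<close>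

definition cardinal_sine :: "real \<Rightarrow> real" where
  "cardinal_sine t = (if t = 0 then 1 else sin (pi * t) / (pi * t))"

definition regularized_shannon ::
    "(real \<Rightarrow> real) \<Rightarrow> nat \<Rightarrow> (real \<Rightarrow> complex) \<Rightarrow> real \<Rightarrow> complex" where
  "regularized_shannon \<phi> m f t =
     (\<Sum>\<^sub>\<infinity>k::int. f (of_int k) *
        complex_of_real (cardinal_sine (t - of_int k) * \<phi> (t - of_int k) *
                         indicator {- real m..real m} (t - of_int k)))"

definition gauss_window :: "real \<Rightarrow> real \<Rightarrow> real" where
  "gauss_window \<sigma> t = exp (- (t\<^sup>2 / (2 * \<sigma>\<^sup>2)))"

definition C0 :: "(real \<Rightarrow> complex) set" where
  "C0 = {g. continuous_on UNIV g \<and> (g \<longlongrightarrow> 0) at_infinity}"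

text \<open>On \<open>C0\<close> the supremum is a maximum, see \<open>norm_C0_attained\<close> below.\<close>

definition norm_C0 :: "(real \<Rightarrow> complex) \<Rightarrow> real" where
  "norm_C0 g = (SUP t. cmod (g t))"

lemma norm_C0_attained:
  assumes "g \<in> C0"
  shows "\<exists>t. norm_C0 g = cmod (g t) \<and> (\<forall>s. cmod (g s) \<le> cmod (g t))"
proof -
  have cont: "continuous_on UNIV g" and lim: "(g \<longlongrightarrow> 0) at_infinity"
    using assms by (auto simp: C0_def)
  have "\<exists>t. \<forall>s. cmod (g s) \<le> cmod (g t)"
  proof (cases "\<forall>s. g s = 0")
    case False
    then obtain t0 where t0: "cmod (g t0) > 0" by auto
    from lim have "\<forall>e>0. \<exists>b. \<forall>x. b \<le> \<bar>x\<bar> \<longrightarrow> cmod (g x) < e"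
      by (simp add: tendsto_iff eventually_at_infinity)
    with t0 obtain b where b: "\<And>x. b \<le> \<bar>x\<bar> \<Longrightarrow> cmod (g x) < cmod (g t0)"
      by blast
    have "\<bar>t0\<bar> < b" using b[of t0] by force
    then have t0_in: "t0 \<in> {-b..b}" by auto
    have "continuous_on {-b..b} (\<lambda>x. cmod (g x))"
      by (intro continuous_intros continuous_on_subset[OF cont]) auto
    then obtain t where t: "\<forall>s\<in>{-b..b}. cmod (g s) \<le> cmod (g t)"
      using continuous_attains_sup[of "{-b..b}" "\<lambda>x. cmod (g x)"] t0_in by auto
    have "cmod (g s) \<le> cmod (g t)" for s
    proof (cases "s \<in> {-b..b}")
      case False
      then have "cmod (g s) < cmod (g t0)" by (intro b) auto
      moreover have "cmod (g t0) \<le> cmod (g t)" using t t0_in by blast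
      ultimately show ?thesis by linarith
    qed (use t in auto)
    then show ?thesis by blast
  qed auto
  then obtain t where t: "\<And>s. cmod (g s) \<le> cmod (g t)" by blast
  have "norm_C0 g = cmod (g t)"
    unfolding norm_C0_def by (rule cSup_eq_maximum) (use t in auto)
  with t show ?thesis by blast
qed

end

theory Submission
  imports Defs "HOL-Probability.Probability"
begin

text \<open>Write \<open>f(t) = (2\<pi>)\<^sup>-\<^sup>1\<^sup>/\<^sup>2 \<integral> g(\<omega>) cis(t\<omega>) d\<omega>\<close> with \<open>g\<close> supported in \<open>(-\<delta>, \<delta>)\<close> and
\<open>\<parallel>g\<parallel> \<le> \<parallel>f\<parallel>\<close> (\<open>bandlimited_representation\<close>). The error of the truncated formula splits into a
regularization error, made by the untruncated sum with the Gaussian window, and a truncation error.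

For the regularization error, the Gaussian window is the mean of the characters \<open>x \<mapsto> cis(x\<tau>)\<close> over
a normal variable \<open>\<tau>\<close> of variance \<open>1/\<sigma>\<^sup>2\<close>. For fixed \<open>\<tau>\<close> the sum over all samples, with \<open>cis((t-k)\<tau>)\<close>
in the place of the window, has the frequency-side kernel \<open>cis(t\<tau>) E(\<omega>-\<tau>)\<close>, where \<open>E\<close> is the
\<open>2\<pi>\<close>-periodic extension of \<open>\<theta> \<mapsto> cis(t\<theta>)\<close> from \<open>[-\<pi>, \<pi>)\<close>, because the Fourier coefficients of \<open>E\<close>
are the values \<open>sinc(t-k)\<close>. This kernel equals \<open>cis(t\<omega>)\<close> unless \<open>|\<omega>-\<tau>| \<ge> \<pi>\<close>, and then the
difference is at most 2. Hence the error is controlled by the Gaussian tail probability of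
\<open>|\<omega>-\<tau>| \<ge> \<pi>\<close> for \<open>|\<omega>| < \<delta>\<close>, which is of order \<open>exp(-\<sigma>\<^sup>2(\<pi>-\<delta>)\<^sup>2/2) = exp(-m(\<pi>-\<delta>)/2)\<close>
(\<open>regularization_error\<close>, \<open>gauss_two_sided_tail\<close>). The Fourier sums of \<open>E\<close> converge in mean square because
\<open>\<Sum>\<^sub>k sinc\<^sup>2(t-k) = 1\<close> (\<open>cardinal_sine_squares_sum\<close>).

The truncation error is bounded by Cauchy-Schwarz: the samples have square sum at most \<open>\<parallel>g\<parallel>\<^sup>2\<close> by
Bessel's inequality, and the squares of the omitted kernel values are dominated by a geometric
series (\<open>truncation_error\<close>). The choice of the variance makes both errors decay at the same rate
\<open>exp(-m(\<pi>-\<delta>)/2)\<close>. In units of \<open>\<surd>2 / \<surd>(\<pi>m(\<pi>-\<delta>)) exp(-m(\<pi>-\<delta>)/2) \<parallel>f\<parallel>\<close> they are at most 1.1 and 0.8,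
so that their sum stays below 2 (\<open>shannon_constants_bound\<close>).\<close>

section \<open>Square-integrable functions on the line\<close>

lemma square_integrable_measurable [measurable_dest]:
  "square_integrable u \<Longrightarrow> u \<in> borel_measurable borel"
  by (simp add: square_integrable_def)

lemma square_integrable_nn_integral:
  assumes "square_integrable u"
  shows "(\<integral>\<^sup>+ x. ennreal ((cmod (u x))\<^sup>2) \<partial>lborel) = ennreal ((norm_L2 u)\<^sup>2)"
  using assms by (subst nn_integral_eq_integral) (auto simp: square_integrable_def norm_L2_def)

lemma norm_L2_nonneg [simp]: "0 \<le> norm_L2 u"
  by (simp add: norm_L2_def)

lemma square_integrableI_bounded:
  assumes "u \<in> borel_measurable borel"
    and "(\<integral>\<^sup>+ x. ennreal ((cmod (u x))\<^sup>2) \<partial>lborel) \<le> ennreal c" and "0 \<le> c"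
  shows "square_integrable u \<and> (norm_L2 u)\<^sup>2 \<le> c"
proof -
  have int: "integrable lborel (\<lambda>t. (cmod (u t))\<^sup>2)"
    using assms(1) le_less_trans[OF assms(2) ennreal_less_top]
    by (intro integrableI_bounded) auto
  then have sq: "square_integrable u"
    using assms(1) by (simp add: square_integrable_def)
  show ?thesis
    using square_integrable_nn_integral[OF sq] assms(2,3) sq by simp
qed

lemma nn_integral_mult_le_norm_L2:
  assumes u: "square_integrable u" and v: "square_integrable v"
  shows "(\<integral>\<^sup>+ x. ennreal (cmod (u x) * cmod (v x)) \<partial>lborel) \<le> ennreal (norm_L2 u * norm_L2 v)"
proof -
  note [measurable] = u[THEN square_integrable_measurable] v[THEN square_integrable_measurable]
  have "(\<integral>\<^sup>+ x. ennreal (cmod (u x)) * ennreal (cmod (v x)) \<partial>lborel)\<^sup>2 \<le>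
      (\<integral>\<^sup>+ x. ennreal (cmod (u x))^2 \<partial>lborel) * (\<integral>\<^sup>+ x. ennreal (cmod (v x))^2 \<partial>lborel)"
    by (rule Cauchy_Schwarz_nn_integral) measurable
  also have "\<dots> = ennreal ((norm_L2 u)\<^sup>2) * ennreal ((norm_L2 v)\<^sup>2)"
    using square_integrable_nn_integral[OF u] square_integrable_nn_integral[OF v]
    by (simp add: ennreal_power)
  also have "\<dots> = ennreal (norm_L2 u * norm_L2 v)^2"
    by (simp add: ennreal_mult'[symmetric] ennreal_power power_mult_distrib)
  finally have "(\<integral>\<^sup>+ x. ennreal (cmod (u x)) * ennreal (cmod (v x)) \<partial>lborel)
      \<le> ennreal (norm_L2 u * norm_L2 v)"
    by (cases "\<integral>\<^sup>+ x. ennreal (cmod (u x)) * ennreal (cmod (v x)) \<partial>lborel")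
       (auto simp: ennreal_power power2_le_iff_abs_le top_unique)
  then show ?thesis
    by (simp add: ennreal_mult'[symmetric])
qed

lemma square_integrable_mult_integrable:
  assumes u: "square_integrable u" and v: "square_integrable v"
  shows "integrable lborel (\<lambda>x. u x * v x)"
proof (rule integrableI_bounded)
  note [measurable] = u[THEN square_integrable_measurable] v[THEN square_integrable_measurable]
  show "(\<lambda>x. u x * v x) \<in> borel_measurable lborel" by measurable
  show "(\<integral>\<^sup>+ x. ennreal (norm (u x * v x)) \<partial>lborel) < \<infinity>"
    using nn_integral_mult_le_norm_L2[OF u v] 
    by (simp add: norm_mult) (meson ennreal_less_top le_less_trans)
qed

lemma norm_integral_mult_le_norm_L2:
  assumes u: "square_integrable u" and v: "square_integrable v"
  shows "cmod (LINT x|lborel. u x * v x) \<le> norm_L2 u * norm_L2 v"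
proof -
  have "ennreal (cmod (LINT x|lborel. u x * v x)) \<le> (\<integral>\<^sup>+ x. ennreal (norm (u x * v x)) \<partial>lborel)"
    by (rule integral_norm_bound_ennreal[OF square_integrable_mult_integrable[OF u v]])
  also have "\<dots> \<le> ennreal (norm_L2 u * norm_L2 v)"
    using nn_integral_mult_le_norm_L2[OF u v] by (simp add: norm_mult)
  finally show ?thesis
    by (simp add: ennreal_le_iff)
qed

lemma sum_sq_weighted_bound:
  fixes a b :: complex and \<eta> :: real
  assumes "\<eta> > 0"
  shows "(cmod (a + b))\<^sup>2 \<le> (1 + \<eta>) * (cmod a)\<^sup>2 + (1 + 1 / \<eta>) * (cmod b)\<^sup>2"
proof -
  have "(cmod (a + b))\<^sup>2 \<le> (cmod a + cmod b)\<^sup>2"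
    by (intro power_mono norm_triangle_ineq) auto
  moreover have "0 \<le> (sqrt \<eta> * cmod a - cmod b / sqrt \<eta>)\<^sup>2" by simp
  then have "2 * (cmod a * cmod b) \<le> \<eta> * (cmod a)\<^sup>2 + (cmod b)\<^sup>2 / \<eta>"
    using assms by (simp add: power2_diff power_mult_distrib power_divide)
  ultimately show ?thesis by (simp add: power2_sum algebra_simps)
qed

lemma square_integrable_diff:
  assumes u: "square_integrable u" and v: "square_integrable v"
  shows "square_integrable (\<lambda>x. u x - v x)"
proof -
  note [measurable] = u[THEN square_integrable_measurable] v[THEN square_integrable_measurable]
  have "integrable lborel (\<lambda>x. (cmod (u x - v x))\<^sup>2)"
  proof (rule Bochner_Integration.integrable_bound)
    show "integrable lborel (\<lambda>x. 2 * (cmod (u x))\<^sup>2 + 2 * (cmod (v x))\<^sup>2)"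
      using u v by (auto simp: square_integrable_def)
    show "AE x in lborel. norm ((cmod (u x - v x))\<^sup>2) \<le> norm (2 * (cmod (u x))\<^sup>2 + 2 * (cmod (v x))\<^sup>2)"
      using sum_sq_weighted_bound[of 1 "u x" "- v x" for x] by auto
  qed measurable
  then show ?thesis by (simp add: square_integrable_def)
qed

lemma tendsto_L2_norm_diff:
  assumes lim: "tendsto_L2 h f" and h: "\<And>n. square_integrable (h n)" and f: "square_integrable f"
  shows "(\<lambda>n. norm_L2 (\<lambda>x. h n x - f x)) \<longlonglongrightarrow> 0"
proof -
  have "(\<lambda>n. ennreal ((norm_L2 (\<lambda>x. h n x - f x))\<^sup>2)) \<longlonglongrightarrow> ennreal 0"
    using lim square_integrable_nn_integral[OF square_integrable_diff[OF h f]]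
    by (simp add: tendsto_L2_def)
  then have "(\<lambda>n. (norm_L2 (\<lambda>x. h n x - f x))\<^sup>2) \<longlonglongrightarrow> 0"
    by (subst (asm) tendsto_ennreal_iff) auto
  from tendsto_real_sqrt[OF this] show ?thesis by (simp add: real_sqrt_abs)
qed

text \<open>By Cauchy-Schwarz, pairing with a fixed square-integrable function is continuous for mean-square
convergence. This is what carries identities for integrable functions over to the \<open>L\<^sup>2\<close> transform.\<close>

lemma tendsto_L2_integral_mult:
  assumes lim: "tendsto_L2 h f" and h: "\<And>n. square_integrable (h n)" and f: "square_integrable f"
    and v: "square_integrable v"
  shows "(\<lambda>n. LINT x|lborel. h n x * v x) \<longlonglongrightarrow> (LINT x|lborel. f x * v x)"
proof (rule LIM_zero_cancel, rule Lim_null_comparison)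
  have "(LINT x|lborel. h n x * v x) - (LINT x|lborel. f x * v x) =
      (LINT x|lborel. (h n x - f x) * v x)" for n
    using square_integrable_mult_integrable[OF h v] square_integrable_mult_integrable[OF f v]
    by (subst Bochner_Integration.integral_diff[symmetric]) (auto simp: algebra_simps)
  then show "\<forall>\<^sub>F n in sequentially. norm ((LINT x|lborel. h n x * v x) - (LINT x|lborel. f x * v x))
      \<le> norm_L2 (\<lambda>x. h n x - f x) * norm_L2 v"
    using norm_integral_mult_le_norm_L2[OF square_integrable_diff[OF h f] v] by simp
  show "(\<lambda>n. norm_L2 (\<lambda>x. h n x - f x) * norm_L2 v) \<longlonglongrightarrow> 0"
    using tendsto_mult_right[OF tendsto_L2_norm_diff[OF lim h f], of "norm_L2 v"] by simp
qed

lemma norm_L2_le_of_tendsto_L2: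
  assumes h: "\<And>n. square_integrable (h n)" and f: "square_integrable f" and lim: "tendsto_L2 h f"
    and H: "\<And>n. square_integrable (H n)" and g: "square_integrable g" and lim': "tendsto_L2 H g"
    and le: "\<And>n. norm_L2 (H n) \<le> norm_L2 (h n)"
  shows "norm_L2 g \<le> norm_L2 f"
proof -
  have tri: "norm_L2 u \<le> norm_L2 v + norm_L2 (\<lambda>x. u x - v x)"
    if u: "square_integrable u" and v: "square_integrable v" for u v
  proof -
    define w where "w = (\<lambda>x. u x - v x)"
    have w: "square_integrable w" unfolding w_def by (rule square_integrable_diff[OF u v])
    note [measurable] = w[THEN square_integrable_measurable] v[THEN square_integrable_measurable]
    have int: "integrable lborel (\<lambda>x. cmod (v x) * cmod (w x))"
      using integrable_norm[OF square_integrable_mult_integrable[OF v w]] by (simp add: norm_mult)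
    have "ennreal (LINT x|lborel. cmod (v x) * cmod (w x)) \<le> ennreal (norm_L2 v * norm_L2 w)"
      using nn_integral_mult_le_norm_L2[OF v w] nn_integral_eq_integral[OF int] by simp
    then have cs: "(LINT x|lborel. cmod (v x) * cmod (w x)) \<le> norm_L2 v * norm_L2 w"
      by (simp add: ennreal_le_iff)
    have "(norm_L2 u)\<^sup>2 = (LINT x|lborel. (cmod (u x))\<^sup>2)"
      by (simp add: norm_L2_def)
    also have "\<dots> \<le> (LINT x|lborel. (cmod (v x))\<^sup>2 + (cmod (w x))\<^sup>2 + 2 * (cmod (v x) * cmod (w x)))"
    proof (rule integral_mono)
      fix x
      have "cmod (u x) \<le> cmod (v x) + cmod (w x)"
        using norm_triangle_ineq[of "v x" "w x"] by (simp add: w_def)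
      then have "(cmod (u x))\<^sup>2 \<le> (cmod (v x) + cmod (w x))\<^sup>2" by (intro power_mono) auto
      then show "(cmod (u x))\<^sup>2 \<le> (cmod (v x))\<^sup>2 + (cmod (w x))\<^sup>2 + 2 * (cmod (v x) * cmod (w x))"
        by (simp add: power2_sum)
    qed (use u v w int in \<open>auto simp: square_integrable_def\<close>)
    also have "\<dots> = (norm_L2 v)\<^sup>2 + (norm_L2 w)\<^sup>2 + 2 * (LINT x|lborel. cmod (v x) * cmod (w x))"
      using u v w int by (simp add: square_integrable_def norm_L2_def)
    also have "\<dots> \<le> (norm_L2 v + norm_L2 w)\<^sup>2"
      using cs by (simp add: power2_sum)
    finally show ?thesis
      unfolding w_def by (simp add: power2_le_iff_abs_le)
  qed
  have "norm_L2 g \<le> norm_L2 f + (norm_L2 (\<lambda>x. h n x - f x) + norm_L2 (\<lambda>x. H n x - g x))" for n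
  proof -
    have "norm_L2 (\<lambda>x. g x - H n x) = norm_L2 (\<lambda>x. H n x - g x)"
      by (simp add: norm_L2_def norm_minus_commute)
    then show ?thesis
      using tri[OF g H, of n] tri[OF h f, of n] le[of n] by linarith
  qed
  moreover have "(\<lambda>n. norm_L2 f + (norm_L2 (\<lambda>x. h n x - f x) + norm_L2 (\<lambda>x. H n x - g x)))
      \<longlonglongrightarrow> norm_L2 f + (0 + 0)"
    by (intro tendsto_intros tendsto_L2_norm_diff lim lim' h f g H)
  ultimately show ?thesis
    using LIMSEQ_le_const[of _ "norm_L2 f + (0 + 0)" "norm_L2 g"] by auto
qed

section \<open>The Gaussian and its characteristic function\<close>

definition gauss_measure :: "real \<Rightarrow> real measure" where
  "gauss_measure s = density lborel (\<lambda>x. ennreal (normal_density 0 s x))"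

lemma prob_space_gauss_measure: "s > 0 \<Longrightarrow> prob_space (gauss_measure s)"
  by (simp add: gauss_measure_def prob_space_normal_density)

lemma sets_gauss_measure [measurable_cong, simp]: "sets (gauss_measure s) = sets borel"
  by (simp add: gauss_measure_def)

lemma space_gauss_measure [simp]: "space (gauss_measure s) = UNIV"
  by (simp add: gauss_measure_def)

lemma integral_gauss_measure:
  fixes u :: "real \<Rightarrow> complex"
  assumes "u \<in> borel_measurable borel"
  shows "(LINT x|gauss_measure s. u x) = (LINT x|lborel. normal_density 0 s x *\<^sub>R u x)"
  unfolding gauss_measure_def using assms by (subst integral_density) auto

lemma gauss_measure_char:
  assumes "s > 0"
  shows "(LINT x|gauss_measure s. cis (t * x)) = complex_of_real (exp (- (s * t)\<^sup>2 / 2))"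
proof -
  have "(LINT x|gauss_measure s. cis (t * x)) = (LINT x|lborel. normal_density 0 s x *\<^sub>R cis (t * x))"
    by (rule integral_gauss_measure) (auto simp: cis_conv_exp)
  also have "\<dots> = (LINT x|lborel. std_normal_density x *\<^sub>R iexp (s * t * x))"
    using assms
    by (subst lborel_integral_real_affine[of s _ 0])
       (auto simp: normal_density_def power_mult_distrib real_sqrt_mult cis_conv_exp
          scaleR_conv_of_real mult_ac)
  also have "\<dots> = char std_normal_distribution (s * t)"
    unfolding char_def by (subst integral_density) auto
  also have "\<dots> = complex_of_real (exp (- (s * t)\<^sup>2 / 2))"
    by (simp add: char_std_normal_distribution)
  finally show ?thesis .
qed

lemma cis_cnj_measurable [measurable]:
  "cis \<in> borel_measurable borel" "cnj \<in> borel_measurable borel"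
  by (intro borel_measurable_continuous_onI continuous_intros)+

text \<open>Moving the transform from one factor to the other is Fubini's theorem; a finite measure and a bounded
\<open>u\<close> make the double integral absolutely convergent.\<close>

lemma fourier_multiplication_formula:
  fixes h u :: "real \<Rightarrow> complex"
  assumes h: "integrable lborel h" and M: "finite_measure M" and sets: "sets M = sets borel"
    and u [measurable]: "u \<in> borel_measurable borel" and bd: "\<And>\<omega>. cmod (u \<omega>) \<le> C"
  shows "(LINT \<omega>|M. u \<omega> * (LINT x|lborel. h x * cis (- (x * \<omega>)))) =
         (LINT x|lborel. h x * (LINT \<omega>|M. u \<omega> * cis (- (x * \<omega>))))"
proof -
  interpret M: finite_measure M by fact
  interpret pair_sigma_finite lborel M ..
  note [measurable_cong] = sets
  note [measurable] = borel_measurable_integrable[OF h]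
  have int: "integrable (lborel \<Otimes>\<^sub>M M) (\<lambda>(x, \<omega>). h x * (u \<omega> * cis (- (x * \<omega>))))"
  proof (rule Fubini_integrable)
    show "(\<lambda>(x, \<omega>). h x * (u \<omega> * cis (- (x * \<omega>)))) \<in> borel_measurable (lborel \<Otimes>\<^sub>M M)"
      by measurable
    have "integrable lborel (\<lambda>x. norm (h x) * (LINT \<omega>|M. norm (u \<omega>)))"
      using h by auto
    then show "integrable lborel (\<lambda>x. LINT y|M. norm (case (x, y) of (x, \<omega>) \<Rightarrow> h x * (u \<omega> * cis (- (x * \<omega>)))))"
      by (simp add: norm_mult)
    have "integrable M (\<lambda>\<omega>. h x * (u \<omega> * cis (- (x * \<omega>))))" for x
      by (intro integrable_mult_right M.integrable_const_bound[where B=C]) (auto simp: norm_mult bd)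
    then show "AE x in lborel. integrable M (\<lambda>y. case (x, y) of (x, \<omega>) \<Rightarrow> h x * (u \<omega> * cis (- (x * \<omega>))))"
      by simp
  qed
  have "(LINT \<omega>|M. u \<omega> * (LINT x|lborel. h x * cis (- (x * \<omega>)))) =
      (LINT \<omega>|M. (LINT x|lborel. h x * (u \<omega> * cis (- (x * \<omega>)))))"
    by (simp add: mult_ac flip: integral_mult_right_zero)
  also have "\<dots> = (LINT x|lborel. (LINT \<omega>|M. h x * (u \<omega> * cis (- (x * \<omega>)))))"
    by (rule Fubini_integral[OF int])
  finally show ?thesis by simp
qed

section \<open>The Plancherel inequality and Gaussian inversion\<close>

lemma fourier_L1_cis:
  "fourier_L1 h \<omega> = complex_of_real (1 / sqrt (2 * pi)) * (LINT x|lborel. h x * cis (- (x * \<omega>)))"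
  by (simp add: fourier_L1_def cis_conv_exp mult.assoc)

lemma fourier_L1_measurable [measurable]:
  assumes [measurable]: "h \<in> borel_measurable borel"
  shows "fourier_L1 h \<in> borel_measurable borel"
  unfolding fourier_L1_cis[abs_def] by measurable

lemma norm_fourier_integral_le:
  "cmod (LINT x|lborel. h x * cis (- (x * \<omega>))) \<le> (LINT x|lborel. cmod (h x))"
  using integral_norm_bound[of lborel "\<lambda>x. h x * cis (- (x * \<omega>))"] by (simp add: norm_mult)

lemma gauss_kernel_density:
  assumes "s > 0"
  shows "exp (- (s * z)\<^sup>2 / 2) = sqrt (2 * pi) / s * normal_density 0 (1 / s) z"
  using assms by (simp add: normal_density_def real_sqrt_mult real_sqrt_divide power_mult_distrib field_simps)

lemma nn_integral_normal_density_translate: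
  assumes "s > 0"
  shows "(\<integral>\<^sup>+ x. ennreal (normal_density 0 s (x - y)) \<partial>lborel) = 1"
    and "(\<integral>\<^sup>+ x. ennreal (normal_density 0 s (y - x)) \<partial>lborel) = 1"
proof -
  have 1: "(\<integral>\<^sup>+ x. ennreal (normal_density 0 s x) \<partial>lborel) = 1"
    using assms by (subst nn_integral_eq_integral) auto
  show "(\<integral>\<^sup>+ x. ennreal (normal_density 0 s (x - y)) \<partial>lborel) = 1"
    using nn_integral_real_affine[of "\<lambda>x. ennreal (normal_density 0 s x)" 1 "-y"] 1 by simp
  show "(\<integral>\<^sup>+ x. ennreal (normal_density 0 s (y - x)) \<partial>lborel) = 1"
    using nn_integral_real_affine[of "\<lambda>x. ennreal (normal_density 0 s x)" "-1" y] 1 by simp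
qed

text \<open>Schur's test: after \<open>|h(x) h(y)| \<le> (|h(x)|\<^sup>2 + |h(y)|\<^sup>2) / 2\<close> one of the two integrations only sees the
normal density, which has total mass 1.\<close>

lemma gauss_quadratic_form_bound:
  assumes h: "square_integrable h" and s: "s > 0"
  shows "(\<integral>\<^sup>+ x. \<integral>\<^sup>+ y. ennreal (cmod (h x) * cmod (h y) * normal_density 0 s (x - y)) \<partial>lborel \<partial>lborel)
      \<le> ennreal ((norm_L2 h)\<^sup>2)"
proof -
  note [measurable] = h[THEN square_integrable_measurable]
  define K where "K = (\<lambda>x y. ennreal (normal_density 0 s (x - y)))"
  define a where "a = (\<lambda>x. ennreal ((cmod (h x))\<^sup>2))"
  have [measurable]: "a \<in> borel_measurable borel" "case_prod K \<in> borel_measurable (borel \<Otimes>\<^sub>M borel)"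
    unfolding a_def K_def by measurable
  have [measurable]: "(\<lambda>x. K x y) \<in> borel_measurable borel" "(\<lambda>x. K y x) \<in> borel_measurable borel" for y
    unfolding K_def by measurable
  have pt: "ennreal (cmod (h x) * cmod (h y) * normal_density 0 s (x - y))
      \<le> (a x * K x y + a y * K x y) / 2" for x y
  proof -
    have "cmod (h x) * cmod (h y) \<le> ((cmod (h x))\<^sup>2 + (cmod (h y))\<^sup>2) / 2"
      using sum_squares_bound[of "cmod (h x)" "cmod (h y)"] by simp
    then have "cmod (h x) * cmod (h y) * normal_density 0 s (x - y) \<le>
       ((cmod (h x))\<^sup>2 + (cmod (h y))\<^sup>2) / 2 * normal_density 0 s (x - y)"
      by (rule mult_right_mono) simp
    then have "ennreal (cmod (h x) * cmod (h y) * normal_density 0 s (x - y)) \<le>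
       ennreal (((cmod (h x))\<^sup>2 * normal_density 0 s (x - y) + (cmod (h y))\<^sup>2 * normal_density 0 s (x - y)) / 2)"
      by (intro ennreal_leI) (simp add: field_simps)
    also have "\<dots> = (a x * K x y + a y * K x y) / 2"
      by (simp add: a_def K_def ennreal_mult' ennreal_plus divide_ennreal[symmetric] flip: ennreal_numeral)
    finally show ?thesis .
  qed
  have A: "(\<integral>\<^sup>+ x. \<integral>\<^sup>+ y. a x * K x y \<partial>lborel \<partial>lborel) = ennreal ((norm_L2 h)\<^sup>2)"
    using nn_integral_normal_density_translate(2)[OF s] square_integrable_nn_integral[OF h]
    by (simp add: nn_integral_cmult) (simp add: K_def a_def)
  have "(\<integral>\<^sup>+ x. \<integral>\<^sup>+ y. a y * K x y \<partial>lborel \<partial>lborel) = (\<integral>\<^sup>+ y. \<integral>\<^sup>+ x. a y * K x y \<partial>lborel \<partial>lborel)"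
    by (rule lborel_pair.Fubini') measurable
  also have "\<dots> = ennreal ((norm_L2 h)\<^sup>2)"
    using nn_integral_normal_density_translate(1)[OF s] square_integrable_nn_integral[OF h]
    by (simp add: nn_integral_cmult) (simp add: K_def a_def)
  finally have B: "(\<integral>\<^sup>+ x. \<integral>\<^sup>+ y. a y * K x y \<partial>lborel \<partial>lborel) = ennreal ((norm_L2 h)\<^sup>2)" .
  have "(\<integral>\<^sup>+ x. \<integral>\<^sup>+ y. ennreal (cmod (h x) * cmod (h y) * normal_density 0 s (x - y)) \<partial>lborel \<partial>lborel)
      \<le> (\<integral>\<^sup>+ x. \<integral>\<^sup>+ y. (a x * K x y + a y * K x y) / 2 \<partial>lborel \<partial>lborel)"
    by (intro nn_integral_mono pt)
  also have "\<dots> = ((\<integral>\<^sup>+ x. \<integral>\<^sup>+ y. a x * K x y \<partial>lborel \<partial>lborel) + (\<integral>\<^sup>+ x. \<integral>\<^sup>+ y. a y * K x y \<partial>lborel \<partial>lborel)) / 2"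
    by (simp add: nn_integral_divide nn_integral_add)
  also have "\<dots> = ennreal ((norm_L2 h)\<^sup>2)"
    unfolding A B by (simp add: divide_ennreal flip: ennreal_plus ennreal_numeral)
  finally show ?thesis .
qed

text \<open>Integrating \<open>|F h|\<^sup>2\<close> against a Gaussian and using the multiplication formula twice gives
\<open>\<integral>\<integral> h(x) cnj(h(y)) N(x-y)\<close> with a normal density \<open>N\<close>; the quadratic form bound applies.\<close>

lemma plancherel_gauss_damped:
  assumes h: "integrable lborel h" "square_integrable h" and s: "s > 0"
  shows "(\<integral>\<^sup>+ \<omega>. ennreal (exp (- (\<omega>\<^sup>2 / (2 * s\<^sup>2))) * (cmod (fourier_L1 h \<omega>))\<^sup>2) \<partial>lborel)
      \<le> ennreal ((norm_L2 h)\<^sup>2)"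
proof -
  note [measurable] = h(2)[THEN square_integrable_measurable]
  interpret M: prob_space "gauss_measure s" by (rule prob_space_gauss_measure[OF s])
  define H where "H = (\<lambda>\<omega>. LINT x|lborel. h x * cis (- (x * \<omega>)))"
  have [measurable]: "H \<in> borel_measurable borel" unfolding H_def by measurable
  define C where "C = (LINT x|lborel. cmod (h x))"
  have HC: "cmod (H \<omega>) \<le> C" for \<omega>
    unfolding H_def C_def by (rule norm_fourier_integral_le)
  have sq: "(cmod (H \<omega>))\<^sup>2 \<le> C\<^sup>2" for \<omega> using HC by (intro power_mono) auto
  define q where "q = (\<lambda>x. LINT y|lborel. h y * complex_of_real (exp (- (s * (x - y))\<^sup>2 / 2)))"
  \<comment> \<open>The first use of the multiplication formula: the inner transform becomes a Gaussian convolution \<open>q\<close> of \<open>h\<close>.\<close>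
  have inner: "(LINT \<omega>|gauss_measure s. cnj (H \<omega>) * cis (- (x * \<omega>))) = cnj (q x)" for x
  proof -
    have "(LINT \<omega>|gauss_measure s. cis (x * \<omega>) * H \<omega>) =
        (LINT y|lborel. h y * (LINT \<omega>|gauss_measure s. cis (x * \<omega>) * cis (- (y * \<omega>))))"
      unfolding H_def
      by (rule fourier_multiplication_formula[where C=1]) (auto intro: h M.finite_measure_axioms)
    also have "\<dots> = q x"
      using gauss_measure_char[OF s, of "x - y" for y]
      unfolding q_def by (simp add: cis_mult algebra_simps)
    finally have "(LINT \<omega>|gauss_measure s. cis (x * \<omega>) * H \<omega>) = q x" .
    moreover have "(LINT \<omega>|gauss_measure s. cnj (H \<omega>) * cis (- (x * \<omega>))) =
        (LINT \<omega>|gauss_measure s. cnj (cis (x * \<omega>) * H \<omega>))"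
      by (simp add: cis_cnj mult.commute)
    ultimately show ?thesis by (simp only: Bochner_Integration.integral_cnj)
  qed
  have "(LINT \<omega>|gauss_measure s. cnj (H \<omega>) * H \<omega>) =
      (LINT x|lborel. h x * (LINT \<omega>|gauss_measure s. cnj (H \<omega>) * cis (- (x * \<omega>))))"
    unfolding H_def[symmetric] 
    by (subst (2) H_def, rule fourier_multiplication_formula[where C=C])
       (auto intro: h M.finite_measure_axioms HC)
  also have "\<dots> = (LINT x|lborel. h x * cnj (q x))"
    by (simp add: inner)
  finally have eq: "complex_of_real (LINT \<omega>|gauss_measure s. (cmod (H \<omega>))\<^sup>2) = (LINT x|lborel. h x * cnj (q x))"
    by (simp only: complex_norm_square mult.commute[of "H _"] flip: integral_complex_of_real)
  have intM: "integrable (gauss_measure s) (\<lambda>\<omega>. (cmod (H \<omega>))\<^sup>2)"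
    by (rule M.integrable_const_bound[where B="C\<^sup>2"]) (auto simp: sq)
  have "(\<integral>\<^sup>+ \<omega>. ennreal ((cmod (H \<omega>))\<^sup>2) \<partial>gauss_measure s) = ennreal (cmod (LINT x|lborel. h x * cnj (q x)))"
    unfolding eq[symmetric] by (subst nn_integral_eq_integral[OF intM]) auto
  also have "\<dots> \<le> (\<integral>\<^sup>+ x. ennreal (cmod (h x * cnj (q x))) \<partial>lborel)"
    by (cases "integrable lborel (\<lambda>x. h x * cnj (q x))")
       (auto intro: integral_norm_bound_ennreal simp: not_integrable_integral_eq)
  also have "\<dots> \<le> (\<integral>\<^sup>+ x. \<integral>\<^sup>+ y. ennreal (sqrt (2 * pi) / s) *
       ennreal (cmod (h x) * cmod (h y) * normal_density 0 (1 / s) (x - y)) \<partial>lborel \<partial>lborel)"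
  proof (rule nn_integral_mono)
    fix x
    have kd: "exp (- ((s * z)\<^sup>2 / 2)) = sqrt (2 * pi) / s * normal_density 0 (1 / s) z" for z
      using gauss_kernel_density[OF s, of z] by simp
    have i: "integrable lborel (\<lambda>y. h y * complex_of_real (exp (- (s * (x - y))\<^sup>2 / 2)))"
      by (rule Bochner_Integration.integrable_bound[OF h(1)]) (auto simp: norm_mult mult_left_le)
    have "ennreal (cmod (h x * cnj (q x))) = ennreal (cmod (h x)) * ennreal (cmod (q x))"
      by (simp add: norm_mult ennreal_mult')
    also have "\<dots> \<le> ennreal (cmod (h x)) *
        (\<integral>\<^sup>+ y. ennreal (norm (h y * complex_of_real (exp (- (s * (x - y))\<^sup>2 / 2)))) \<partial>lborel)"
      unfolding q_def by (intro mult_left_mono integral_norm_bound_ennreal i) auto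
    also have "\<dots> = (\<integral>\<^sup>+ y. ennreal (sqrt (2 * pi) / s) *
       ennreal (cmod (h x) * cmod (h y) * normal_density 0 (1 / s) (x - y)) \<partial>lborel)"
      using s
      by (subst nn_integral_cmult[symmetric])
         (auto intro!: nn_integral_cong simp: kd norm_mult norm_divide mult_ac simp flip: ennreal_mult')
    finally show "ennreal (cmod (h x * cnj (q x))) \<le> \<dots>" .
  qed
  also have "\<dots> = ennreal (sqrt (2 * pi) / s) * (\<integral>\<^sup>+ x. \<integral>\<^sup>+ y.
       ennreal (cmod (h x) * cmod (h y) * normal_density 0 (1 / s) (x - y)) \<partial>lborel \<partial>lborel)"
    by (simp add: nn_integral_cmult)
  also have "\<dots> \<le> ennreal (sqrt (2 * pi) / s) * ennreal ((norm_L2 h)\<^sup>2)"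
    by (intro mult_left_mono gauss_quadratic_form_bound h) (use s in auto)
  finally have main: "(\<integral>\<^sup>+ \<omega>. ennreal ((cmod (H \<omega>))\<^sup>2) \<partial>gauss_measure s)
      \<le> ennreal (sqrt (2 * pi) / s * (norm_L2 h)\<^sup>2)"
    by (subst ennreal_mult) (use s in auto)
  have "(\<integral>\<^sup>+ \<omega>. ennreal (exp (- (\<omega>\<^sup>2 / (2 * s\<^sup>2))) * (cmod (fourier_L1 h \<omega>))\<^sup>2) \<partial>lborel) =
     (\<integral>\<^sup>+ \<omega>. ennreal (s / sqrt (2 * pi)) * (ennreal (normal_density 0 s \<omega>) * ennreal ((cmod (H \<omega>))\<^sup>2)) \<partial>lborel)"
  proof (intro nn_integral_cong)
    fix \<omega> :: real
    define c where "c = sqrt (2 * pi)"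
    define e where "e = exp (- (\<omega>\<^sup>2 / (2 * s\<^sup>2)))"
    have c: "c > 0" "c * c = 2 * pi" by (auto simp: c_def)
    have "normal_density 0 s \<omega> = e / (c * s)"
      using s by (simp add: normal_density_def c_def e_def real_sqrt_mult)
    moreover have "(cmod (fourier_L1 h \<omega>))\<^sup>2 = (cmod (H \<omega>))\<^sup>2 / (c * c)"
      unfolding c(2) by (simp add: fourier_L1_cis H_def norm_mult norm_divide power_mult_distrib power_divide)
    ultimately have "e * (cmod (fourier_L1 h \<omega>))\<^sup>2 = s / c * (normal_density 0 s \<omega> * (cmod (H \<omega>))\<^sup>2)"
      by (simp only:) (use s c(1) in \<open>simp add: field_simps\<close>)
    moreover have "0 \<le> s / c" using s c(1) by simp
    ultimately show "ennreal (e * (cmod (fourier_L1 h \<omega>))\<^sup>2) =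
        ennreal (s / c) * (ennreal (normal_density 0 s \<omega>) * ennreal ((cmod (H \<omega>))\<^sup>2))"
      by (simp add: ennreal_mult del: times_divide_eq_left times_divide_eq_right)
  qed
  also have "\<dots> = ennreal (s / sqrt (2 * pi)) * (\<integral>\<^sup>+ \<omega>. ennreal ((cmod (H \<omega>))\<^sup>2) \<partial>gauss_measure s)"
    unfolding gauss_measure_def by (simp add: nn_integral_cmult nn_integral_density)
  also have "\<dots> \<le> ennreal (s / sqrt (2 * pi)) * ennreal (sqrt (2 * pi) / s * (norm_L2 h)\<^sup>2)"
    by (intro mult_left_mono main) auto
  also have "\<dots> = ennreal ((norm_L2 h)\<^sup>2)"
    using s by (subst ennreal_mult[symmetric]) auto
  finally show ?thesis .
qed

lemma gauss_damping_tendsto_1: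
  "(\<lambda>n. exp (- (\<omega>\<^sup>2 / (2 * (real (Suc n))\<^sup>2)))) \<longlonglongrightarrow> 1" for \<omega> :: real
proof -
  have "(\<lambda>n. \<omega>\<^sup>2 / 2 * (inverse (real (Suc n)))\<^sup>2) \<longlonglongrightarrow> \<omega>\<^sup>2 / 2 * 0\<^sup>2"
    by (intro tendsto_intros LIMSEQ_inverse_real_of_nat)
  from tendsto_exp[OF tendsto_minus[OF this]] show ?thesis by (simp add: field_simps)
qed

text \<open>Half of Plancherel's theorem, obtained from the damped inequality by removing the damping with
Fatou's lemma.\<close>

lemma plancherel_le:
  assumes h: "integrable lborel h" "square_integrable h"
  shows "square_integrable (fourier_L1 h) \<and> norm_L2 (fourier_L1 h) \<le> norm_L2 h"
proof -
  note [measurable] = h(2)[THEN square_integrable_measurable]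
  define F where "F = fourier_L1 h"
  have [measurable]: "F \<in> borel_measurable borel" unfolding F_def by measurable
  define d where "d = (\<lambda>n \<omega>. exp (- (\<omega>\<^sup>2 / (2 * (real (Suc n))\<^sup>2))))"
  have d1: "(\<lambda>n. d n \<omega>) \<longlonglongrightarrow> 1" for \<omega>
    unfolding d_def by (rule gauss_damping_tendsto_1)
  have "(\<integral>\<^sup>+ \<omega>. ennreal ((cmod (F \<omega>))\<^sup>2) \<partial>lborel) =
      (\<integral>\<^sup>+ \<omega>. liminf (\<lambda>n. ennreal (d n \<omega> * (cmod (F \<omega>))\<^sup>2)) \<partial>lborel)"
  proof (intro nn_integral_cong)
    fix \<omega> :: real
    have "(\<lambda>n. ennreal (d n \<omega> * (cmod (F \<omega>))\<^sup>2)) \<longlonglongrightarrow> ennreal (1 * (cmod (F \<omega>))\<^sup>2)"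
      by (intro tendsto_ennrealI tendsto_mult d1 tendsto_const)
    then show "ennreal ((cmod (F \<omega>))\<^sup>2) = liminf (\<lambda>n. ennreal (d n \<omega> * (cmod (F \<omega>))\<^sup>2))"
      using lim_imp_Liminf[OF sequentially_bot] by fastforce
  qed
  also have "\<dots> \<le> liminf (\<lambda>n. \<integral>\<^sup>+ \<omega>. ennreal (d n \<omega> * (cmod (F \<omega>))\<^sup>2) \<partial>lborel)"
    by (rule nn_integral_liminf) (auto simp: d_def)
  also have "\<dots> \<le> liminf (\<lambda>n. ennreal ((norm_L2 h)\<^sup>2))"
    unfolding d_def F_def
    by (intro Liminf_mono always_eventually allI plancherel_gauss_damped h) auto
  also have "\<dots> = ennreal ((norm_L2 h)\<^sup>2)"
    by (rule Liminf_const) simp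
  finally have "square_integrable F \<and> (norm_L2 F)\<^sup>2 \<le> (norm_L2 h)\<^sup>2"
    by (intro square_integrableI_bounded) auto
  then show ?thesis by (auto simp: F_def power2_le_iff_abs_le)
qed

text \<open>For integrable functions this is the multiplication formula with a Gaussian-damped character. Both sides
are pairings with square-integrable functions, so the identity survives the mean-square limits
that define the \<open>L\<^sup>2\<close> transform.\<close>

lemma gauss_regularized_inversion:
  assumes fg: "has_fourier_L2 f g" and s: "s > 0"
  shows "(LINT \<omega>|lborel. g \<omega> * (exp (- (\<omega>\<^sup>2 / (2 * s\<^sup>2))) *\<^sub>R cis (t * \<omega>))) =
    sqrt (2 * pi) *\<^sub>R (LINT x|lborel. f x * complex_of_real (normal_density 0 (1 / s) (t - x)))"
proof -
  from fg obtain h where f: "square_integrable f" and g: "square_integrable g"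
    and h: "\<And>n. integrable lborel (h n)" "\<And>n. square_integrable (h n)"
    and lim: "tendsto_L2 h f" "tendsto_L2 (\<lambda>n. fourier_L1 (h n)) g"
    by (auto simp: has_fourier_L2_def)
  interpret M: prob_space "gauss_measure s" by (rule prob_space_gauss_measure[OF s])
  define v where "v = (\<lambda>\<omega>. complex_of_real (normal_density 0 s \<omega>) * cis (t * \<omega>))"
  define w where "w = (\<lambda>x. complex_of_real (exp (- (s * (t - x))\<^sup>2 / 2)))"
  have gint: "integrable lborel (\<lambda>x. exp (- (r * (t - x))\<^sup>2))" if "r > 0" for r t :: real
  proof -
    have "integrable lborel (\<lambda>x. normal_density 0 (1 / (sqrt 2 * r)) (t + (-1) * x))"
      using that by (intro lborel_integrable_real_affine integrable_normal_density) auto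
    then have "integrable lborel (\<lambda>x. sqrt (2 * pi) / (sqrt 2 * r) * normal_density 0 (1 / (sqrt 2 * r)) (t - x))"
      by (intro integrable_mult_right) simp
    then show ?thesis
      using that by (subst (asm) gauss_kernel_density[symmetric]) (auto simp: power_mult_distrib)
  qed
  have v: "square_integrable v"
  proof -
    have "integrable lborel (\<lambda>x. (1 / sqrt (2 * pi * s\<^sup>2))\<^sup>2 * exp (- ((1 / s) * (0 - x))\<^sup>2))"
      using s by (intro integrable_mult_right gint) auto
    also have "(\<lambda>x. (1 / sqrt (2 * pi * s\<^sup>2))\<^sup>2 * exp (- ((1 / s) * (0 - x))\<^sup>2)) = (\<lambda>x. (normal_density 0 s x)\<^sup>2)"
      using s by (auto simp: normal_density_def power_mult_distrib power_divide
          fun_eq_iff simp flip: exp_double)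
    also have "\<dots> = (\<lambda>x. (cmod (v x))\<^sup>2)"
      by (simp add: v_def norm_mult)
    finally show ?thesis by (simp add: square_integrable_def v_def)
  qed
  have w: "square_integrable w"
  proof -
    have "integrable lborel (\<lambda>x. exp (- (s * (t - x))\<^sup>2))"
      using s by (intro gint)
    also have "(\<lambda>x. exp (- (s * (t - x))\<^sup>2)) = (\<lambda>x. (cmod (w x))\<^sup>2)"
      by (auto simp: w_def fun_eq_iff simp flip: exp_double)
    finally show ?thesis by (simp add: square_integrable_def w_def)
  qed
  have n: "(LINT \<omega>|lborel. fourier_L1 (h n) \<omega> * v \<omega>) =
      complex_of_real (1 / sqrt (2 * pi)) * (LINT x|lborel. h n x * w x)" for n
  proof -
    note [measurable] = h(2)[THEN square_integrable_measurable]
    have "(LINT \<omega>|gauss_measure s. cis (t * \<omega>) * (LINT x|lborel. h n x * cis (- (x * \<omega>)))) =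
        (LINT x|lborel. h n x * (LINT \<omega>|gauss_measure s. cis (t * \<omega>) * cis (- (x * \<omega>))))"
      by (rule fourier_multiplication_formula[where C=1]) (auto intro: h M.finite_measure_axioms)
    also have "\<dots> = (LINT x|lborel. h n x * w x)"
      using gauss_measure_char[OF s, of "t - x" for x]
      unfolding w_def by (simp add: cis_mult algebra_simps)
    finally have "(LINT x|lborel. h n x * w x) =
      (LINT \<omega>|lborel. normal_density 0 s \<omega> *\<^sub>R (cis (t * \<omega>) * (LINT x|lborel. h n x * cis (- (x * \<omega>)))))"
      by (subst (asm) integral_gauss_measure) auto
    then show ?thesis
      unfolding fourier_L1_cis v_def
      by (simp add: scaleR_conv_of_real mult_ac)
  qed
  have "(\<lambda>n. LINT \<omega>|lborel. fourier_L1 (h n) \<omega> * v \<omega>) \<longlonglongrightarrow> (LINT \<omega>|lborel. g \<omega> * v \<omega>)"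
    using plancherel_le[OF h] by (intro tendsto_L2_integral_mult lim g v) auto
  moreover have "(\<lambda>n. complex_of_real (1 / sqrt (2 * pi)) * (LINT x|lborel. h n x * w x))
      \<longlonglongrightarrow> complex_of_real (1 / sqrt (2 * pi)) * (LINT x|lborel. f x * w x)"
    by (intro tendsto_mult_left tendsto_L2_integral_mult lim h f w)
  ultimately have "(LINT \<omega>|lborel. g \<omega> * v \<omega>) = complex_of_real (1 / sqrt (2 * pi)) * (LINT x|lborel. f x * w x)"
    unfolding n by (rule LIMSEQ_unique)
  moreover have "(LINT \<omega>|lborel. g \<omega> * (exp (- (\<omega>\<^sup>2 / (2 * s\<^sup>2))) *\<^sub>R cis (t * \<omega>))) =
      complex_of_real (s * sqrt (2 * pi)) * (LINT \<omega>|lborel. g \<omega> * v \<omega>)"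
    unfolding v_def using s
    by (subst integral_mult_right_zero[symmetric])
       (auto intro!: Bochner_Integration.integral_cong simp: normal_density_def scaleR_conv_of_real real_sqrt_mult)
  moreover have "(LINT x|lborel. f x * w x) = complex_of_real (sqrt (2 * pi) / s) *
      (LINT x|lborel. f x * complex_of_real (normal_density 0 (1 / s) (t - x)))"
    by (subst integral_mult_right_zero[symmetric])
       (simp only: w_def gauss_kernel_density[OF s] of_real_mult mult_ac)
  ultimately show ?thesis
    using s by (simp add: scaleR_conv_of_real)
qed

text \<open>Normal densities of shrinking width form an approximate identity. As \<open>f\<close> need not be bounded, it is cut at
distance 1 from \<open>t\<close>: the near part is bounded by compactness, and the far part is handled by
\<open>2|f| N \<le> |f|\<^sup>2 + N\<^sup>2\<close> together with the smallness of \<open>N\<close> away from its centre.\<close>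

lemma gauss_approximate_identity:
  assumes f: "square_integrable f" and cont: "continuous_on UNIV f"
  shows "(\<lambda>n. LINT x|lborel. f x * complex_of_real (normal_density 0 (1 / real (Suc n)) (t - x))) \<longlonglongrightarrow> f t"
proof -
  note [measurable] = f[THEN square_integrable_measurable]
  define r where "r = (\<lambda>n. real (Suc n))"
  have r: "r n \<ge> 1" for n by (simp add: r_def)
  define N where "N = (\<lambda>n x. normal_density 0 (1 / r n) (t - x))"
  have [measurable]: "N n \<in> borel_measurable borel" for n unfolding N_def by measurable
  define S where "S = {x. \<bar>t - x\<bar> \<le> 1}"
  have [measurable]: "S \<in> sets borel" unfolding S_def by measurable
  define f1 where "f1 = (\<lambda>x. indicator S x *\<^sub>R f x)"
  define f2 where "f2 = (\<lambda>x. indicator (- S) x *\<^sub>R f x)"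
  have [measurable]: "f1 \<in> borel_measurable borel" "f2 \<in> borel_measurable borel"
    unfolding f1_def f2_def by measurable
  have Nscale: "N n (t - y / r n) = r n * std_normal_density y" for n y
    using r[of n] by (simp add: N_def normal_density_def power_divide power_mult_distrib real_sqrt_divide field_simps)
  have "bounded (f ` {t - 1..t + 1})"
    by (intro compact_imp_bounded compact_continuous_image continuous_on_subset[OF cont]) auto
  then obtain B where B: "\<forall>x\<in>{t - 1..t + 1}. cmod (f x) \<le> B"
    unfolding bounded_iff by blast
  have B: "cmod (f1 x) \<le> \<bar>B\<bar>" for x
  proof (cases "x \<in> S")
    case True
    then have "x \<in> {t - 1..t + 1}" by (auto simp: S_def)
    then have "cmod (f x) \<le> B" using B by blast
    with True show ?thesis by (simp add: f1_def)
  qed (simp add: f1_def)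
  have lim1: "(\<lambda>n. LINT x|lborel. f1 x * complex_of_real (N n x)) \<longlonglongrightarrow> f t"
  proof -
    have eq: "(LINT x|lborel. f1 x * complex_of_real (N n x)) =
        (LINT y|lborel. f1 (t - y / r n) * complex_of_real (std_normal_density y))" for n
      using r[of n]
      by (subst lborel_integral_real_affine[of "- (1 / r n)" _ t])
         (auto simp: Nscale scaleR_conv_of_real mult_ac simp flip: integral_mult_right_zero)
    have "(\<lambda>n. LINT y|lborel. f1 (t - y / r n) * complex_of_real (std_normal_density y)) \<longlonglongrightarrow>
        (LINT y|lborel. f t * complex_of_real (std_normal_density y))"
    proof (rule integral_dominated_convergence[where w="\<lambda>y. \<bar>B\<bar> * std_normal_density y"])
      show "AE y in lborel. (\<lambda>n. f1 (t - y / r n) * complex_of_real (std_normal_density y))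
          \<longlonglongrightarrow> f t * complex_of_real (std_normal_density y)"
      proof (intro AE_I2 tendsto_mult_right)
        fix y :: real
        have "(\<lambda>n. t - y * inverse (real (Suc n))) \<longlonglongrightarrow> t - y * 0"
          by (intro tendsto_intros LIMSEQ_inverse_real_of_nat)
        then have l: "(\<lambda>n. t - y / r n) \<longlonglongrightarrow> t" by (simp add: r_def field_simps)
        have "isCont f t" using cont by (simp add: continuous_on_eq_continuous_at)
        then have "(\<lambda>n. f (t - y / r n)) \<longlonglongrightarrow> f t"
          by (rule isCont_tendsto_compose[OF _ l])
        moreover have "\<forall>\<^sub>F n in sequentially. dist (t - y / r n) t < 1"
          using l by (rule tendstoD) simp
        then have "\<forall>\<^sub>F n in sequentially. f1 (t - y / r n) = f (t - y / r n)"
          by eventually_elim (auto simp: f1_def S_def dist_real_def)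
        ultimately show "(\<lambda>n. f1 (t - y / r n)) \<longlonglongrightarrow> f t"
          by (simp add: tendsto_cong)
      qed
      show "AE y in lborel. norm (f1 (t - y / r n) * complex_of_real (std_normal_density y)) \<le> \<bar>B\<bar> * std_normal_density y" for n
        using B by (auto simp: norm_mult intro!: mult_right_mono)
    qed auto
    also have "(LINT y|lborel. f t * complex_of_real (std_normal_density y)) = f t"
      by simp
    finally show ?thesis unfolding eq .
  qed
  define w where "w = (\<lambda>x. (cmod (f x))\<^sup>2 + 2 * (exp (- (t - x)\<^sup>2 / 4))\<^sup>2)"
  have wint: "integrable lborel w"
  proof -
    have "integrable lborel (\<lambda>x. sqrt (2 * pi) * normal_density 0 1 (t + (-1) * x))"
      by (intro integrable_mult_right lborel_integrable_real_affine integrable_normal_density) auto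
    then have "integrable lborel (\<lambda>x. (exp (- (t - x)\<^sup>2 / 4))\<^sup>2)"
      by (simp add: std_normal_density_def flip: exp_double)
    then show ?thesis
      using f unfolding w_def by (auto simp: square_integrable_def)
  qed
  \<comment> \<open>Half of the exponent is at least \<open>r\<^sup>2/4\<close> and gives a factor that tends to 0 with growing \<open>n\<close>; the other half is at least \<open>(t-x)\<^sup>2/4\<close> and gives a fixed square-integrable Gaussian.\<close>
  have Nfar: "N n x \<le> r n * exp (- (r n)\<^sup>2 / 4) * exp (- (t - x)\<^sup>2 / 4)" if "x \<notin> S" for n x
  proof -
    have "1 < \<bar>t - x\<bar>" using that by (auto simp: S_def)
    then have a: "1 \<le> (t - x)\<^sup>2" using one_le_power[of "\<bar>t - x\<bar>" 2] by simp
    have b: "1 \<le> (r n)\<^sup>2" using r[of n] using one_le_power[of "r n" 2] by simp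
    have "0 \<le> ((t - x)\<^sup>2 - 1) * ((r n)\<^sup>2) + (t - x)\<^sup>2 * ((r n)\<^sup>2 - 1)"
      using a b by (intro add_nonneg_nonneg mult_nonneg_nonneg) auto
    then have "- ((r n)\<^sup>2 * (t - x)\<^sup>2) / 2 \<le> - (r n)\<^sup>2 / 4 + (- (t - x)\<^sup>2 / 4)"
      by (simp add: algebra_simps)
    then have e: "exp (- ((r n)\<^sup>2 * (t - x)\<^sup>2) / 2) \<le> exp (- (r n)\<^sup>2 / 4) * exp (- (t - x)\<^sup>2 / 4)"
      by (simp flip: exp_add)
    have "1 \<le> sqrt (2 * pi)" using pi_gt3 by simp
    then have "r n / sqrt (2 * pi) \<le> r n" using r[of n] by (simp add: field_simps)
    moreover have "N n x = r n / sqrt (2 * pi) * exp (- ((r n)\<^sup>2 * (t - x)\<^sup>2) / 2)"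
      using r[of n] by (simp add: N_def normal_density_def power_divide real_sqrt_divide real_sqrt_mult field_simps)
    ultimately have "N n x \<le> r n * (exp (- (r n)\<^sup>2 / 4) * exp (- (t - x)\<^sup>2 / 4))"
      using e r[of n] by (simp only:) (intro mult_mono, auto)
    then show ?thesis by (simp add: mult_ac)
  qed
  have rexp: "r n * exp (- (r n)\<^sup>2 / 4) \<le> 1" for n
  proof -
    have "0 \<le> (r n / 2 - 1)\<^sup>2" by simp
    then have "r n \<le> 1 + (r n)\<^sup>2 / 4" by (simp add: power2_eq_square field_simps)
    also have "\<dots> \<le> exp ((r n)\<^sup>2 / 4)" by (rule exp_ge_add_one_self)
    finally show ?thesis by (simp add: exp_minus field_simps)
  qed
  have rexp0: "(\<lambda>n. r n * exp (- (r n)\<^sup>2 / 4)) \<longlonglongrightarrow> 0"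
  proof (rule Lim_null_comparison)
    show "\<forall>\<^sub>F n in sequentially. norm (r n * exp (- (r n)\<^sup>2 / 4)) \<le> 64 * inverse (real (Suc n))"
    proof (intro always_eventually allI)
      fix n
      have "(r n)\<^sup>2 / 8 \<le> exp ((r n)\<^sup>2 / 8)"
        using exp_ge_add_one_self[of "(r n)\<^sup>2 / 8"] by linarith
      then have "((r n)\<^sup>2 / 8)\<^sup>2 \<le> (exp ((r n)\<^sup>2 / 8))\<^sup>2" by (intro power_mono) auto
      then have e: "(r n)^4 / 64 \<le> exp ((r n)\<^sup>2 / 4)" by (simp add: power_divide flip: exp_double)
      have "r n * r n = (r n)^2 * 1" by (simp add: power2_eq_square)
      also have "\<dots> \<le> (r n)^2 * (r n)^2" using r[of n] by (intro mult_left_mono one_le_power) auto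
      also have "\<dots> \<le> 64 * exp ((r n)\<^sup>2 / 4)" using e by (simp flip: power_add)
      finally have "r n * r n \<le> 64 * exp ((r n)\<^sup>2 / 4)" .
      then have "r n * exp (- (r n)\<^sup>2 / 4) \<le> 64 * inverse (r n)"
        using r[of n] by (simp add: exp_minus field_simps)
      then show "norm (r n * exp (- (r n)\<^sup>2 / 4)) \<le> 64 * inverse (real (Suc n))"
        using r[of n] by (simp add: r_def)
    qed
    show "(\<lambda>n. 64 * inverse (real (Suc n))) \<longlonglongrightarrow> 0"
      using tendsto_mult_left[OF LIMSEQ_inverse_real_of_nat, of 64] by simp
  qed
  have lim2: "(\<lambda>n. LINT x|lborel. f2 x * complex_of_real (N n x)) \<longlonglongrightarrow> integral\<^sup>L lborel (\<lambda>x::real. 0::complex)"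
  proof (rule integral_dominated_convergence[where w=w])
    have bd: "norm (f2 x * complex_of_real (N n x)) \<le> r n * exp (- (r n)\<^sup>2 / 4) * w x" for n x
    proof (cases "x \<in> S")
      case False
      have N0: "0 \<le> N n x" by (simp add: N_def)
      have "norm (f2 x * complex_of_real (N n x)) = cmod (f x) * N n x"
        using False N0 by (simp add: f2_def norm_mult)
      also have "\<dots> \<le> cmod (f x) * (r n * exp (- (r n)\<^sup>2 / 4) * exp (- (t - x)\<^sup>2 / 4))"
        by (intro mult_left_mono Nfar False) auto
      also have "\<dots> = r n * exp (- (r n)\<^sup>2 / 4) * (cmod (f x) * exp (- (t - x)\<^sup>2 / 4))"
        by simp
      also have "\<dots> \<le> r n * exp (- (r n)\<^sup>2 / 4) * w x"
      proof (intro mult_left_mono)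
        have "2 * (cmod (f x) * exp (- (t - x)\<^sup>2 / 4)) \<le> (cmod (f x))\<^sup>2 + (exp (- (t - x)\<^sup>2 / 4))\<^sup>2"
          using sum_squares_bound[of "cmod (f x)" "exp (- (t - x)\<^sup>2 / 4)"] by simp
        moreover have "0 \<le> cmod (f x) * exp (- (t - x)\<^sup>2 / 4)" "0 \<le> (exp (- (t - x)\<^sup>2 / 4))\<^sup>2" by auto
        ultimately show "cmod (f x) * exp (- (t - x)\<^sup>2 / 4) \<le> w x"
          unfolding w_def by linarith
      qed (use r[of n] in auto)
      finally show ?thesis .
    qed (use r[of n] in \<open>auto simp: f2_def w_def\<close>)
    show "AE x in lborel. (\<lambda>n. f2 x * complex_of_real (N n x)) \<longlonglongrightarrow> 0"
    proof (rule AE_I2, rule Lim_null_comparison)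
      fix x
      show "\<forall>\<^sub>F n in sequentially. norm (f2 x * complex_of_real (N n x)) \<le> r n * exp (- (r n)\<^sup>2 / 4) * w x"
        using bd by simp
      show "(\<lambda>n. r n * exp (- (r n)\<^sup>2 / 4) * w x) \<longlonglongrightarrow> 0"
        using tendsto_mult_right[OF rexp0, of "w x"] by simp
    qed
    show "AE x in lborel. norm (f2 x * complex_of_real (N n x)) \<le> w x" for n
    proof (rule AE_I2)
      fix x
      have "r n * exp (- (r n)\<^sup>2 / 4) * w x \<le> 1 * w x"
        by (intro mult_right_mono rexp) (simp add: w_def)
      then show "norm (f2 x * complex_of_real (N n x)) \<le> w x" using bd[of x n] by simp
    qed
  qed (use wint in auto)
  have i1: "integrable lborel (\<lambda>x. f1 x * complex_of_real (N n x))" for n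
  proof (rule Bochner_Integration.integrable_bound)
    have "integrable lborel (\<lambda>x. normal_density 0 (1 / r n) (t + (-1) * x))"
      using r[of n] by (intro lborel_integrable_real_affine integrable_normal_density) auto
    then show "integrable lborel (\<lambda>x. \<bar>B\<bar> * N n x)" by (simp add: N_def)
    show "AE x in lborel. norm (f1 x * complex_of_real (N n x)) \<le> norm (\<bar>B\<bar> * N n x)"
      using B by (auto simp: norm_mult abs_mult intro!: mult_right_mono)
  qed measurable
  have i2: "integrable lborel (\<lambda>x. f2 x * complex_of_real (N n x))" for n
  proof (rule Bochner_Integration.integrable_bound[OF wint])
    show "AE x in lborel. norm (f2 x * complex_of_real (N n x)) \<le> norm (w x)"
    proof (rule AE_I2)
      fix x
      show "norm (f2 x * complex_of_real (N n x)) \<le> norm (w x)"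
      proof (cases "x \<in> S")
        case False
        have w0: "0 \<le> w x" by (simp add: w_def)
        have N0: "0 \<le> N n x" by (simp add: N_def)
        have "N n x \<le> 1 * exp (- (t - x)\<^sup>2 / 4)"
          by (rule order_trans[OF Nfar[OF False]]) (intro mult_right_mono rexp, simp)
        then have "cmod (f x) * N n x \<le> cmod (f x) * exp (- (t - x)\<^sup>2 / 4)"
          by (intro mult_left_mono) auto
        moreover have "2 * (cmod (f x) * exp (- (t - x)\<^sup>2 / 4)) \<le> (cmod (f x))\<^sup>2 + (exp (- (t - x)\<^sup>2 / 4))\<^sup>2"
          using sum_squares_bound[of "cmod (f x)" "exp (- (t - x)\<^sup>2 / 4)"] by simp
        moreover have "0 \<le> cmod (f x) * exp (- (t - x)\<^sup>2 / 4)" "0 \<le> (exp (- (t - x)\<^sup>2 / 4))\<^sup>2" by auto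
        ultimately have "cmod (f x) * N n x \<le> w x" unfolding w_def by linarith
        then show ?thesis using False N0 w0 by (simp add: f2_def norm_mult)
      qed (simp add: f2_def)
    qed
  qed measurable
  have "(LINT x|lborel. f x * complex_of_real (N n x)) =
      (LINT x|lborel. f1 x * complex_of_real (N n x)) + (LINT x|lborel. f2 x * complex_of_real (N n x))" for n
    by (subst Bochner_Integration.integral_add[OF i1 i2, symmetric])
       (auto intro!: Bochner_Integration.integral_cong simp: f1_def f2_def indicator_def)
  then show ?thesis
    using tendsto_add[OF lim1 lim2] by (simp add: N_def r_def)
qed

section \<open>Band-limited functions as Fourier integrals\<close>

lemma square_integrable_compact_support_integrable:
  assumes g: "square_integrable g" and ae: "AE \<omega> in lborel. \<bar>\<omega>\<bar> \<ge> \<delta> \<longrightarrow> g \<omega> = 0"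
  shows "integrable lborel g"
proof (rule Bochner_Integration.integrable_bound)
  note [measurable] = g[THEN square_integrable_measurable]
  show "integrable lborel (\<lambda>x. (cmod (g x))\<^sup>2 + indicator {-\<delta>..\<delta>} x)"
    using g by (intro Bochner_Integration.integrable_add integrable_real_indicator)
      (auto simp: square_integrable_def emeasure_lborel_Icc_eq)
  show "g \<in> borel_measurable lborel" by measurable
  show "AE x in lborel. norm (g x) \<le> norm ((cmod (g x))\<^sup>2 + indicator {-\<delta>..\<delta>} x)"
    using ae
  proof eventually_elim
    fix x assume x: "\<bar>x\<bar> \<ge> \<delta> \<longrightarrow> g x = 0"
    have "0 \<le> (cmod (g x) - 1)\<^sup>2" by simp
    then have "2 * cmod (g x) \<le> (cmod (g x))\<^sup>2 + 1" by (simp add: power2_diff)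
    moreover have "0 \<le> cmod (g x)" by simp
    ultimately have "cmod (g x) \<le> (cmod (g x))\<^sup>2 + 1" by linarith
    then show "norm (g x) \<le> norm ((cmod (g x))\<^sup>2 + indicator {-\<delta>..\<delta>} x)"
      using x by (cases "\<bar>x\<bar> \<ge> \<delta>") (auto simp: indicator_def)
  qed
qed

text \<open>The transform vanishes outside \<open>(-\<delta>, \<delta>)\<close> almost everywhere, hence is integrable, and the damping in the
regularized inversion formula can be removed by dominated convergence. Continuity of \<open>f\<close> makes
the inversion valid at every point.\<close>

lemma bandlimited_representation:
  assumes "bandlimited \<delta> f"
  obtains g where "square_integrable g" "integrable lborel g" "\<And>\<omega>. \<bar>\<omega>\<bar> \<ge> \<delta> \<Longrightarrow> g \<omega> = 0"
    "norm_L2 g \<le> norm_L2 f"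
    "\<And>t. f t = complex_of_real (1 / sqrt (2 * pi)) * (LINT \<omega>|lborel. g \<omega> * cis (t * \<omega>))"
proof -
  from assms obtain g0 where f: "square_integrable f" and cont: "continuous_on UNIV f"
    and fg: "has_fourier_L2 f g0" and ae: "AE \<omega> in lborel. \<bar>\<omega>\<bar> \<ge> \<delta> \<longrightarrow> g0 \<omega> = 0"
    by (auto simp: bandlimited_def)
  from fg obtain h where g0: "square_integrable g0"
    and h: "\<And>n. integrable lborel (h n)" "\<And>n. square_integrable (h n)"
    and lim: "tendsto_L2 h f" "tendsto_L2 (\<lambda>n. fourier_L1 (h n)) g0"
    by (auto simp: has_fourier_L2_def)
  note [measurable] = g0[THEN square_integrable_measurable]
  have le0: "norm_L2 g0 \<le> norm_L2 f"
    using plancherel_le[OF h] by (intro norm_L2_le_of_tendsto_L2[OF h(2) f lim(1) _ g0 lim(2)]) auto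
  have int0: "integrable lborel g0"
    by (rule square_integrable_compact_support_integrable[OF g0 ae])
  define g where "g = (\<lambda>\<omega>. if \<bar>\<omega>\<bar> \<ge> \<delta> then 0 else g0 \<omega>)"
  have [measurable]: "g \<in> borel_measurable borel" unfolding g_def by measurable
  have aeg: "AE \<omega> in lborel. g \<omega> = g0 \<omega>"
    using ae by eventually_elim (auto simp: g_def)
  have int: "integrable lborel g"
    using int0 aeg by (subst integrable_cong_AE[of g _ g0]) auto
  have "integrable lborel (\<lambda>\<omega>. (cmod (g \<omega>))\<^sup>2)"
  proof (subst integrable_cong_AE[of _ _ "\<lambda>\<omega>. (cmod (g0 \<omega>))\<^sup>2"])
    show "AE \<omega> in lborel. (cmod (g \<omega>))\<^sup>2 = (cmod (g0 \<omega>))\<^sup>2"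
      using aeg by eventually_elim simp
    show "integrable lborel (\<lambda>\<omega>. (cmod (g0 \<omega>))\<^sup>2)" using g0 by (simp add: square_integrable_def)
  qed auto
  then have sq: "square_integrable g" by (simp add: square_integrable_def)
  have "norm_L2 g = norm_L2 g0"
    unfolding norm_L2_def
    by (intro arg_cong[where f=sqrt] integral_cong_AE) (use aeg in \<open>auto elim: eventually_mono\<close>)
  with le0 have le: "norm_L2 g \<le> norm_L2 f" by simp
  have inv: "f t = complex_of_real (1 / sqrt (2 * pi)) * (LINT \<omega>|lborel. g \<omega> * cis (t * \<omega>))" for t
  proof -
    define d where "d = (\<lambda>n \<omega>. exp (- (\<omega>\<^sup>2 / (2 * (real (Suc n))\<^sup>2))))"
    have d1: "(\<lambda>n. d n \<omega>) \<longlonglongrightarrow> 1" for \<omega>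
      unfolding d_def by (rule gauss_damping_tendsto_1)
    have [measurable]: "d n \<in> borel_measurable borel" for n unfolding d_def by measurable
    have "(\<lambda>n. LINT \<omega>|lborel. g0 \<omega> * (d n \<omega> *\<^sub>R cis (t * \<omega>))) \<longlonglongrightarrow>
        (LINT \<omega>|lborel. g0 \<omega> * (1 *\<^sub>R cis (t * \<omega>)))"
    proof (rule integral_dominated_convergence[where w="\<lambda>\<omega>. cmod (g0 \<omega>)"])
      show "AE \<omega> in lborel. (\<lambda>n. g0 \<omega> * (d n \<omega> *\<^sub>R cis (t * \<omega>))) \<longlonglongrightarrow> g0 \<omega> * (1 *\<^sub>R cis (t * \<omega>))"
        by (intro AE_I2 tendsto_intros d1)
      show "AE \<omega> in lborel. norm (g0 \<omega> * (d n \<omega> *\<^sub>R cis (t * \<omega>))) \<le> cmod (g0 \<omega>)" for n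
        by (auto simp: norm_mult d_def intro!: mult_left_le_one_le)
    qed (use int0 in auto)
    moreover have "(\<lambda>n. LINT \<omega>|lborel. g0 \<omega> * (d n \<omega> *\<^sub>R cis (t * \<omega>))) \<longlonglongrightarrow> sqrt (2 * pi) *\<^sub>R f t"
      unfolding d_def gauss_regularized_inversion[OF fg of_nat_0_less_iff[THEN iffD2, OF zero_less_Suc]]
      by (intro tendsto_scaleR tendsto_const gauss_approximate_identity f cont)
    ultimately have "(LINT \<omega>|lborel. g0 \<omega> * (1 *\<^sub>R cis (t * \<omega>))) = sqrt (2 * pi) *\<^sub>R f t"
      by (rule LIMSEQ_unique)
    moreover have "(LINT \<omega>|lborel. g \<omega> * cis (t * \<omega>)) = (LINT \<omega>|lborel. g0 \<omega> * cis (t * \<omega>))"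
      by (rule integral_cong_AE) (use aeg in \<open>auto elim: eventually_mono\<close>)
    ultimately have "(LINT \<omega>|lborel. g \<omega> * cis (t * \<omega>)) = complex_of_real (sqrt (2 * pi)) * f t"
      by (simp add: scaleR_conv_of_real)
    then show ?thesis by simp
  qed
  show thesis
    by (rule that[OF sq int _ le inv]) (simp add: g_def)
qed

section \<open>Fourier coefficients on a period\<close>

definition period_measure :: "real \<Rightarrow> real measure" where
  "period_measure b = restrict_space lborel {b..b + 2 * pi}"

lemma space_period_measure [simp]: "space (period_measure b) = {b..b + 2 * pi}"
  by (simp add: period_measure_def space_restrict_space)

lemma measurable_period_measure [measurable (raw)]:
  "u \<in> borel_measurable borel \<Longrightarrow> u \<in> borel_measurable (period_measure b)"
  unfolding period_measure_def by (intro measurable_restrict_space1) simp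

lemma finite_measure_period_measure: "finite_measure (period_measure b)"
  by (rule finite_measureI)
     (simp add: period_measure_def emeasure_restrict_space space_restrict_space)

lemma integral_period_measure:
  fixes u :: "real \<Rightarrow> 'b :: {banach, second_countable_topology}"
  shows "(LINT x|period_measure b. u x) = (LINT x|lborel. indicator {b..b + 2 * pi} x *\<^sub>R u x)"
  unfolding period_measure_def by (rule integral_restrict_space) simp

lemma integral_period_measure_FTC:
  fixes u :: "real \<Rightarrow> complex"
  assumes "\<And>x. (F has_vector_derivative u x) (at x)" and "continuous_on UNIV u"
  shows "(LINT x|period_measure b. u x) = F (b + 2 * pi) - F b"
  unfolding integral_period_measure
  by (rule integral_FTC_atLeastAtMost)
     (auto intro: has_vector_derivative_at_within assms continuous_on_subset[OF assms(2)])

lemma cis_has_vector_derivative: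
  "((\<lambda>x. cis (a * x)) has_vector_derivative \<i> * complex_of_real a * cis (a * x)) (at x within S)"
  unfolding has_vector_derivative_def
  by (rule derivative_eq_intros refl)+ (auto simp: fun_eq_iff scaleR_conv_of_real)

lemma cis_period: "cis (real_of_int k * (x + 2 * pi)) = cis (real_of_int k * x)"
proof -
  have "cis (real_of_int k * (x + 2 * pi)) = cis (real_of_int k * x) * cis (2 * pi * real_of_int k)"
    by (simp add: cis_mult algebra_simps)
  then show ?thesis by simp
qed

lemma integral_cis_period:
  "(LINT x|period_measure b. cis (real_of_int j * x)) = (if j = 0 then 2 * complex_of_real pi else 0)"
proof (cases "j = 0")
  case True
  have "(LINT x|period_measure b. (1::complex)) = complex_of_real (b + 2 * pi) - complex_of_real b"
    by (rule integral_period_measure_FTC)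
       (auto intro!: derivative_eq_intros simp: has_vector_derivative_complex_iff)
  with True show ?thesis by simp
next
  case False
  have "(LINT x|period_measure b. cis (real_of_int j * x)) =
     (1 / (\<i> * of_int j)) * cis (real_of_int j * (b + 2 * pi)) - (1 / (\<i> * of_int j)) * cis (real_of_int j * b)"
  proof (rule integral_period_measure_FTC)
    fix x
    show "((\<lambda>x. (1 / (\<i> * of_int j)) * cis (real_of_int j * x)) has_vector_derivative cis (real_of_int j * x)) (at x)"
      by (rule has_vector_derivative_eq_rhs[OF has_vector_derivative_mult_right[OF cis_has_vector_derivative]])
         (use False in simp)
  qed (intro continuous_intros)
  then show ?thesis using False by (simp add: cis_period)
qed

definition fourier_coeff :: "real \<Rightarrow> (real \<Rightarrow> complex) \<Rightarrow> int \<Rightarrow> complex" where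
  "fourier_coeff b u k = (LINT x|period_measure b. u x * cis (- (real_of_int k * x))) / (2 * pi)"

lemma period_integrable_cis:
  assumes [measurable]: "u \<in> borel_measurable borel" and u: "integrable (period_measure b) u"
  shows "integrable (period_measure b) (\<lambda>x. u x * cis (a * x))"
  by (rule Bochner_Integration.integrable_bound[OF u]) (auto simp: norm_mult)

lemma period_integrable_of_square:
  fixes u :: "real \<Rightarrow> complex"
  assumes [measurable]: "u \<in> borel_measurable borel" and u: "integrable (period_measure b) (\<lambda>x. (cmod (u x))\<^sup>2)"
  shows "integrable (period_measure b) u"
proof -
  interpret finite_measure "period_measure b" by (rule finite_measure_period_measure)
  show ?thesis
  proof (rule Bochner_Integration.integrable_bound)
    show "integrable (period_measure b) (\<lambda>x. 1 + (cmod (u x))\<^sup>2)" using u by auto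
    show "AE x in period_measure b. norm (u x) \<le> norm (1 + (cmod (u x))\<^sup>2)"
    proof (rule AE_I2)
      fix x
      have "0 \<le> (cmod (u x) - 1)\<^sup>2" by simp
      then have "2 * cmod (u x) \<le> (cmod (u x))\<^sup>2 + 1" by (simp add: power2_diff)
      moreover have "0 \<le> cmod (u x)" by simp
      ultimately have "cmod (u x) \<le> 1 + (cmod (u x))\<^sup>2" by linarith
      then show "norm (u x) \<le> norm (1 + (cmod (u x))\<^sup>2)" by simp
    qed
  qed measurable
qed

text \<open>The remainder \<open>u - T\<close> is orthogonal to the exponentials with index in \<open>K\<close>, so \<open>\<parallel>u - T\<parallel>\<^sup>2\<close> collapses to the
pairing of \<open>u - T\<close> with \<open>u\<close>.\<close>

lemma bessel_identity:
  fixes u :: "real \<Rightarrow> complex" and K :: "int set"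
  assumes [measurable]: "u \<in> borel_measurable borel" and u2: "integrable (period_measure b) (\<lambda>x. (cmod (u x))\<^sup>2)"
    and K: "finite K"
  defines "T \<equiv> (\<lambda>x. \<Sum>k\<in>K. fourier_coeff b u k * cis (real_of_int k * x))"
  shows "integrable (period_measure b) (\<lambda>x. (cmod (u x - T x))\<^sup>2)"
    and "(LINT x|period_measure b. (cmod (u x - T x))\<^sup>2) =
      (LINT x|period_measure b. (cmod (u x))\<^sup>2) - 2 * pi * (\<Sum>k\<in>K. (cmod (fourier_coeff b u k))\<^sup>2)"
proof -
  define M where "M = period_measure b"
  interpret M: finite_measure M unfolding M_def by (rule finite_measure_period_measure)
  have [measurable]: "w \<in> borel_measurable borel \<Longrightarrow> w \<in> borel_measurable M" for w :: "real \<Rightarrow> complex"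
    unfolding M_def by measurable
  define c where "c = fourier_coeff b u"
  define e where "e = (\<lambda>k x. cis (real_of_int k * x))"
  have [measurable]: "e k \<in> borel_measurable borel" for k unfolding e_def by measurable
  have T: "T x = (\<Sum>k\<in>K. c k * e k x)" for x by (simp add: T_def c_def e_def)
  have [measurable]: "T \<in> borel_measurable borel" unfolding T_def by measurable
  have u1: "integrable M u" unfolding M_def by (rule period_integrable_of_square[OF _ u2]) measurable
  have ecis: "cnj (e k x) = cis (- (real_of_int k * x))" for k x by (simp add: e_def cis_cnj)
  have uek: "(LINT x|M. u x * cnj (e k x)) = 2 * pi * c k" for k
    by (simp add: ecis c_def fourier_coeff_def M_def)
  have iu: "integrable M (\<lambda>x. u x * cnj (e k x))" for k
    using period_integrable_cis[OF _ u1[unfolded M_def], of "- real_of_int k"] by (simp add: ecis M_def)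
  have ieu: "integrable M (\<lambda>x. e k x * cnj (u x))" for k
    using iu[of k, THEN integrable_cnj] by (simp add: mult.commute)
  have ie: "integrable M (\<lambda>x. e j x * cnj (e k x))" for j k
    by (rule M.integrable_const_bound[where B=1]) (auto simp: e_def norm_mult)
  have ee: "(LINT x|M. e j x * cnj (e k x)) = (if j = k then 2 * complex_of_real pi else 0)" for j k
    using integral_cis_period[of b "j - k"] unfolding ecis unfolding e_def M_def cis_mult by (simp add: algebra_simps)
  have uu: "integrable M (\<lambda>x. u x * cnj (u x))"
    using integrable_of_real[OF u2, where 'a=complex] unfolding M_def[symmetric]
    by (simp only: complex_norm_square)
  have orth: "(LINT x|M. (u x - T x) * cnj (e k x)) = 0" if "k \<in> K" for k
  proof -
    have "(LINT x|M. (u x - T x) * cnj (e k x)) =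
      (LINT x|M. u x * cnj (e k x) - (\<Sum>j\<in>K. c j * (e j x * cnj (e k x))))"
      by (simp add: T left_diff_distrib sum_distrib_right mult.assoc)
    also have "\<dots> = 2 * pi * c k - (\<Sum>j\<in>K. c j * (if j = k then 2 * complex_of_real pi else 0))"
      using iu ie uek ee
      by (subst Bochner_Integration.integral_diff) (auto intro!: Bochner_Integration.integrable_sum)
    also have "\<dots> = 0" using that K by (simp add: if_distrib sum.delta cong: if_cong)
    finally show ?thesis .
  qed
  have cT: "cnj (T x) = (\<Sum>k\<in>K. cnj (c k) * cnj (e k x))" for x by (simp add: T)
  have iT: "integrable M (\<lambda>x. u x * cnj (T x))" "integrable M (\<lambda>x. T x * cnj (u x))"
    "integrable M (\<lambda>x. T x * cnj (e k x))" "integrable M (\<lambda>x. T x * cnj (T x))" for k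
  proof -
    have "integrable M (\<lambda>x. \<Sum>k\<in>K. cnj (c k) * (u x * cnj (e k x)))"
      using iu by auto
    then show "integrable M (\<lambda>x. u x * cnj (T x))" by (simp add: T sum_distrib_left mult_ac)
    have "integrable M (\<lambda>x. \<Sum>k\<in>K. c k * (e k x * cnj (u x)))"
      using ieu by auto
    then show "integrable M (\<lambda>x. T x * cnj (u x))" by (simp add: T sum_distrib_left sum_distrib_right mult_ac)
    have Te: "integrable M (\<lambda>x. T x * cnj (e k x))" for k
    proof -
      have "integrable M (\<lambda>x. \<Sum>j\<in>K. c j * (e j x * cnj (e k x)))"
        using ie by auto
      then show ?thesis by (simp add: T sum_distrib_left sum_distrib_right mult_ac)
    qed
    then show "integrable M (\<lambda>x. T x * cnj (e k x))" .
    have "integrable M (\<lambda>x. \<Sum>k\<in>K. cnj (c k) * (T x * cnj (e k x)))"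
      using Te by auto
    then show "integrable M (\<lambda>x. T x * cnj (T x))" by (simp add: cT sum_distrib_left mult_ac)
  qed
  have iD: "integrable M (\<lambda>x. (u x - T x) * cnj (u x - T x))"
    using uu iT by (simp add: algebra_simps)
  then have "integrable M (\<lambda>x. complex_of_real ((cmod (u x - T x))\<^sup>2))"
    by (simp only: complex_norm_square)
  then show "integrable (period_measure b) (\<lambda>x. (cmod (u x - T x))\<^sup>2)"
    unfolding M_def using integrable_Re by fastforce
  have iDe: "integrable M (\<lambda>x. (u x - T x) * cnj (e k x))" for k
    using iu iT by (simp add: left_diff_distrib)
  have iDu: "integrable M (\<lambda>x. (u x - T x) * cnj (u x))"
    using uu iT by (simp add: left_diff_distrib)
  have eu: "(LINT x|M. e k x * cnj (u x)) = 2 * pi * cnj (c k)" for k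
  proof -
    have "(LINT x|M. e k x * cnj (u x)) = (LINT x|M. cnj (u x * cnj (e k x)))"
      by (simp add: mult.commute)
    also have "\<dots> = cnj (2 * pi * c k)" by (simp only: Bochner_Integration.integral_cnj uek)
    finally show ?thesis by simp
  qed
  have "complex_of_real (LINT x|M. (cmod (u x - T x))\<^sup>2) = (LINT x|M. (u x - T x) * cnj (u x - T x))"
    by (simp only: complex_norm_square flip: integral_complex_of_real)
  also have "\<dots> = (LINT x|M. (u x - T x) * cnj (u x) - (\<Sum>k\<in>K. cnj (c k) * ((u x - T x) * cnj (e k x))))"
  proof -
    have "(u x - T x) * cnj (u x - T x) = (u x - T x) * cnj (u x) - (\<Sum>k\<in>K. cnj (c k) * ((u x - T x) * cnj (e k x)))" for x
      unfolding complex_cnj_diff cT right_diff_distrib sum_distrib_left by (simp only: mult_ac)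
    then show ?thesis by simp
  qed
  also have "\<dots> = (LINT x|M. (u x - T x) * cnj (u x)) - (\<Sum>k\<in>K. cnj (c k) * (LINT x|M. (u x - T x) * cnj (e k x)))"
    using iDe iDu by (subst Bochner_Integration.integral_diff) (auto intro!: Bochner_Integration.integrable_sum)
  also have "\<dots> = (LINT x|M. (u x - T x) * cnj (u x))"
    using orth by simp
  also have "\<dots> = (LINT x|M. u x * cnj (u x) - (\<Sum>k\<in>K. c k * (e k x * cnj (u x))))"
    by (simp add: T left_diff_distrib sum_distrib_right mult.assoc)
  also have "\<dots> = (LINT x|M. u x * cnj (u x)) - (\<Sum>k\<in>K. c k * (LINT x|M. e k x * cnj (u x)))"
    using ieu uu by (subst Bochner_Integration.integral_diff) (auto intro!: Bochner_Integration.integrable_sum)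
  also have "\<dots> = complex_of_real (LINT x|M. (cmod (u x))\<^sup>2) -
      complex_of_real (2 * pi * (\<Sum>k\<in>K. (cmod (c k))\<^sup>2))"
  proof -
    have "(LINT x|M. u x * cnj (u x)) = complex_of_real (LINT x|M. (cmod (u x))\<^sup>2)"
      by (simp only: complex_norm_square flip: integral_complex_of_real)
    moreover have "(\<Sum>k\<in>K. c k * (2 * pi * cnj (c k))) = complex_of_real (2 * pi * (\<Sum>k\<in>K. (cmod (c k))\<^sup>2))"
      unfolding of_real_mult of_real_sum complex_norm_square by (simp add: sum_distrib_left mult_ac)
    ultimately show ?thesis unfolding eu by (simp only:)
  qed
  finally show "(LINT x|period_measure b. (cmod (u x - T x))\<^sup>2) =
      (LINT x|period_measure b. (cmod (u x))\<^sup>2) - 2 * pi * (\<Sum>k\<in>K. (cmod (fourier_coeff b u k))\<^sup>2)"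
    unfolding M_def c_def by (simp only: of_real_diff[symmetric] of_real_eq_iff)
qed

lemma bessel_inequality:
  fixes u :: "real \<Rightarrow> complex"
  assumes "u \<in> borel_measurable borel" and "integrable (period_measure b) (\<lambda>x. (cmod (u x))\<^sup>2)" and "finite K"
  shows "2 * pi * (\<Sum>k\<in>K. (cmod (fourier_coeff b u k))\<^sup>2) \<le> (LINT x|period_measure b. (cmod (u x))\<^sup>2)"
proof -
  have "0 \<le> (LINT x|period_measure b. (cmod (u x - (\<Sum>k\<in>K. fourier_coeff b u k * cis (real_of_int k * x))))\<^sup>2)"
    by (rule Bochner_Integration.integral_nonneg) simp
  then show ?thesis using bessel_identity(2)[OF assms] by simp
qed

lemma fourier_coeff_tendsto_0:
  fixes u :: "real \<Rightarrow> complex"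
  assumes "u \<in> borel_measurable borel" and "integrable (period_measure b) (\<lambda>x. (cmod (u x))\<^sup>2)"
    and f: "inj f"
  shows "(\<lambda>n::nat. fourier_coeff b u (f n)) \<longlonglongrightarrow> 0"
proof -
  have "summable (\<lambda>n. (cmod (fourier_coeff b u (f n)))\<^sup>2)"
  proof (rule bounded_imp_summable)
    fix n
    have "(\<Sum>k\<le>n. (cmod (fourier_coeff b u (f k)))\<^sup>2) = (\<Sum>k\<in>f ` {..n}. (cmod (fourier_coeff b u k))\<^sup>2)"
      by (rule sum.reindex_cong[symmetric, where l=f]) (auto intro: inj_on_subset[OF f])
    also have "\<dots> \<le> (LINT x|period_measure b. (cmod (u x))\<^sup>2) / (2 * pi)"
      using bessel_inequality[OF assms(1,2), of "f ` {..n}"] by (simp add: field_simps)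
    finally show "(\<Sum>k\<le>n. (cmod (fourier_coeff b u (f k)))\<^sup>2) \<le> (LINT x|period_measure b. (cmod (u x))\<^sup>2) / (2 * pi)" .
  qed simp
  then have "(\<lambda>n. (cmod (fourier_coeff b u (f n)))\<^sup>2) \<longlonglongrightarrow> 0" by (rule summable_LIMSEQ_zero)
  from tendsto_real_sqrt[OF this] show ?thesis by (simp add: tendsto_norm_zero_iff)
qed

section \<open>The square sum of the shifted cardinal sines\<close>

lemma norm_cis_minus_1: "cmod (cis a - 1) = 2 * \<bar>sin (a / 2)\<bar>"
  using dist_exp_i_1[of a] by (simp add: cis_conv_exp)

lemma norm_cis_minus_1_le: "cmod (cis a - 1) \<le> \<bar>a\<bar>"
  using abs_sin_x_le_abs_x[of "a / 2"] by (simp add: norm_cis_minus_1)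

lemma sin_linear_lower_bound:
  obtains c :: real where "c > 0" "\<And>y. 0 \<le> y \<Longrightarrow> y \<le> pi / 2 \<Longrightarrow> c * y \<le> sin y"
proof -
  have "continuous_on {0..pi/2} sinc"
    by (intro continuous_at_imp_continuous_on ballI isCont_sinc)
  then obtain y0 where y0: "y0 \<in> {0..pi/2}" "\<And>y. y \<in> {0..pi/2} \<Longrightarrow> sinc y0 \<le> sinc y"
    using continuous_attains_inf[of "{0..pi/2}" sinc] by auto
  have "sinc y0 > 0"
    using y0(1) pi_gt_zero by (auto intro!: divide_pos_pos sin_gt_zero)
  moreover have "sinc y0 * y \<le> sin y" if "0 \<le> y" "y \<le> pi / 2" for y
  proof (cases "y = 0")
    case False
    then have "sinc y0 \<le> sin y / y" using y0(2)[of y] that by simp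
    then show ?thesis using False that by (simp add: pos_le_divide_eq)
  qed simp
  ultimately show thesis by (rule that)
qed

text \<open>On \<open>[0, 2\<pi>]\<close> this is the normalized periodic autocorrelation of the \<open>2\<pi>\<close>-periodic extension of
\<open>\<theta> \<mapsto> cis(t\<theta>)\<close>, whose Fourier coefficients are the squares of those of the extension. Its value at 0
being 1, pointwise convergence of its Fourier series at 0 is the identity
\<open>\<Sum>\<^sub>k sinc\<^sup>2(t-k) = 1\<close>.\<close>

definition sinc_autocorrelation :: "real \<Rightarrow> real \<Rightarrow> complex" where
  "sinc_autocorrelation t \<theta> =
     (complex_of_real (2 * pi - \<theta>) + complex_of_real \<theta> * cis (- (2 * pi * t))) * cis (t * \<theta>) / (2 * pi)"

lemma fourier_coeff_sinc_autocorrelation: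
  "fourier_coeff 0 (sinc_autocorrelation t) k = complex_of_real ((cardinal_sine (t - of_int k))\<^sup>2)"
proof -
  define a where "a = t - of_int k"
  define B where "B = cis (- (2 * pi * t)) - 1"
  have Ba: "B = cis (- (2 * pi * a)) - 1"
  proof -
    have "cis (- (2 * pi * a)) = cis (- (2 * pi * t)) * cis (2 * pi * real_of_int k)"
      unfolding cis_mult a_def by (simp add: algebra_simps)
    then show ?thesis by (simp add: B_def)
  qed
  have eq: "sinc_autocorrelation t \<theta> * cis (- (real_of_int k * \<theta>)) =
      (1 / (2 * pi)) * ((2 * pi + B * complex_of_real \<theta>) * cis (a * \<theta>))" for \<theta>
  proof -
    have "cis (a * \<theta>) = cis (t * \<theta>) * cis (- (real_of_int k * \<theta>))"
      unfolding cis_mult a_def by (simp add: algebra_simps)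
    then show ?thesis by (simp add: sinc_autocorrelation_def B_def field_simps)
  qed
  have cont: "continuous_on UNIV (\<lambda>\<theta>. (2 * pi + B * complex_of_real \<theta>) * cis (a * \<theta>))"
    by (intro continuous_intros)
  have main: "(LINT \<theta>|period_measure 0. (2 * pi + B * complex_of_real \<theta>) * cis (a * \<theta>)) =
      (2 * pi)\<^sup>2 * complex_of_real ((cardinal_sine a)\<^sup>2)"
  proof (cases "a = 0")
    case True
    then have "B = 0" by (simp add: Ba)
    have "(LINT \<theta>|period_measure 0. (2 * pi + B * complex_of_real \<theta>) * cis (a * \<theta>)) =
        (LINT x|period_measure 0. 2 * pi * cis (real_of_int 0 * x))"
      using True \<open>B = 0\<close> by simp
    also have "\<dots> = 2 * pi * (2 * pi)"
      unfolding integral_mult_right_zero integral_cis_period by simp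
    finally show ?thesis
      using True by (simp add: cardinal_sine_def power2_eq_square)
  next
    case False
    \<comment> \<open>\<open>G\<close> is an antiderivative: integration by parts of a linear function times an exponential.\<close>
    define c0 where "c0 = 2 * pi / (\<i> * a) + B / (complex_of_real a)\<^sup>2"
    define c1 where "c1 = B / (\<i> * a)"
    define G where "G = (\<lambda>\<theta>. (c0 + c1 * complex_of_real \<theta>) * cis (a * \<theta>))"
    have "(LINT \<theta>|period_measure 0. (2 * pi + B * complex_of_real \<theta>) * cis (a * \<theta>)) = G (0 + 2 * pi) - G 0"
    proof (rule integral_period_measure_FTC[OF _ cont])
      fix x
      have 1: "((\<lambda>\<theta>. c0 + c1 * complex_of_real \<theta>) has_vector_derivative c1) (at x)"
        unfolding has_vector_derivative_def
        by (rule derivative_eq_intros refl)+ (auto simp: fun_eq_iff scaleR_conv_of_real)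
      have 2: "(c0 + c1 * complex_of_real x) * (\<i> * complex_of_real a) + c1 = 2 * pi + B * complex_of_real x"
        using False by (simp add: c0_def c1_def field_simps power2_eq_square)
      show "(G has_vector_derivative (2 * pi + B * complex_of_real x) * cis (a * x)) (at x)"
        unfolding G_def
        by (rule has_vector_derivative_eq_rhs[OF has_vector_derivative_mult[OF 1 cis_has_vector_derivative]])
           (simp only: 2[symmetric], simp add: algebra_simps)
    qed
    also have "\<dots> = (B * cis (2 * pi * a) - B) / (complex_of_real a)\<^sup>2"
    proof -
      have "(2 * pi + B * complex_of_real (2 * pi)) * cis (2 * pi * a) = 2 * pi"
        unfolding Ba by (simp add: algebra_simps cis_mult)
      moreover have "G (0 + 2 * pi) = (2 * pi + B * complex_of_real (2 * pi)) * cis (2 * pi * a) / (\<i> * a)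
          + B * cis (2 * pi * a) / (complex_of_real a)\<^sup>2"
        by (simp add: G_def c0_def c1_def add_divide_distrib ring_distribs mult_ac)
      ultimately have "G (0 + 2 * pi) = 2 * pi / (\<i> * a) + B * cis (2 * pi * a) / (complex_of_real a)\<^sup>2"
        by (simp only:)
      moreover have "G 0 = 2 * pi / (\<i> * a) + B / (complex_of_real a)\<^sup>2"
        by (simp add: G_def c0_def)
      ultimately show ?thesis by (simp only: diff_divide_distrib) simp
    qed
    also have "B * cis (2 * pi * a) - B = 2 - complex_of_real (2 * cos (2 * pi * a))"
      unfolding Ba by (simp add: algebra_simps cis_mult) (simp add: complex_eq_iff)
    also have "\<dots> = complex_of_real (4 * (sin (pi * a))\<^sup>2)"
      using cos_double_sin[of "pi * a"] by (simp add: mult.assoc)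
    also have "\<dots> / (complex_of_real a)\<^sup>2 = (2 * pi)\<^sup>2 * complex_of_real ((cardinal_sine a)\<^sup>2)"
      using False by (simp add: cardinal_sine_def power_divide power_mult_distrib)
    finally show ?thesis .
  qed
  show ?thesis
    unfolding fourier_coeff_def eq integral_mult_right_zero main
    by (simp add: a_def power2_eq_square)
qed

text \<open>The autocorrelation takes the value 1 at both ends of \<open>[0, 2\<pi>]\<close> and is Lipschitz there, while
\<open>|cis \<theta> - 1| = 2 |sin(\<theta>/2)|\<close> is bounded below by a multiple of the distance to the nearer end.\<close>

lemma sinc_autocorrelation_quotient_bounded:
  obtains C where "\<And>\<theta>. 0 \<le> \<theta> \<Longrightarrow> \<theta> \<le> 2 * pi \<Longrightarrow>
    cmod ((sinc_autocorrelation t \<theta> - 1) / (cis \<theta> - 1)) \<le> C"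
proof -
  obtain c :: real where c: "c > 0" "\<And>y. 0 \<le> y \<Longrightarrow> y \<le> pi / 2 \<Longrightarrow> c * y \<le> sin y"
    by (rule sin_linear_lower_bound) blast
  have core: "cmod (sinc_autocorrelation t \<theta> - 1) \<le> (\<bar>t\<bar> + 1) * d"
    if "cmod (sinc_autocorrelation t \<theta> - 1) \<le> cmod (cis v - 1) + d / (2 * pi) * 2"
      and "\<bar>v\<bar> \<le> \<bar>t\<bar> * d" "0 \<le> d" for v d \<theta>
  proof -
    have "d / (2 * pi) * 2 \<le> d" using mult_right_mono[of 1 pi d] that(3) pi_gt3 by (simp add: field_simps)
    then show ?thesis using that norm_cis_minus_1_le[of v] by (simp add: algebra_simps)
  qed
  have left: "cmod (sinc_autocorrelation t \<theta> - 1) \<le> (\<bar>t\<bar> + 1) * \<theta>" if "0 \<le> \<theta>" for \<theta>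
  proof (rule core)
    have "sinc_autocorrelation t \<theta> - 1 =
      (cis (t * \<theta>) - 1) + complex_of_real (\<theta> / (2 * pi)) * (cis (t * \<theta> - 2 * pi * t) - cis (t * \<theta>))"
      unfolding sinc_autocorrelation_def cis_divide[symmetric]
      by (simp add: field_simps cis_divide cis_mult)
    also have "cmod \<dots> \<le> cmod (cis (t * \<theta>) - 1) +
        cmod (complex_of_real (\<theta> / (2 * pi))) * cmod (cis (t * \<theta> - 2 * pi * t) - cis (t * \<theta>))"
      unfolding norm_mult[symmetric] by (rule norm_triangle_ineq)
    also have "\<dots> \<le> cmod (cis (t * \<theta>) - 1) + \<theta> / (2 * pi) * 2"
      using that norm_triangle_ineq4[of "cis (t * \<theta> - 2 * pi * t)" "cis (t * \<theta>)"]
      by (intro add_left_mono mult_mono) (auto simp: norm_divide)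
    finally show "cmod (sinc_autocorrelation t \<theta> - 1) \<le> cmod (cis (t * \<theta>) - 1) + \<theta> / (2 * pi) * 2" .
  qed (use that in \<open>auto simp: abs_mult\<close>)
  \<comment> \<open>The same estimate from the other end, after rewriting around \<open>2\<pi>\<close>.\<close>
  have right: "cmod (sinc_autocorrelation t \<theta> - 1) \<le> (\<bar>t\<bar> + 1) * (2 * pi - \<theta>)" if "\<theta> \<le> 2 * pi" for \<theta>
  proof (rule core)
    have "sinc_autocorrelation t \<theta> - 1 = (cis (t * (\<theta> - 2 * pi)) - 1) +
      complex_of_real ((2 * pi - \<theta>) / (2 * pi)) * (cis (t * \<theta>) - cis (t * (\<theta> - 2 * pi)))"
    proof -
      have "cis (t * (\<theta> - 2 * pi)) = cis (t * \<theta>) * cis (- (2 * pi * t))"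
        by (simp add: cis_mult algebra_simps)
      then show ?thesis
        unfolding sinc_autocorrelation_def by (simp add: field_simps)
    qed
    also have "cmod \<dots> \<le> cmod (cis (t * (\<theta> - 2 * pi)) - 1) +
        cmod (complex_of_real ((2 * pi - \<theta>) / (2 * pi))) * cmod (cis (t * \<theta>) - cis (t * (\<theta> - 2 * pi)))"
      unfolding norm_mult[symmetric] by (rule norm_triangle_ineq)
    also have "\<dots> \<le> cmod (cis (t * (\<theta> - 2 * pi)) - 1) + (2 * pi - \<theta>) / (2 * pi) * 2"
      using that norm_triangle_ineq4[of "cis (t * \<theta>)" "cis (t * (\<theta> - 2 * pi))"]
      by (intro add_left_mono mult_mono) (auto simp del: of_real_divide of_real_diff)
    finally show "cmod (sinc_autocorrelation t \<theta> - 1) \<le> cmod (cis (t * (\<theta> - 2 * pi)) - 1) + (2 * pi - \<theta>) / (2 * pi) * 2" .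
  qed (use that in \<open>auto simp: abs_mult\<close>)
  show thesis
  proof (rule that)
    fix \<theta> :: real assume th: "0 \<le> \<theta>" "\<theta> \<le> 2 * pi"
    define d where "d = min \<theta> (2 * pi - \<theta>)"
    have d0: "0 \<le> d" using th by (simp add: d_def)
    have num: "cmod (sinc_autocorrelation t \<theta> - 1) \<le> (\<bar>t\<bar> + 1) * d"
      using left[OF th(1)] right[OF th(2)] by (simp add: d_def min_def)
    have "sin (\<theta> / 2) = sin (d / 2)"
      using sin_pi_minus[of "\<theta> / 2"] by (simp add: d_def min_def diff_divide_distrib)
    moreover have "c * (d / 2) \<le> sin (d / 2)"
      by (rule c(2)) (use th in \<open>auto simp: d_def\<close>)
    moreover have "0 \<le> c * (d / 2)" using c(1) d0 by simp
    ultimately have den: "c * d \<le> cmod (cis \<theta> - 1)" by (simp add: norm_cis_minus_1)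
    show "cmod ((sinc_autocorrelation t \<theta> - 1) / (cis \<theta> - 1)) \<le> (\<bar>t\<bar> + 1) / c"
    proof (cases "cis \<theta> = 1")
      case False
      then have pos: "cmod (cis \<theta> - 1) > 0" by simp
      have "cmod (sinc_autocorrelation t \<theta> - 1) * c \<le> (\<bar>t\<bar> + 1) * (c * d)"
        using mult_right_mono[OF num, of c] c(1) by (simp add: mult_ac)
      also have "\<dots> \<le> (\<bar>t\<bar> + 1) * cmod (cis \<theta> - 1)"
        by (intro mult_left_mono den) auto
      finally show ?thesis using pos c(1) by (simp add: norm_divide divide_le_eq le_divide_eq mult_ac)
    qed (use c(1) in simp)
  qed
qed

lemma sum_int_telescope:
  fixes q :: "int \<Rightarrow> 'a :: ab_group_add"
  shows "(\<Sum>k\<in>{- int N..int N}. q (k - 1) - q k) = q (- int N - 1) - q (int N)"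
proof (induction N)
  case (Suc N)
  have "{- int (Suc N)..int (Suc N)} = insert (- int (Suc N)) (insert (int (Suc N)) {- int N..int N})"
    by auto
  then have "(\<Sum>k\<in>{- int (Suc N)..int (Suc N)}. q (k - 1) - q k) =
     (q (- int (Suc N) - 1) - q (- int (Suc N))) + ((q (int (Suc N) - 1) - q (int (Suc N))) +
       (q (- int N - 1) - q (int N)))"
    using Suc by (simp add: algebra_simps)
  moreover have "int (Suc N) - 1 = int N" "- int (Suc N) = - int N - 1" by auto
  ultimately show ?case by (simp only:) (simp add: algebra_simps)
qed simp

text \<open>Chernoff's argument for pointwise convergence of a Fourier series. Write the autocorrelation as
\<open>P = 1 + (cis \<theta> - 1) Q\<close> with \<open>Q\<close> bounded. Multiplication by \<open>cis \<theta>\<close> shifts Fourier coefficients, so the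
partial sums of the coefficients of \<open>P\<close> telescope to 1 plus two coefficients of \<open>Q\<close> with indices tending to
infinity in absolute value, and these vanish in the limit by Bessel's inequality.\<close>

lemma cardinal_sine_squares_sum:
  "(\<lambda>N::nat. \<Sum>k\<in>{- int N..int N}. (cardinal_sine (t - of_int k))\<^sup>2) \<longlonglongrightarrow> 1"
proof -
  interpret M: finite_measure "period_measure 0" by (rule finite_measure_period_measure)
  define P where "P = sinc_autocorrelation t"
  have [measurable]: "P \<in> borel_measurable borel"
    unfolding P_def sinc_autocorrelation_def[abs_def] by measurable
  define Q where "Q = (\<lambda>\<theta>. (P \<theta> - 1) / (cis \<theta> - 1))"
  have [measurable]: "Q \<in> borel_measurable borel" unfolding Q_def by measurable
  obtain C where C: "\<And>\<theta>. 0 \<le> \<theta> \<Longrightarrow> \<theta> \<le> 2 * pi \<Longrightarrow> cmod (Q \<theta>) \<le> C"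
    using sinc_autocorrelation_quotient_bounded[of t] unfolding Q_def P_def by metis
  have Qint: "integrable (period_measure 0) Q"
    by (rule M.integrable_const_bound[where B=C]) (auto intro!: AE_I2 C)
  have Q2int: "integrable (period_measure 0) (\<lambda>x. (cmod (Q x))\<^sup>2)"
    by (rule M.integrable_const_bound[where B="C\<^sup>2"]) (auto intro!: AE_I2 power_mono C)
  have PQ: "P \<theta> = 1 + (cis \<theta> - 1) * Q \<theta>" if "0 \<le> \<theta>" "\<theta> \<le> 2 * pi" for \<theta>
  proof (cases "cis \<theta> = 1")
    case True
    then have "sin (\<theta> / 2) = 0" using norm_cis_minus_1[of \<theta>] by simp
    then have "\<not> (0 < \<theta> / 2 \<and> \<theta> / 2 < pi)" using sin_gt_zero by fastforce
    then have "\<theta> = 0 \<or> \<theta> = 2 * pi" using that by auto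
    then have "P \<theta> = 1"
      by (auto simp: P_def sinc_autocorrelation_def cis_mult mult.commute)
    with True show ?thesis by simp
  qed (simp add: Q_def)
  define q where "q = fourier_coeff 0 Q"
  have coeff: "complex_of_real ((cardinal_sine (t - of_int k))\<^sup>2) = (if k = 0 then 1 else 0) + (q (k - 1) - q k)" for k
  proof -
    have "complex_of_real ((cardinal_sine (t - of_int k))\<^sup>2) =
        (LINT x|period_measure 0. P x * cis (- (real_of_int k * x))) / (2 * pi)"
      unfolding P_def fourier_coeff_sinc_autocorrelation[symmetric] fourier_coeff_def ..
    also have "(LINT x|period_measure 0. P x * cis (- (real_of_int k * x))) =
       (LINT x|period_measure 0. cis (real_of_int (- k) * x) +
         (Q x * cis (- (real_of_int (k - 1) * x)) - Q x * cis (- (real_of_int k * x))))"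
    proof (rule Bochner_Integration.integral_cong[OF refl])
      fix x assume "x \<in> space (period_measure 0)"
      then have P: "P x = 1 + (cis x - 1) * Q x" by (intro PQ) auto
      have "cis (- (real_of_int (k - 1) * x)) = cis x * cis (- (real_of_int k * x))"
        by (simp add: cis_mult algebra_simps)
      then show "P x * cis (- (real_of_int k * x)) = cis (real_of_int (- k) * x) +
         (Q x * cis (- (real_of_int (k - 1) * x)) - Q x * cis (- (real_of_int k * x)))"
        unfolding P by (simp add: algebra_simps)
    qed
    also have "\<dots> = (LINT x|period_measure 0. cis (real_of_int (- k) * x)) +
       ((LINT x|period_measure 0. Q x * cis (- (real_of_int (k - 1) * x))) -
        (LINT x|period_measure 0. Q x * cis (- (real_of_int k * x))))"
    proof -
      have 1: "integrable (period_measure 0) (\<lambda>x. cis (real_of_int (- k) * x))"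
        by (rule M.integrable_const_bound[where B=1]) auto
      have 2: "integrable (period_measure 0) (\<lambda>x. Q x * cis (- (real_of_int j * x)))" for j
        using period_integrable_cis[OF _ Qint, of "- real_of_int j"] by simp
      show ?thesis
        by (subst Bochner_Integration.integral_add[OF 1 Bochner_Integration.integrable_diff[OF 2 2]])
           (subst Bochner_Integration.integral_diff[OF 2 2], rule refl)
    qed
    also have "\<dots> / (2 * pi) = (if k = 0 then 1 else 0) + (q (k - 1) - q k)"
      unfolding integral_cis_period q_def fourier_coeff_def
      by (simp add: add_divide_distrib diff_divide_distrib)
    finally show ?thesis .
  qed
  have sum: "complex_of_real (\<Sum>k\<in>{- int N..int N}. (cardinal_sine (t - of_int k))\<^sup>2) =
      1 + (q (- int N - 1) - q (int N))" for N
    unfolding of_real_sum coeff sum.distrib sum_int_telescope by (simp add: sum.delta)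
  have "(\<lambda>N. q (- int N - 1)) \<longlonglongrightarrow> 0" "(\<lambda>N. q (int N)) \<longlonglongrightarrow> 0"
    unfolding q_def by (intro fourier_coeff_tendsto_0 Q2int; simp add: inj_def)+
  then have "(\<lambda>N. 1 + (q (- int N - 1) - q (int N))) \<longlonglongrightarrow> 1 + (0 - 0)"
    by (intro tendsto_intros)
  then have "(\<lambda>N. complex_of_real (\<Sum>k\<in>{- int N..int N}. (cardinal_sine (t - of_int k))\<^sup>2)) \<longlonglongrightarrow> complex_of_real 1"
    unfolding sum by simp
  then show ?thesis by (simp only: tendsto_of_real_iff)
qed

section \<open>The periodic extension of a character\<close>

lemma cardinal_sine_eq_sinc: "cardinal_sine t = sinc (pi * t)"
  by (simp add: cardinal_sine_def)

lemma fourier_coeff_cis: "fourier_coeff (- pi) (\<lambda>\<theta>. cis (t * \<theta>)) k = complex_of_real (cardinal_sine (t - of_int k))"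
proof -
  define a where "a = t - of_int k"
  have eq: "cis (t * \<theta>) * cis (- (real_of_int k * \<theta>)) = cis (a * \<theta>)" for \<theta>
    unfolding cis_mult a_def by (simp add: algebra_simps)
  have "(LINT \<theta>|period_measure (- pi). cis (a * \<theta>)) = 2 * pi * complex_of_real (cardinal_sine a)"
  proof (cases "a = 0")
    case True
    then show ?thesis using integral_cis_period[of "- pi" 0] by (simp add: cardinal_sine_def)
  next
    case False
    have "(LINT \<theta>|period_measure (- pi). cis (a * \<theta>)) =
       (1 / (\<i> * a)) * cis (a * (- pi + 2 * pi)) - (1 / (\<i> * a)) * cis (a * (- pi))"
    proof (rule integral_period_measure_FTC)
      fix x
      show "((\<lambda>x. (1 / (\<i> * a)) * cis (a * x)) has_vector_derivative cis (a * x)) (at x)"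
        by (rule has_vector_derivative_eq_rhs[OF has_vector_derivative_mult_right[OF cis_has_vector_derivative]])
           (use False in simp)
    qed (intro continuous_intros)
    also have "\<dots> = (1 / (\<i> * a)) * (cis (pi * a) - cis (- (pi * a)))"
      by (simp add: algebra_simps)
    also have "cis (pi * a) - cis (- (pi * a)) = 2 * \<i> * complex_of_real (sin (pi * a))"
      by (simp add: complex_eq_iff)
    finally show ?thesis using False by (simp add: cardinal_sine_def)
  qed
  then show ?thesis unfolding fourier_coeff_def eq by (simp add: a_def)
qed

text \<open>The floor is the index of the period cell \<open>[-\<pi> + 2\<pi>n, \<pi> + 2\<pi>n)\<close> that contains \<open>\<theta>\<close>.\<close>

definition periodic_wave :: "real \<Rightarrow> real \<Rightarrow> complex" where
  "periodic_wave t \<theta> = cis (t * (\<theta> - 2 * pi * of_int \<lfloor>(\<theta> + pi) / (2 * pi)\<rfloor>))"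

lemma periodic_wave_measurable [measurable]: "periodic_wave t \<in> borel_measurable borel"
  unfolding periodic_wave_def[abs_def] by measurable

lemma norm_periodic_wave [simp]: "cmod (periodic_wave t \<theta>) = 1"
  by (simp add: periodic_wave_def)

lemma periodic_wave_period: "periodic_wave t (\<theta> + 2 * pi) = periodic_wave t \<theta>"
proof -
  have "(\<theta> + 2 * pi + pi) / (2 * pi) = (\<theta> + pi) / (2 * pi) + of_int 1"
    by (simp add: field_simps)
  then have "\<lfloor>(\<theta> + 2 * pi + pi) / (2 * pi)\<rfloor> = \<lfloor>(\<theta> + pi) / (2 * pi)\<rfloor> + 1"
    by (simp only: floor_add_int[symmetric])
  then show ?thesis by (simp add: periodic_wave_def algebra_simps)
qed

lemma periodic_wave_eq_cis:
  assumes "- pi \<le> \<theta>" "\<theta> < pi"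
  shows "periodic_wave t \<theta> = cis (t * \<theta>)"
proof -
  have "\<lfloor>(\<theta> + pi) / (2 * pi)\<rfloor> = 0"
    using assms by (intro floor_unique) (auto simp: field_simps)
  then show ?thesis by (simp add: periodic_wave_def)
qed

text \<open>The partial Fourier sum of the periodic wave.\<close>

definition sinc_poly :: "real \<Rightarrow> nat \<Rightarrow> real \<Rightarrow> complex" where
  "sinc_poly t N \<theta> = (\<Sum>k\<in>{- int N..int N}. complex_of_real (cardinal_sine (t - of_int k)) * cis (of_int k * \<theta>))"

lemma sinc_poly_measurable [measurable]: "sinc_poly t N \<in> borel_measurable borel"
  unfolding sinc_poly_def[abs_def] by measurable

lemma sinc_poly_period: "sinc_poly t N (\<theta> + 2 * pi) = sinc_poly t N \<theta>"
  by (simp add: sinc_poly_def cis_period)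

definition sinc_defect :: "real \<Rightarrow> nat \<Rightarrow> real" where
  "sinc_defect t N = 1 - (\<Sum>k\<in>{- int N..int N}. (cardinal_sine (t - of_int k))\<^sup>2)"

lemma sinc_defect_tendsto_0: "sinc_defect t \<longlonglongrightarrow> 0"
  using tendsto_diff[OF tendsto_const cardinal_sine_squares_sum, of 1 t]
  unfolding sinc_defect_def[abs_def] by simp

text \<open>On the cell \<open>[-\<pi>, \<pi>)\<close> the wave is a character of modulus 1 with Fourier coefficients \<open>sinc(t-k)\<close>, so
Bessel's identity gives the mean-square error of its Fourier sums.\<close>

lemma integral_wave_minus_sinc_poly:
  "(\<integral>\<^sup>+ \<theta>. ennreal ((cmod (periodic_wave t \<theta> - sinc_poly t N \<theta>))\<^sup>2) * indicator {- pi..<pi} \<theta> \<partial>lborel)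
     = ennreal (2 * pi * sinc_defect t N)" and sinc_defect_nonneg: "0 \<le> sinc_defect t N"
proof -
  define e where "e = (\<lambda>\<theta>. cis (t * \<theta>))"
  have [measurable]: "e \<in> borel_measurable borel" unfolding e_def by measurable
  interpret M: finite_measure "period_measure (- pi)" by (rule finite_measure_period_measure)
  have e2: "integrable (period_measure (- pi)) (\<lambda>\<theta>. (cmod (e \<theta>))\<^sup>2)"
    by (rule M.integrable_const_bound[where B=1]) (auto simp: e_def)
  have T: "(\<Sum>k\<in>{- int N..int N}. fourier_coeff (- pi) e k * cis (real_of_int k * x)) = sinc_poly t N x" for x
    unfolding sinc_poly_def e_def fourier_coeff_cis ..
  have coeff: "(cmod (fourier_coeff (- pi) e k))\<^sup>2 = (cardinal_sine (t - of_int k))\<^sup>2" for k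
    unfolding e_def fourier_coeff_cis by simp
  have vol: "(LINT \<theta>|period_measure (- pi). (cmod (e \<theta>))\<^sup>2) = 2 * pi"
    by (subst integral_period_measure) (simp add: e_def)
  note bi = bessel_identity[OF _ e2, of "{- int N..int N}", unfolded T coeff]
  have "(LINT \<theta>|period_measure (- pi). (cmod (e \<theta> - sinc_poly t N \<theta>))\<^sup>2) = 2 * pi * sinc_defect t N"
    using bi(2) vol by (simp add: sinc_defect_def right_diff_distrib)
  moreover have int: "integrable (period_measure (- pi)) (\<lambda>\<theta>. (cmod (e \<theta> - sinc_poly t N \<theta>))\<^sup>2)"
    using bi(1) by simp
  ultimately have eq: "(\<integral>\<^sup>+ \<theta>. ennreal ((cmod (e \<theta> - sinc_poly t N \<theta>))\<^sup>2) \<partial>period_measure (- pi)) = ennreal (2 * pi * sinc_defect t N)"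
    and "0 \<le> 2 * pi * sinc_defect t N"
    using Bochner_Integration.integral_nonneg[of "period_measure (- pi)" "\<lambda>\<theta>. (cmod (e \<theta> - sinc_poly t N \<theta>))\<^sup>2"]
    by (auto simp: nn_integral_eq_integral)
  then show "0 \<le> sinc_defect t N" using pi_gt_zero by (auto simp: zero_le_mult_iff)
  have "(\<integral>\<^sup>+ \<theta>. ennreal ((cmod (periodic_wave t \<theta> - sinc_poly t N \<theta>))\<^sup>2) * indicator {- pi..<pi} \<theta> \<partial>lborel) =
      (\<integral>\<^sup>+ \<theta>. ennreal ((cmod (e \<theta> - sinc_poly t N \<theta>))\<^sup>2) * indicator {- pi..- pi + 2 * pi} \<theta> \<partial>lborel)"
  proof (rule nn_integral_cong_AE)
    have "AE \<theta> in lborel. \<theta> \<noteq> pi" by (rule AE_lborel_singleton)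
    then show "AE \<theta> in lborel. ennreal ((cmod (periodic_wave t \<theta> - sinc_poly t N \<theta>))\<^sup>2) * indicator {- pi..<pi} \<theta> =
       ennreal ((cmod (e \<theta> - sinc_poly t N \<theta>))\<^sup>2) * indicator {- pi..- pi + 2 * pi} \<theta>"
      by eventually_elim (auto simp: indicator_def periodic_wave_eq_cis e_def)
  qed
  also have "\<dots> = ennreal (2 * pi * sinc_defect t N)"
    unfolding eq[symmetric] period_measure_def
    by (subst nn_integral_restrict_space) auto
  finally show "(\<integral>\<^sup>+ \<theta>. ennreal ((cmod (periodic_wave t \<theta> - sinc_poly t N \<theta>))\<^sup>2) * indicator {- pi..<pi} \<theta> \<partial>lborel)
     = ennreal (2 * pi * sinc_defect t N)" .
qed

text \<open>A closed window of length \<open>2\<pi>\<close> is covered by two consecutive period cells, whence the factor 2.\<close>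

lemma nn_integral_periodic_window_le:
  fixes F :: "real \<Rightarrow> ennreal"
  assumes [measurable]: "F \<in> borel_measurable borel" and per: "\<And>x. F (x + 2 * pi) = F x"
  shows "(\<integral>\<^sup>+ x. F x * indicator {a..a + 2 * pi} x \<partial>lborel) \<le> 2 * (\<integral>\<^sup>+ x. F x * indicator {- pi..<pi} x \<partial>lborel)"
proof -
  have pern: "F (x + 2 * pi * real n) = F x" for x and n :: nat
  proof (induction n)
    case (Suc n)
    have "F (x + 2 * pi * real (Suc n)) = F (x + 2 * pi * real n + 2 * pi)" by (simp add: algebra_simps)
    with Suc show ?case by (simp only: per)
  qed simp
  have perz: "F (2 * pi * of_int z + x) = F x" for x and z :: int
  proof (cases "z \<ge> 0")
    case True
    then show ?thesis using pern[of x "nat z"] by (simp add: add.commute)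
  next
    case False
    then show ?thesis using pern[of "2 * pi * of_int z + x" "nat (- z)"] by simp
  qed
  have cell: "(\<integral>\<^sup>+ x. F x * indicator {- pi + 2 * pi * of_int z..<pi + 2 * pi * of_int z} x \<partial>lborel) =
      (\<integral>\<^sup>+ x. F x * indicator {- pi..<pi} x \<partial>lborel)" for z :: int
    by (subst nn_integral_real_affine[where c=1 and t="2 * pi * of_int z"])
       (auto simp: perz indicator_def intro!: nn_integral_cong)
  define z where "z = \<lfloor>(a + pi) / (2 * pi)\<rfloor>"
  have "of_int z \<le> (a + pi) / (2 * pi)" "(a + pi) / (2 * pi) < of_int z + 1"
    unfolding z_def by linarith+
  then have z: "- pi + 2 * pi * of_int z \<le> a" "a < pi + 2 * pi * of_int z"
    by (auto simp: field_simps)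
  have "(\<integral>\<^sup>+ x. F x * indicator {a..a + 2 * pi} x \<partial>lborel) \<le>
    (\<integral>\<^sup>+ x. F x * indicator {- pi + 2 * pi * of_int z..<pi + 2 * pi * of_int z} x +
       F x * indicator {- pi + 2 * pi * of_int (z + 1)..<pi + 2 * pi * of_int (z + 1)} x \<partial>lborel)"
    using z by (intro nn_integral_mono) (auto simp: indicator_def algebra_simps)
  also have "\<dots> = 2 * (\<integral>\<^sup>+ x. F x * indicator {- pi..<pi} x \<partial>lborel)"
    by (subst nn_integral_add) (auto simp only: cell mult_2[symmetric] intro!: borel_measurable_times assms(1), measurable)
  finally show ?thesis .
qed

lemma norm_L2_translated_defect:
  fixes t \<tau> :: real and N :: nat
  defines "v \<equiv> (\<lambda>\<tau> \<omega>. indicator {- pi..pi} \<omega> *\<^sub>R (periodic_wave t (\<omega> - \<tau>) - sinc_poly t N (\<omega> - \<tau>)))"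
  shows "square_integrable (v \<tau>) \<and> norm_L2 (v \<tau>) \<le> sqrt (4 * pi * sinc_defect t N)"
proof -
  define F where "F = (\<lambda>\<theta>. ennreal ((cmod (periodic_wave t \<theta> - sinc_poly t N \<theta>))\<^sup>2))"
  have [measurable]: "F \<in> borel_measurable borel" unfolding F_def by measurable
  have "(\<integral>\<^sup>+ \<omega>. ennreal ((cmod (v \<tau> \<omega>))\<^sup>2) \<partial>lborel) = (\<integral>\<^sup>+ \<omega>. F (\<omega> - \<tau>) * indicator {- pi..pi} \<omega> \<partial>lborel)"
    by (intro nn_integral_cong) (auto simp: v_def F_def indicator_def)
  also have "\<dots> = (\<integral>\<^sup>+ x. F x * indicator {- pi - \<tau>..- pi - \<tau> + 2 * pi} x \<partial>lborel)"
    by (subst nn_integral_real_affine[where c=1 and t=\<tau>])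
       (auto simp: indicator_def intro!: nn_integral_cong)
  also have "\<dots> \<le> 2 * (\<integral>\<^sup>+ x. F x * indicator {- pi..<pi} x \<partial>lborel)"
    by (rule nn_integral_periodic_window_le) (auto simp: F_def periodic_wave_period sinc_poly_period)
  also have "\<dots> = ennreal (4 * pi * sinc_defect t N)"
    unfolding F_def integral_wave_minus_sinc_poly using sinc_defect_nonneg[of t N]
    by (simp add: ennreal_mult'[symmetric] flip: ennreal_numeral)
  finally have "square_integrable (v \<tau>) \<and> (norm_L2 (v \<tau>))\<^sup>2 \<le> 4 * pi * sinc_defect t N"
    by (intro square_integrableI_bounded) (use sinc_defect_nonneg[of t N] in \<open>auto simp: v_def\<close>)
  then show ?thesis by (auto intro: real_le_rsqrt)
qed

section \<open>The regularization error\<close>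

lemma gauss_window_char:
  assumes "\<sigma> > 0"
  shows "(LINT \<tau>|gauss_measure (1 / \<sigma>). cis (x * \<tau>)) = complex_of_real (gauss_window \<sigma> x)"
  using gauss_measure_char[of "1 / \<sigma>" x] assms
  by (simp add: gauss_window_def power_divide)

lemma nn_integral_norm_le_norm_L2:
  assumes g: "square_integrable g" and supp: "\<And>\<omega>. \<bar>\<omega>\<bar> \<ge> \<delta> \<Longrightarrow> g \<omega> = 0" and d: "0 < \<delta>"
  shows "(\<integral>\<^sup>+ \<omega>. ennreal (cmod (g \<omega>)) \<partial>lborel) \<le> ennreal (sqrt (2 * \<delta>) * norm_L2 g)"
proof -
  define v :: "real \<Rightarrow> complex" where "v = (\<lambda>\<omega>. indicator {-\<delta>..\<delta>} \<omega> *\<^sub>R 1)"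
  have "(\<integral>\<^sup>+ \<omega>. ennreal ((cmod (v \<omega>))\<^sup>2) \<partial>lborel) = (\<integral>\<^sup>+ \<omega>. indicator {-\<delta>..\<delta>} \<omega> \<partial>lborel)"
    by (intro nn_integral_cong) (auto simp: v_def indicator_def)
  also have "\<dots> = ennreal (2 * \<delta>)" using d by simp
  finally have v: "square_integrable v \<and> (norm_L2 v)\<^sup>2 \<le> 2 * \<delta>"
    by (intro square_integrableI_bounded) (use d in \<open>auto simp: v_def\<close>)
  have "(\<integral>\<^sup>+ \<omega>. ennreal (cmod (g \<omega>)) \<partial>lborel) = (\<integral>\<^sup>+ \<omega>. ennreal (cmod (g \<omega>) * cmod (v \<omega>)) \<partial>lborel)"
  proof (intro nn_integral_cong)
    fix \<omega>
    show "ennreal (cmod (g \<omega>)) = ennreal (cmod (g \<omega>) * cmod (v \<omega>))"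
      by (cases "\<bar>\<omega>\<bar> \<ge> \<delta>") (auto simp: supp v_def indicator_def)
  qed
  also have "\<dots> \<le> ennreal (norm_L2 g * norm_L2 v)"
    by (rule nn_integral_mult_le_norm_L2) (use g v in auto)
  also have "\<dots> \<le> ennreal (sqrt (2 * \<delta>) * norm_L2 g)"
  proof (intro ennreal_leI)
    have "norm_L2 v \<le> sqrt (2 * \<delta>)" using v by (auto intro: real_le_rsqrt)
    then have "norm_L2 g * norm_L2 v \<le> norm_L2 g * sqrt (2 * \<delta>)" by (intro mult_left_mono) auto
    then show "norm_L2 g * norm_L2 v \<le> sqrt (2 * \<delta>) * norm_L2 g" by (simp add: mult.commute)
  qed
  finally show ?thesis .
qed

text \<open>The Gaussian window is averaged over \<open>\<tau>\<close> as described at the top. For each \<open>\<tau>\<close> the kernel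
\<open>H(\<omega>) = cis(t\<omega>) - cis(t\<tau>) T\<^sub>N(\<omega>-\<tau>)\<close> splits into the jump part \<open>J\<close>, which compares the character with the
periodic wave, and the defect \<open>D\<close> of the Fourier sum \<open>T\<^sub>N\<close>. The first one is nonzero only for
\<open>|\<omega>-\<tau>| \<ge> \<pi>\<close>, which is where \<open>q\<close> enters after exchanging the integrals; the second one is small in mean
square uniformly in \<open>\<tau>\<close>.\<close>

lemma regularization_error:
  fixes f g :: "real \<Rightarrow> complex"
  assumes g: "square_integrable g" "integrable lborel g"
    and supp: "\<And>\<omega>. \<bar>\<omega>\<bar> \<ge> \<delta> \<Longrightarrow> g \<omega> = 0" and d: "0 < \<delta>" "\<delta> < pi"
    and f: "\<And>t. f t = complex_of_real (1 / sqrt (2 * pi)) * (LINT \<omega>|lborel. g \<omega> * cis (t * \<omega>))"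
    and \<sigma>: "\<sigma> > 0"
    and q: "\<And>\<omega>. \<bar>\<omega>\<bar> < \<delta> \<Longrightarrow> emeasure (gauss_measure (1 / \<sigma>)) {\<tau>. \<bar>\<omega> - \<tau>\<bar> \<ge> pi} \<le> ennreal q" and q0: "0 \<le> q"
  shows "cmod (f t - (\<Sum>k\<in>{- int N..int N}. f (of_int k) *
            complex_of_real (cardinal_sine (t - of_int k) * gauss_window \<sigma> (t - of_int k))))
     \<le> 1 / sqrt (2 * pi) * (2 * q * sqrt (2 * \<delta>) + sqrt (4 * pi * sinc_defect t N)) * norm_L2 g"
proof -
  define M where "M = gauss_measure (1 / \<sigma>)"
  interpret M: prob_space M unfolding M_def using \<sigma> by (intro prob_space_gauss_measure) simp
  interpret LM: pair_sigma_finite M lborel ..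
  have setsM [measurable_cong, simp]: "sets M = sets borel" by (simp add: M_def)
  have spM [simp]: "space M = UNIV" by (simp add: M_def)
  have prob1: "M.prob UNIV = 1" "emeasure M UNIV = 1"
    using M.prob_space M.emeasure_space_1 unfolding spM by auto
  have [measurable]: "g \<in> borel_measurable borel" using g(1) by (rule square_integrable_measurable)
  define c where "c = 1 / sqrt (2 * pi)"
  have c0: "0 \<le> c" by (simp add: c_def)
  define s where "s = (\<lambda>k. cardinal_sine (t - of_int k))"
  define R where "R = (\<lambda>\<tau>. \<Sum>k\<in>{- int N..int N}. f (of_int k) * complex_of_real (s k) * cis ((t - of_int k) * \<tau>))"
  have [measurable]: "R \<in> borel_measurable borel" unfolding R_def by measurable
  have RN: "(\<Sum>k\<in>{- int N..int N}. f (of_int k) * complex_of_real (cardinal_sine (t - of_int k) * gauss_window \<sigma> (t - of_int k)))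
      = (LINT \<tau>|M. R \<tau>)"
  proof -
    have "(LINT \<tau>|M. R \<tau>) = (\<Sum>k\<in>{- int N..int N}. (LINT \<tau>|M. f (of_int k) * complex_of_real (s k) * cis ((t - of_int k) * \<tau>)))"
      unfolding R_def
      by (intro Bochner_Integration.integral_sum integrable_mult_right M.integrable_const_bound[where B=1]) auto
    then show ?thesis
      unfolding M_def integral_mult_right_zero gauss_window_char[OF \<sigma>] by (simp add: s_def mult.assoc)
  qed
  have Rint: "integrable M R"
    unfolding R_def by (intro Bochner_Integration.integrable_sum integrable_mult_right M.integrable_const_bound[where B=1]) auto
  have "f t - (LINT \<tau>|M. R \<tau>) = (LINT \<tau>|M. f t - R \<tau>)"
    using Rint by (subst Bochner_Integration.integral_diff) (auto simp: prob1)
  then have "ennreal (cmod (f t - (LINT \<tau>|M. R \<tau>))) \<le> (\<integral>\<^sup>+ \<tau>. ennreal (cmod (f t - R \<tau>)) \<partial>M)"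
    using integral_norm_bound_ennreal[of M "\<lambda>\<tau>. f t - R \<tau>"] Rint by auto
  also have "\<dots> \<le> (\<integral>\<^sup>+ \<tau>. ennreal c * ((\<integral>\<^sup>+ \<omega>. ennreal (2 * cmod (g \<omega>)) * indicator {\<tau>. \<bar>\<omega> - \<tau>\<bar> \<ge> pi} \<tau> \<partial>lborel)
        + ennreal (norm_L2 g * sqrt (4 * pi * sinc_defect t N))) \<partial>M)"
  proof (rule nn_integral_mono)
    fix \<tau>
    have gc: "integrable lborel (\<lambda>\<omega>. g \<omega> * cis (a * \<omega>))" for a
      by (rule Bochner_Integration.integrable_bound[OF g(2)]) (auto simp: norm_mult)
    define H where "H = (\<lambda>\<omega>. cis (t * \<omega>) - cis (t * \<tau>) * sinc_poly t N (\<omega> - \<tau>))"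
    have [measurable]: "H \<in> borel_measurable borel" unfolding H_def by measurable
    have H: "g \<omega> * H \<omega> = g \<omega> * cis (t * \<omega>) -
        (\<Sum>k\<in>{- int N..int N}. complex_of_real (s k) * cis ((t - of_int k) * \<tau>) * (g \<omega> * cis (of_int k * \<omega>)))" for \<omega>
    proof -
      have "cis (t * \<tau>) * cis (of_int k * (\<omega> - \<tau>)) = cis ((t - of_int k) * \<tau>) * cis (of_int k * \<omega>)" for k
        unfolding cis_mult by (simp add: algebra_simps)
      then have "cis (t * \<tau>) * sinc_poly t N (\<omega> - \<tau>) =
         (\<Sum>k\<in>{- int N..int N}. complex_of_real (s k) * (cis ((t - of_int k) * \<tau>) * cis (of_int k * \<omega>)))"
        unfolding sinc_poly_def sum_distrib_left s_def by (simp only: mult.left_commute[of "cis (t * \<tau>)"])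
      then show ?thesis unfolding H_def by (simp add: right_diff_distrib sum_distrib_left mult_ac)
    qed
    have Hint: "integrable lborel (\<lambda>\<omega>. g \<omega> * H \<omega>)"
      unfolding H using gc by auto
    have "f t - R \<tau> = complex_of_real c * (LINT \<omega>|lborel. g \<omega> * H \<omega>)"
    proof -
      have "(LINT \<omega>|lborel. g \<omega> * H \<omega>) = (LINT \<omega>|lborel. g \<omega> * cis (t * \<omega>)) -
        (\<Sum>k\<in>{- int N..int N}. complex_of_real (s k) * cis ((t - of_int k) * \<tau>) * (LINT \<omega>|lborel. g \<omega> * cis (of_int k * \<omega>)))"
        unfolding H using gc
        by (subst Bochner_Integration.integral_diff) (auto intro!: Bochner_Integration.integrable_sum)
      then show ?thesis
        unfolding R_def f c_def[symmetric] by (simp add: right_diff_distrib sum_distrib_left mult_ac)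
    qed
    then have "ennreal (cmod (f t - R \<tau>)) = ennreal c * ennreal (cmod (LINT \<omega>|lborel. g \<omega> * H \<omega>))"
      using c0 by (simp add: norm_mult ennreal_mult)
    also have "\<dots> \<le> ennreal c * (\<integral>\<^sup>+ \<omega>. ennreal (cmod (g \<omega> * H \<omega>)) \<partial>lborel)"
      by (intro mult_left_mono integral_norm_bound_ennreal Hint) auto
    also have "(\<integral>\<^sup>+ \<omega>. ennreal (cmod (g \<omega> * H \<omega>)) \<partial>lborel) \<le>
       (\<integral>\<^sup>+ \<omega>. ennreal (2 * cmod (g \<omega>)) * indicator {\<tau>. \<bar>\<omega> - \<tau>\<bar> \<ge> pi} \<tau> + ennreal (cmod (g \<omega>) *
          cmod (indicator {- pi..pi} \<omega> *\<^sub>R (periodic_wave t (\<omega> - \<tau>) - sinc_poly t N (\<omega> - \<tau>)))) \<partial>lborel)"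
    proof (rule nn_integral_mono)
      fix \<omega>
      define D where "D = periodic_wave t (\<omega> - \<tau>) - sinc_poly t N (\<omega> - \<tau>)"
      define J where "J = cis (t * \<omega>) - cis (t * \<tau>) * periodic_wave t (\<omega> - \<tau>)"
      show "ennreal (cmod (g \<omega> * H \<omega>)) \<le> ennreal (2 * cmod (g \<omega>)) * indicator {\<tau>. \<bar>\<omega> - \<tau>\<bar> \<ge> pi} \<tau> +
          ennreal (cmod (g \<omega>) * cmod (indicator {- pi..pi} \<omega> *\<^sub>R (periodic_wave t (\<omega> - \<tau>) - sinc_poly t N (\<omega> - \<tau>))))"
      proof (cases "\<bar>\<omega>\<bar> \<ge> \<delta>")
        case False
        then have ind: "indicator {- pi..pi} \<omega> = (1::real)" using d by (auto simp: indicator_def)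
        have "H \<omega> = J + cis (t * \<tau>) * D" by (simp add: H_def J_def D_def algebra_simps)
        then have "cmod (H \<omega>) \<le> cmod J + cmod D"
          using norm_triangle_ineq[of J "cis (t * \<tau>) * D"] by (simp add: norm_mult)
        moreover have "cmod J \<le> 2 * indicator {\<tau>. \<bar>\<omega> - \<tau>\<bar> \<ge> pi} \<tau>"
        proof (cases "\<bar>\<omega> - \<tau>\<bar> \<ge> pi")
          case True
          have "cmod J \<le> 2"
            using norm_triangle_ineq4[of "cis (t * \<omega>)" "cis (t * \<tau>) * periodic_wave t (\<omega> - \<tau>)"]
            by (simp add: J_def norm_mult)
          with True show ?thesis by simp
        next
          case False
          then have "periodic_wave t (\<omega> - \<tau>) = cis (t * (\<omega> - \<tau>))" by (intro periodic_wave_eq_cis) auto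
          then have "J = 0" unfolding J_def by (simp add: cis_mult algebra_simps)
          then show ?thesis by simp
        qed
        ultimately have "cmod (g \<omega>) * cmod (H \<omega>) \<le> cmod (g \<omega>) * (2 * indicator {\<tau>. \<bar>\<omega> - \<tau>\<bar> \<ge> pi} \<tau> + cmod D)"
          by (intro mult_left_mono) auto
        then have "ennreal (cmod (g \<omega> * H \<omega>)) \<le>
            ennreal (2 * cmod (g \<omega>) * indicator {\<tau>. \<bar>\<omega> - \<tau>\<bar> \<ge> pi} \<tau> + cmod (g \<omega>) * cmod D)"
          by (intro ennreal_leI) (simp add: norm_mult algebra_simps)
        also have "\<dots> = ennreal (2 * cmod (g \<omega>)) * indicator {\<tau>. \<bar>\<omega> - \<tau>\<bar> \<ge> pi} \<tau> + ennreal (cmod (g \<omega>) * cmod D)"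
          by (subst ennreal_plus) (auto simp: indicator_def)
        finally show ?thesis unfolding ind D_def[symmetric] by simp
      qed (simp add: supp)
    qed
    also have "\<dots> = (\<integral>\<^sup>+ \<omega>. ennreal (2 * cmod (g \<omega>)) * indicator {\<tau>. \<bar>\<omega> - \<tau>\<bar> \<ge> pi} \<tau> \<partial>lborel) +
        (\<integral>\<^sup>+ \<omega>. ennreal (cmod (g \<omega>) * cmod (indicator {- pi..pi} \<omega> *\<^sub>R
          (periodic_wave t (\<omega> - \<tau>) - sinc_poly t N (\<omega> - \<tau>)))) \<partial>lborel)"
      by (rule nn_integral_add) (simp_all add: indicator_def)
    also have "(\<integral>\<^sup>+ \<omega>. ennreal (cmod (g \<omega>) * cmod (indicator {- pi..pi} \<omega> *\<^sub>R
          (periodic_wave t (\<omega> - \<tau>) - sinc_poly t N (\<omega> - \<tau>)))) \<partial>lborel) \<le> ennreal (norm_L2 g * sqrt (4 * pi * sinc_defect t N))"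
      using norm_L2_translated_defect[of t \<tau> N]
      by (intro order_trans[OF nn_integral_mult_le_norm_L2[OF g(1)]] ennreal_leI mult_left_mono) auto
    finally show "ennreal (cmod (f t - R \<tau>)) \<le> ennreal c * ((\<integral>\<^sup>+ \<omega>. ennreal (2 * cmod (g \<omega>)) * indicator {\<tau>. \<bar>\<omega> - \<tau>\<bar> \<ge> pi} \<tau> \<partial>lborel)
        + ennreal (norm_L2 g * sqrt (4 * pi * sinc_defect t N)))"
      by (simp add: mult_left_mono add_left_mono)
  qed
  also have "\<dots> = ennreal c * ((\<integral>\<^sup>+ \<tau>. \<integral>\<^sup>+ \<omega>. ennreal (2 * cmod (g \<omega>)) * indicator {\<tau>. \<bar>\<omega> - \<tau>\<bar> \<ge> pi} \<tau> \<partial>lborel \<partial>M)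
        + ennreal (norm_L2 g * sqrt (4 * pi * sinc_defect t N)))"
  proof -
    have [measurable]: "(\<lambda>\<tau>. \<integral>\<^sup>+ \<omega>. ennreal (2 * cmod (g \<omega>)) * indicator {\<tau>. \<bar>\<omega> - \<tau>\<bar> \<ge> pi} \<tau> \<partial>lborel) \<in> borel_measurable M"
      unfolding indicator_def mem_Collect_eq by measurable
    show ?thesis
      by (simp add: nn_integral_cmult nn_integral_add prob1)
  qed
  also have "(\<integral>\<^sup>+ \<tau>. \<integral>\<^sup>+ \<omega>. ennreal (2 * cmod (g \<omega>)) * indicator {\<tau>. \<bar>\<omega> - \<tau>\<bar> \<ge> pi} \<tau> \<partial>lborel \<partial>M) =
      (\<integral>\<^sup>+ \<omega>. \<integral>\<^sup>+ \<tau>. ennreal (2 * cmod (g \<omega>)) * indicator {\<tau>. \<bar>\<omega> - \<tau>\<bar> \<ge> pi} \<tau> \<partial>M \<partial>lborel)"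
    unfolding indicator_def mem_Collect_eq by (rule LM.Fubini'[symmetric]) measurable
  also have "\<dots> \<le> (\<integral>\<^sup>+ \<omega>. ennreal (2 * q) * ennreal (cmod (g \<omega>)) \<partial>lborel)"
  proof (rule nn_integral_mono)
    fix \<omega>
    have [measurable]: "{\<tau>. pi \<le> \<bar>\<omega> - \<tau>\<bar>} \<in> sets borel" by measurable
    have "(\<integral>\<^sup>+ \<tau>. ennreal (2 * cmod (g \<omega>)) * indicator {\<tau>. \<bar>\<omega> - \<tau>\<bar> \<ge> pi} \<tau> \<partial>M) =
       ennreal (2 * cmod (g \<omega>)) * emeasure M {\<tau>. \<bar>\<omega> - \<tau>\<bar> \<ge> pi}"
      by (subst nn_integral_cmult_indicator) auto
    also have "\<dots> \<le> ennreal (2 * cmod (g \<omega>)) * ennreal q"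
    proof (cases "\<bar>\<omega>\<bar> \<ge> \<delta>")
      case False
      then show ?thesis unfolding M_def by (intro mult_left_mono q) auto
    qed (simp add: supp)
    also have "\<dots> = ennreal (2 * q) * ennreal (cmod (g \<omega>))"
      using q0 by (simp add: ennreal_mult[symmetric] mult_ac)
    finally show "(\<integral>\<^sup>+ \<tau>. ennreal (2 * cmod (g \<omega>)) * indicator {\<tau>. \<bar>\<omega> - \<tau>\<bar> \<ge> pi} \<tau> \<partial>M) \<le> \<dots>" .
  qed
  also have "\<dots> = ennreal (2 * q) * (\<integral>\<^sup>+ \<omega>. ennreal (cmod (g \<omega>)) \<partial>lborel)"
    by (rule nn_integral_cmult) measurable
  also have "\<dots> \<le> ennreal (2 * q) * ennreal (sqrt (2 * \<delta>) * norm_L2 g)"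
    by (intro mult_left_mono nn_integral_norm_le_norm_L2 g supp d) auto
  finally have "ennreal (cmod (f t - (LINT \<tau>|M. R \<tau>))) \<le>
      ennreal c * (ennreal (2 * q) * ennreal (sqrt (2 * \<delta>) * norm_L2 g) + ennreal (norm_L2 g * sqrt (4 * pi * sinc_defect t N)))"
    by (simp add: mult_left_mono add_right_mono)
  also have "\<dots> = ennreal (c * (2 * q * (sqrt (2 * \<delta>) * norm_L2 g) + norm_L2 g * sqrt (4 * pi * sinc_defect t N)))"
    using c0 q0 d sinc_defect_nonneg[of t N]
    by (simp add: ennreal_mult ennreal_plus)
  finally have "cmod (f t - (LINT \<tau>|M. R \<tau>)) \<le> c * (2 * q * (sqrt (2 * \<delta>) * norm_L2 g) + norm_L2 g * sqrt (4 * pi * sinc_defect t N))"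
    using c0 q0 d sinc_defect_nonneg[of t N] by (subst (asm) ennreal_le_iff) auto
  then show ?thesis unfolding RN c_def by (simp add: algebra_simps)
qed

text \<open>The usual Mills-ratio bound: on \<open>[a, \<infinity>)\<close> the density is at most \<open>x/a\<close> times itself, and this product has an
explicit antiderivative.\<close>

lemma gauss_upper_tail:
  assumes s: "s > 0" and a: "a > 0"
  shows "emeasure (gauss_measure s) {a..} \<le> ennreal (s / (a * sqrt (2 * pi)) * exp (- (a\<^sup>2 / (2 * s\<^sup>2))))"
proof -
  define F where "F = (\<lambda>x. - (s\<^sup>2 / a) * normal_density 0 s x)"
  have Fd: "(F has_real_derivative x / a * normal_density 0 s x) (at x)" for x
    unfolding F_def normal_density_def using s a
    by (auto intro!: derivative_eq_intros simp: field_simps power2_eq_square)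
  have lim: "(F \<longlongrightarrow> 0) at_top"
  proof -
    have "filterlim (\<lambda>x::real. x\<^sup>2 / (2 * s\<^sup>2)) at_top at_top"
      using s by (intro filterlim_tendsto_pos_mult_at_top[OF tendsto_const[of "1 / (2 * s\<^sup>2)"], simplified]
        filterlim_pow_at_top filterlim_ident) auto
    then have "((\<lambda>x::real. exp (- (x\<^sup>2 / (2 * s\<^sup>2)))) \<longlongrightarrow> 0) at_top"
      by (intro filterlim_compose[OF exp_at_bot]) (simp add: filterlim_uminus_at_bot)
    then have "((\<lambda>x. - (s\<^sup>2 / a) * (1 / sqrt (2 * pi * s\<^sup>2) * exp (- (x\<^sup>2 / (2 * s\<^sup>2))))) \<longlongrightarrow>
         - (s\<^sup>2 / a) * (1 / sqrt (2 * pi * s\<^sup>2) * 0)) at_top"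
      by (intro tendsto_mult tendsto_const)
    then show ?thesis by (simp add: F_def normal_density_def)
  qed
  have "emeasure (gauss_measure s) {a..} = (\<integral>\<^sup>+ x. ennreal (normal_density 0 s x) * indicator {a..} x \<partial>lborel)"
    unfolding gauss_measure_def by (subst emeasure_density) auto
  also have "\<dots> \<le> (\<integral>\<^sup>+ x. ennreal (x / a * normal_density 0 s x) * indicator {a..} x \<partial>lborel)"
  proof (rule nn_integral_mono)
    fix x
    have "normal_density 0 s x \<le> x / a * normal_density 0 s x" if "a \<le> x"
      using mult_right_mono[of 1 "x / a" "normal_density 0 s x"] that a by simp
    then show "ennreal (normal_density 0 s x) * indicator {a..} x \<le> ennreal (x / a * normal_density 0 s x) * indicator {a..} x"
      by (auto simp: indicator_def intro: ennreal_leI)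
  qed
  also have "\<dots> = ennreal (0 - F a)"
    by (rule nn_integral_FTC_atLeast[OF _ Fd _ lim]) (use a in auto)
  also have "0 - F a = s / (a * sqrt (2 * pi)) * exp (- (a\<^sup>2 / (2 * s\<^sup>2)))"
    using s a by (simp add: F_def normal_density_def real_sqrt_mult power2_eq_square)
  finally show ?thesis .
qed

lemma gauss_lower_tail:
  assumes s: "s > 0"
  shows "emeasure (gauss_measure s) {..- a} = emeasure (gauss_measure s) {a..}"
proof -
  have "emeasure (gauss_measure s) {..- a} = (\<integral>\<^sup>+ x. ennreal (normal_density 0 s x) * indicator {..- a} x \<partial>lborel)"
    unfolding gauss_measure_def by (subst emeasure_density) auto
  also have "\<dots> = (\<integral>\<^sup>+ x. ennreal (normal_density 0 s x) * indicator {a..} x \<partial>lborel)"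
    by (subst nn_integral_real_affine[where c="-1" and t=0])
       (auto simp: normal_density_def indicator_def intro!: nn_integral_cong)
  also have "\<dots> = emeasure (gauss_measure s) {a..}"
    unfolding gauss_measure_def by (subst emeasure_density) auto
  finally show ?thesis .
qed

text \<open>Only one of the two ends of \<open>{\<tau>. |\<omega>-\<tau>| \<ge> \<pi>}\<close> can come as close to 0 as \<open>\<pi>-\<delta>\<close>; the end on the other side is
at distance at least \<open>\<pi>\<close>. Keeping the two distances apart is essential for the constant in the
final estimate.\<close>

lemma gauss_two_sided_tail:
  assumes s: "s > 0" and d: "0 < \<delta>" "\<delta> < pi" and w: "\<bar>\<omega>\<bar> < \<delta>"
  defines "Q \<equiv> (\<lambda>a. s / (a * sqrt (2 * pi)) * exp (- (a\<^sup>2 / (2 * s\<^sup>2))))"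
  shows "emeasure (gauss_measure s) {\<tau>. \<bar>\<omega> - \<tau>\<bar> \<ge> pi} \<le> ennreal (Q (pi - \<delta>) + Q pi)"
proof -
  define G where "G = gauss_measure s"
  have [simp]: "sets G = sets borel" by (simp add: G_def)
  have Q: "emeasure G {a..} \<le> ennreal (Q a)" "emeasure G {..- a} \<le> ennreal (Q a)" if "a > 0" for a
    using gauss_upper_tail[OF s that] gauss_lower_tail[OF s, of a] by (simp_all add: G_def Q_def)
  have Q0: "0 \<le> Q a" if "a > 0" for a using that s by (simp add: Q_def)
  have "emeasure G {\<tau>. \<bar>\<omega> - \<tau>\<bar> \<ge> pi} \<le> ennreal (Q (pi - \<delta>)) + ennreal (Q pi)"
  proof (cases "\<omega> \<ge> 0")
    case True
    have "emeasure G {\<tau>. \<bar>\<omega> - \<tau>\<bar> \<ge> pi} \<le> emeasure G ({..- (pi - \<delta>)} \<union> {pi..})"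
      by (rule emeasure_mono) (use True w in auto)
    also have "\<dots> \<le> emeasure G {..- (pi - \<delta>)} + emeasure G {pi..}"
      by (rule emeasure_subadditive) auto
    also have "\<dots> \<le> ennreal (Q (pi - \<delta>)) + ennreal (Q pi)"
      by (intro add_mono Q) (use d in auto)
    finally show ?thesis .
  next
    case False
    have "emeasure G {\<tau>. \<bar>\<omega> - \<tau>\<bar> \<ge> pi} \<le> emeasure G ({pi - \<delta>..} \<union> {..- pi})"
      by (rule emeasure_mono) (use False w in auto)
    also have "\<dots> \<le> emeasure G {pi - \<delta>..} + emeasure G {..- pi}"
      by (rule emeasure_subadditive) auto
    also have "\<dots> \<le> ennreal (Q (pi - \<delta>)) + ennreal (Q pi)"
      by (intro add_mono Q) (use d in auto)
    finally show ?thesis .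
  qed
  then show ?thesis unfolding G_def using Q0 d by (simp add: ennreal_plus)
qed

section \<open>The truncation error\<close>

text \<open>The samples of \<open>f\<close> on a translate of the integers are, up to the factor \<open>\<surd>(2\<pi>)\<close>, Fourier coefficients of the
modulated transform on \<open>[-\<pi>, \<pi>]\<close>, so Bessel's inequality applies.\<close>

lemma samples_square_sum_le:
  fixes f g :: "real \<Rightarrow> complex"
  assumes g: "square_integrable g" and supp: "\<And>\<omega>. \<bar>\<omega>\<bar> \<ge> \<delta> \<Longrightarrow> g \<omega> = 0" and d: "\<delta> < pi"
    and f: "\<And>t. f t = complex_of_real (1 / sqrt (2 * pi)) * (LINT \<omega>|lborel. g \<omega> * cis (t * \<omega>))"
    and K: "finite K"
  shows "(\<Sum>k\<in>K. (cmod (f (\<tau> + of_int k)))\<^sup>2) \<le> (norm_L2 g)\<^sup>2"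
proof -
  have [measurable]: "g \<in> borel_measurable borel" using g by (rule square_integrable_measurable)
  define u where "u = (\<lambda>\<omega>. g \<omega> * cis (\<tau> * \<omega>))"
  have [measurable]: "u \<in> borel_measurable borel" unfolding u_def by measurable
  have u2: "(cmod (u \<omega>))\<^sup>2 = (cmod (g \<omega>))\<^sup>2" for \<omega> by (simp add: u_def norm_mult)
  have supp_pi: "indicator {- pi..- pi + 2 * pi} \<omega> *\<^sub>R v = v" if "g \<omega> = 0 \<Longrightarrow> v = 0" for \<omega> and v :: "'z::real_vector"
  proof (cases "\<bar>\<omega>\<bar> \<ge> \<delta>")
    case False
    then show ?thesis using d by (auto simp: indicator_def)
  qed (use supp that in simp)
  have int_eq: "(LINT \<omega>|period_measure (- pi). (cmod (u \<omega>))\<^sup>2) = (norm_L2 g)\<^sup>2"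
    unfolding integral_period_measure u2 by (subst supp_pi) (auto simp: norm_L2_def)
  have int: "integrable (period_measure (- pi)) (\<lambda>\<omega>. (cmod (u \<omega>))\<^sup>2)"
    unfolding period_measure_def u2 using g
    by (subst integrable_restrict_space, simp, subst supp_pi) (auto simp: square_integrable_def)
  have coeff: "f (\<tau> + of_int k) = complex_of_real (sqrt (2 * pi)) * fourier_coeff (- pi) u (- k)" for k
  proof -
    have eq: "u \<omega> * cis (- (real_of_int (- k) * \<omega>)) = g \<omega> * cis ((\<tau> + of_int k) * \<omega>)" for \<omega>
      unfolding u_def mult.assoc cis_mult by (simp add: algebra_simps)
    have "fourier_coeff (- pi) u (- k) = (LINT \<omega>|lborel. g \<omega> * cis ((\<tau> + of_int k) * \<omega>)) / (2 * pi)"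
      unfolding fourier_coeff_def eq integral_period_measure by (subst supp_pi) auto
    moreover have "complex_of_real (sqrt (2 * pi)) * (z / (2 * pi)) = complex_of_real (1 / sqrt (2 * pi)) * z" for z :: complex
    proof -
      have "sqrt (2 * pi) / (2 * pi) = 1 / sqrt (2 * pi)"
        using real_div_sqrt[of "2 * pi"] by (simp add: field_simps)
      then have "complex_of_real (sqrt (2 * pi)) / complex_of_real (2 * pi) = complex_of_real (1 / sqrt (2 * pi))"
        by (simp only: of_real_divide[symmetric])
      then show ?thesis by (simp add: field_simps)
    qed
    ultimately show ?thesis unfolding f by (simp only:)
  qed
  have "(\<Sum>k\<in>K. (cmod (f (\<tau> + of_int k)))\<^sup>2) = 2 * pi * (\<Sum>k\<in>K. (cmod (fourier_coeff (- pi) u (- k)))\<^sup>2)"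
    unfolding coeff by (simp add: norm_mult power_mult_distrib sum_distrib_left)
  also have "(\<Sum>k\<in>K. (cmod (fourier_coeff (- pi) u (- k)))\<^sup>2) = (\<Sum>k\<in>uminus ` K. (cmod (fourier_coeff (- pi) u k))\<^sup>2)"
    by (rule sum.reindex_cong[symmetric, where l=uminus]) (auto simp: inj_on_def)
  also have "2 * pi * \<dots> \<le> (LINT \<omega>|period_measure (- pi). (cmod (u \<omega>))\<^sup>2)"
    by (rule bessel_inequality[OF _ int]) (use K in auto)
  finally show ?thesis unfolding int_eq .
qed

lemma sum_le_geometric:
  fixes b :: "'a \<Rightarrow> real" and j :: "'a \<Rightarrow> nat"
  assumes "finite K" and inj: "inj_on j K" and le: "\<And>k. k \<in> K \<Longrightarrow> b k \<le> C * r ^ j k"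
    and r: "0 \<le> r" "r < 1" and C: "0 \<le> C"
  shows "(\<Sum>k\<in>K. b k) \<le> C / (1 - r)"
proof -
  have "(\<Sum>k\<in>K. b k) \<le> (\<Sum>k\<in>K. C * r ^ j k)" by (rule sum_mono) (rule le)
  also have "\<dots> = C * (\<Sum>i\<in>j ` K. r ^ i)"
    unfolding sum_distrib_left by (rule sum.reindex_cong[symmetric, OF inj]) auto
  also have "(\<Sum>i\<in>j ` K. r ^ i) \<le> (\<Sum>i. r ^ i)"
    by (rule sum_le_suminf) (use r assms(1) in \<open>auto intro: summable_geometric\<close>)
  also have "\<dots> = 1 / (1 - r)" using r by (intro suminf_geometric) simp
  finally show ?thesis using C by (simp add: mult_left_mono)
qed

text \<open>For \<open>|x| > m\<close> the tangent-line bound \<open>x\<^sup>2 \<ge> m\<^sup>2 + 2m(|x| - m)\<close> turns the Gaussian into a geometric sequence. On each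
side of \<open>t\<close> the distances \<open>|t-k| - m\<close> dominate distinct natural numbers.\<close>

lemma gauss_sinc_tail_sum:
  fixes m :: nat and d t :: real
  assumes m: "m > 0" and d: "d > 0" and \<sigma>: "\<sigma>\<^sup>2 = real m / d" and K: "finite K"
    and far: "\<And>k. k \<in> K \<Longrightarrow> \<bar>t - of_int k\<bar> > real m"
  shows "(\<Sum>k\<in>K. (cardinal_sine (t - of_int k) * gauss_window \<sigma> (t - of_int k))\<^sup>2)
      \<le> 2 * exp (- (real m * d)) / (1 - exp (- (2 * d))) / (pi * real m)\<^sup>2"
proof -
  define b where "b = (\<lambda>k. (cardinal_sine (t - of_int k) * gauss_window \<sigma> (t - of_int k))\<^sup>2)"
  define C where "C = exp (- (real m * d)) / (pi * real m)\<^sup>2"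
  define r where "r = exp (- (2 * d))"
  have r: "0 \<le> r" "r < 1" using d by (auto simp: r_def)
  have C: "0 \<le> C" by (simp add: C_def)
  have bound: "b k \<le> C * r ^ j" if k: "k \<in> K" and j: "real j \<le> \<bar>t - of_int k\<bar> - real m" for k j
  proof -
    define x where "x = t - of_int k"
    have x: "\<bar>x\<bar> > real m" using far[OF k] by (simp add: x_def)
    have "x \<noteq> 0" using x by auto
    have "(cardinal_sine x)\<^sup>2 = (sin (pi * x))\<^sup>2 / (pi * x)\<^sup>2"
      using \<open>x \<noteq> 0\<close> by (simp add: cardinal_sine_def power_divide)
    also have "\<dots> \<le> 1 / (pi * real m)\<^sup>2"
    proof (rule frac_le)
      show "(sin (pi * x))\<^sup>2 \<le> 1" by (simp add: abs_square_le_1)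
      show "0 < (pi * real m)\<^sup>2" using m by simp
      have "\<bar>pi * real m\<bar> \<le> \<bar>pi * x\<bar>" using x by (simp add: abs_mult)
      then show "(pi * real m)\<^sup>2 \<le> (pi * x)\<^sup>2" by (rule abs_le_square_iff[THEN iffD1])
    qed auto
    finally have sinc: "(cardinal_sine x)\<^sup>2 \<le> 1 / (pi * real m)\<^sup>2" .
    have "0 \<le> (\<bar>x\<bar> - real m)\<^sup>2" by simp
    then have "real m * (real m + 2 * (\<bar>x\<bar> - real m)) \<le> x\<^sup>2"
      by (simp add: power2_diff algebra_simps power2_eq_square)
    moreover have "real m * (real m + 2 * real j) \<le> real m * (real m + 2 * (\<bar>x\<bar> - real m))"
      using j by (intro mult_left_mono) (auto simp: x_def)
    ultimately have "real m * (real m + 2 * real j) \<le> x\<^sup>2" by linarith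
    then have "d * (real m * (real m + 2 * real j)) \<le> d * x\<^sup>2"
      using d by (intro mult_left_mono) auto
    then have "real m * d + 2 * d * real j \<le> x\<^sup>2 * d / real m"
      using m by (simp add: field_simps)
    moreover have "(gauss_window \<sigma> x)\<^sup>2 = exp (- (x\<^sup>2 * d / real m))"
      using m d by (simp add: gauss_window_def \<sigma> flip: exp_double)
    ultimately have gw: "(gauss_window \<sigma> x)\<^sup>2 \<le> exp (- (real m * d)) * r ^ j"
      by (simp add: r_def mult_ac flip: exp_of_nat_mult exp_add)
    have "b k \<le> 1 / (pi * real m)\<^sup>2 * (exp (- (real m * d)) * r ^ j)"
      unfolding b_def x_def[symmetric] power_mult_distrib[of "cardinal_sine x"]
      by (intro mult_mono sinc gw) auto
    then show ?thesis by (simp add: C_def)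
  qed
  define K1 where "K1 = {k \<in> K. t - of_int k > real m}"
  define K2 where "K2 = {k \<in> K. of_int k - t > real m}"
  have K12: "finite K1" "finite K2" "K = K1 \<union> K2" "K1 \<inter> K2 = {}"
    using K far by (force simp: K1_def K2_def)+
  have 1: "(\<Sum>k\<in>K1. b k) \<le> C / (1 - r)"
  proof (rule sum_le_geometric[OF K12(1) _ _ r C])
    have le: "k \<le> \<lfloor>t - real m\<rfloor>" if "k \<in> K1" for k
      using that by (simp add: K1_def le_floor_iff)
    show "inj_on (\<lambda>k. nat (\<lfloor>t - real m\<rfloor> - k)) K1"
      using le by (auto intro!: inj_onI simp: eq_nat_nat_iff)
    fix k assume k: "k \<in> K1"
    have "real (nat (\<lfloor>t - real m\<rfloor> - k)) = of_int \<lfloor>t - real m\<rfloor> - of_int k" using le[OF k] by simp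
    also have "\<dots> \<le> \<bar>t - of_int k\<bar> - real m" using of_int_floor_le[of "t - real m"] by linarith
    finally show "b k \<le> C * r ^ nat (\<lfloor>t - real m\<rfloor> - k)" using k by (intro bound) (auto simp: K1_def)
  qed
  have 2: "(\<Sum>k\<in>K2. b k) \<le> C / (1 - r)"
  proof (rule sum_le_geometric[OF K12(2) _ _ r C])
    have le: "\<lceil>t + real m\<rceil> \<le> k" if "k \<in> K2" for k
      using that by (simp add: K2_def ceiling_le_iff)
    show "inj_on (\<lambda>k. nat (k - \<lceil>t + real m\<rceil>)) K2"
      using le by (auto intro!: inj_onI simp: eq_nat_nat_iff)
    fix k assume k: "k \<in> K2"
    have "real (nat (k - \<lceil>t + real m\<rceil>)) = of_int k - of_int \<lceil>t + real m\<rceil>" using le[OF k] by simp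
    also have "\<dots> \<le> \<bar>t - of_int k\<bar> - real m" using le_of_int_ceiling[of "t + real m"] by linarith
    finally show "b k \<le> C * r ^ nat (k - \<lceil>t + real m\<rceil>)" using k by (intro bound) (auto simp: K2_def)
  qed
  have "(\<Sum>k\<in>K. b k) = (\<Sum>k\<in>K1. b k) + (\<Sum>k\<in>K2. b k)"
    unfolding K12(3) by (rule sum.union_disjoint[OF K12(1,2,4)])
  also have "\<dots> \<le> 2 * (C / (1 - r))" using 1 2 by simp
  also have "\<dots> = 2 * exp (- (real m * d)) / (1 - r) / (pi * real m)\<^sup>2" by (simp add: C_def)
  finally show ?thesis by (simp add: b_def r_def)
qed

lemma truncation_error:
  fixes f g :: "real \<Rightarrow> complex" and m :: nat
  assumes g: "square_integrable g" and supp: "\<And>\<omega>. \<bar>\<omega>\<bar> \<ge> \<delta> \<Longrightarrow> g \<omega> = 0" and d: "\<delta> < pi"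
    and f: "\<And>t. f t = complex_of_real (1 / sqrt (2 * pi)) * (LINT \<omega>|lborel. g \<omega> * cis (t * \<omega>))"
    and m: "m > 0" and \<sigma>: "\<sigma>\<^sup>2 = real m / (pi - \<delta>)" and K: "finite K"
    and far: "\<And>k. k \<in> K \<Longrightarrow> \<bar>t - of_int k\<bar> > real m"
  shows "cmod (\<Sum>k\<in>K. f (of_int k) * complex_of_real (cardinal_sine (t - of_int k) * gauss_window \<sigma> (t - of_int k)))
     \<le> sqrt (2 + 1 / (pi - \<delta>)) / (pi * real m) * exp (- (real m * (pi - \<delta>) / 2)) * norm_L2 g"
proof -
  define x where "x = pi - \<delta>"
  have x: "x > 0" using d by (simp add: x_def)
  define b where "b = (\<lambda>k. cardinal_sine (t - of_int k) * gauss_window \<sigma> (t - of_int k))"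
  have bb: "(\<Sum>k\<in>K. (b k)\<^sup>2) \<le> (2 + 1 / x) * exp (- (real m * x)) / (pi * real m)\<^sup>2"
  proof -
    have "2 * exp (- (real m * x)) / (1 - exp (- (2 * x))) \<le> (2 + 1 / x) * exp (- (real m * x))"
    proof -
      \<comment> \<open>The geometric series satisfies \<open>1 / (1 - exp(-y)) \<le> 1 + 1/y\<close>, used with \<open>y = 2x\<close>.\<close>
      have "1 + 2 * x \<le> exp (2 * x)" by (rule exp_ge_add_one_self)
      then have e: "(1 + 2 * x) * exp (- (2 * x)) \<le> 1"
        by (simp add: exp_minus field_simps)
      have p: "1 - exp (- (2 * x)) > 0" using x by simp
      have "2 * x \<le> (2 * x + 1) * (1 - exp (- (2 * x)))"
        using e by (simp add: algebra_simps)
      then have "2 / (1 - exp (- (2 * x))) \<le> (2 * x + 1) / x"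
        using x p by (simp add: field_simps)
      also have "(2 * x + 1) / x = 2 + 1 / x" using x by (simp add: field_simps)
      finally have "2 / (1 - exp (- (2 * x))) * exp (- (real m * x)) \<le> (2 + 1 / x) * exp (- (real m * x))"
        by (rule mult_right_mono) simp
      then show ?thesis by simp
    qed
    then have "2 * exp (- (real m * x)) / (1 - exp (- (2 * x))) / (pi * real m)\<^sup>2 \<le> (2 + 1 / x) * exp (- (real m * x)) / (pi * real m)\<^sup>2"
      by (rule divide_right_mono) simp
    with gauss_sinc_tail_sum[OF m x \<sigma>[folded x_def] K far] show ?thesis
      unfolding b_def by linarith
  qed
  have ff: "(\<Sum>k\<in>K. (cmod (f (of_int k)))\<^sup>2) \<le> (norm_L2 g)\<^sup>2"
    using samples_square_sum_le[OF g supp d f K, of 0] by simp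
  have "cmod (\<Sum>k\<in>K. f (of_int k) * complex_of_real (b k)) \<le> (\<Sum>k\<in>K. cmod (f (of_int k)) * \<bar>b k\<bar>)"
    by (rule order_trans[OF norm_sum]) (simp add: norm_mult)
  also have "\<dots> \<le> sqrt ((\<Sum>k\<in>K. (cmod (f (of_int k)))\<^sup>2) * (\<Sum>k\<in>K. (b k)\<^sup>2))"
    using Cauchy_Schwarz_ineq_sum[of "\<lambda>k. cmod (f (of_int k))" "\<lambda>k. \<bar>b k\<bar>" K]
    by (intro real_le_rsqrt) simp
  also have "\<dots> \<le> sqrt ((norm_L2 g)\<^sup>2 * ((2 + 1 / x) * exp (- (real m * x)) / (pi * real m)\<^sup>2))"
    by (intro real_sqrt_le_mono mult_mono ff bb sum_nonneg) auto
  also have "\<dots> = norm_L2 g * (sqrt (2 + 1 / x) * exp (- (real m * x / 2)) / (pi * real m))"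
  proof -
    have "exp (- (real m * x)) = (exp (- (real m * x / 2)))\<^sup>2" by (simp flip: exp_double)
    then show ?thesis by (simp add: real_sqrt_mult real_sqrt_divide)
  qed
  finally show ?thesis by (simp add: b_def x_def mult_ac)
qed

section \<open>Membership in the space of continuous functions vanishing at infinity\<close>

lemma bandlimited_lipschitz:
  fixes f g :: "real \<Rightarrow> complex"
  assumes g: "integrable lborel g" and supp: "\<And>\<omega>. \<bar>\<omega>\<bar> \<ge> \<delta> \<Longrightarrow> g \<omega> = 0"
    and f: "\<And>t. f t = complex_of_real (1 / sqrt (2 * pi)) * (LINT \<omega>|lborel. g \<omega> * cis (t * \<omega>))"
  shows "cmod (f s - f t) \<le> 1 / sqrt (2 * pi) * \<delta> * (LINT \<omega>|lborel. cmod (g \<omega>)) * \<bar>s - t\<bar>"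
proof -
  have gc: "integrable lborel (\<lambda>\<omega>. g \<omega> * cis (a * \<omega>))" for a
    by (rule Bochner_Integration.integrable_bound[OF g])
       (use g in \<open>auto simp: norm_mult intro!: borel_measurable_times\<close>)
  have "(LINT \<omega>|lborel. g \<omega> * cis (s * \<omega>)) - (LINT \<omega>|lborel. g \<omega> * cis (t * \<omega>)) =
      (LINT \<omega>|lborel. g \<omega> * cis (s * \<omega>) - g \<omega> * cis (t * \<omega>))"
    using gc by simp
  also have "cmod \<dots> \<le> (LINT \<omega>|lborel. cmod (g \<omega> * cis (s * \<omega>) - g \<omega> * cis (t * \<omega>)))"
    by (rule integral_norm_bound)
  also have "\<dots> \<le> (LINT \<omega>|lborel. (\<delta> * \<bar>s - t\<bar>) * cmod (g \<omega>))"
  proof (rule integral_mono)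
    fix \<omega>
    show "cmod (g \<omega> * cis (s * \<omega>) - g \<omega> * cis (t * \<omega>)) \<le> (\<delta> * \<bar>s - t\<bar>) * cmod (g \<omega>)"
    proof (cases "\<bar>\<omega>\<bar> \<ge> \<delta>")
      case False
      have "cis (s * \<omega>) = cis (t * \<omega>) * cis ((s - t) * \<omega>)"
        unfolding cis_mult by (simp add: algebra_simps)
      then have "g \<omega> * cis (s * \<omega>) - g \<omega> * cis (t * \<omega>) = g \<omega> * cis (t * \<omega>) * (cis ((s - t) * \<omega>) - 1)"
        by (simp add: algebra_simps)
      then have "cmod (g \<omega> * cis (s * \<omega>) - g \<omega> * cis (t * \<omega>)) = cmod (g \<omega>) * cmod (cis ((s - t) * \<omega>) - 1)"
        by (simp add: norm_mult)
      also have "\<dots> \<le> cmod (g \<omega>) * (\<bar>s - t\<bar> * \<bar>\<omega>\<bar>)"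
        using norm_cis_minus_1_le[of "(s - t) * \<omega>"] by (intro mult_left_mono) (auto simp: abs_mult)
      also have "\<dots> \<le> cmod (g \<omega>) * (\<bar>s - t\<bar> * \<delta>)"
        using False by (intro mult_left_mono) auto
      finally show ?thesis by (simp add: mult_ac)
    qed (simp add: supp)
  qed (use gc g in auto)
  also have "\<dots> = \<delta> * \<bar>s - t\<bar> * (LINT \<omega>|lborel. cmod (g \<omega>))" by simp
  finally have "cmod ((LINT \<omega>|lborel. g \<omega> * cis (s * \<omega>)) - (LINT \<omega>|lborel. g \<omega> * cis (t * \<omega>)))
      \<le> \<delta> * \<bar>s - t\<bar> * (LINT \<omega>|lborel. cmod (g \<omega>))" .
  from mult_left_mono[OF this, of "1 / sqrt (2 * pi)"]
  show ?thesis
    unfolding f right_diff_distrib[symmetric] norm_mult by (simp add: mult_ac norm_divide)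
qed

lemma bounded_square_sums_finite_large:
  fixes a :: "int \<Rightarrow> complex"
  assumes bd: "\<And>K. finite K \<Longrightarrow> (\<Sum>k\<in>K. (cmod (a k))\<^sup>2) \<le> B" and e: "\<epsilon> > 0"
  shows "finite {k. cmod (a k) \<ge> \<epsilon>}"
proof (rule ccontr)
  assume inf: "infinite {k. cmod (a k) \<ge> \<epsilon>}"
  obtain n :: nat where n: "B / \<epsilon>\<^sup>2 < real n" using reals_Archimedean2 by blast
  obtain K where K: "K \<subseteq> {k. cmod (a k) \<ge> \<epsilon>}" "finite K" "card K = n"
    using infinite_arbitrarily_large[OF inf] by blast
  have "real n * \<epsilon>\<^sup>2 = (\<Sum>k\<in>K. \<epsilon>\<^sup>2)" using K by simp
  also have "\<dots> \<le> (\<Sum>k\<in>K. (cmod (a k))\<^sup>2)"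
    using K e by (intro sum_mono power_mono) auto
  also have "\<dots> \<le> B" by (rule bd) (rule K)
  finally show False using n e by (simp add: field_simps)
qed

text \<open>The samples on every translate of the integers tend to 0, being square summable. Since \<open>f\<close> is Lipschitz, finitely
many translates \<open>i/n + \<int>\<close> suffice to control \<open>f\<close> up to a prescribed error.\<close>

lemma bandlimited_tendsto_0:
  fixes f g :: "real \<Rightarrow> complex"
  assumes g: "square_integrable g" "integrable lborel g" and supp: "\<And>\<omega>. \<bar>\<omega>\<bar> \<ge> \<delta> \<Longrightarrow> g \<omega> = 0"
    and d: "0 < \<delta>" "\<delta> < pi"
    and f: "\<And>t. f t = complex_of_real (1 / sqrt (2 * pi)) * (LINT \<omega>|lborel. g \<omega> * cis (t * \<omega>))"
  shows "(f \<longlongrightarrow> 0) at_infinity"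
proof (rule tendstoI)
  fix \<epsilon> :: real assume e: "\<epsilon> > 0"
  \<comment> \<open>\<open>L\<close> is a Lipschitz constant of \<open>f\<close>; sample points at spacing \<open>1/n\<close> approximate \<open>f\<close> up to \<open>L/n < \<epsilon>/2\<close>.\<close>
  define L where "L = 1 / sqrt (2 * pi) * \<delta> * (LINT \<omega>|lborel. cmod (g \<omega>))"
  have L0: "0 \<le> L" using d by (simp add: L_def)
  have lip: "cmod (f s - f t) \<le> L * \<bar>s - t\<bar>" for s t
    unfolding L_def by (rule bandlimited_lipschitz[OF g(2) supp f])
  obtain n :: nat where n: "2 * (L + 1) / \<epsilon> < real n" using reals_Archimedean2 by blast
  have n0: "real n > 0" using n L0 e by (intro le_less_trans[OF _ n]) auto
  have Ln: "L / real n < \<epsilon> / 2"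
  proof -
    have "2 * L < real n * \<epsilon>" using n e by (simp add: field_simps)
    then show ?thesis using n0 by (simp add: field_simps)
  qed
  define S where "S = (\<Union>i\<in>{..<n}. {k::int. cmod (f (real i / real n + of_int k)) \<ge> \<epsilon> / 2})"
  have "finite S"
    unfolding S_def
    using e by (intro finite_UN_I bounded_square_sums_finite_large[where B="(norm_L2 g)\<^sup>2"] samples_square_sum_le[OF g(1) supp d(2) f]) auto
  then obtain B where B: "\<And>k. k \<in> S \<Longrightarrow> \<bar>k\<bar> \<le> B"
    using finite_has_maximal[of "insert 0 (abs ` S)"] by (metis (no_types, lifting) Max_ge finite_imageI imageI)
  have "cmod (f t) < \<epsilon>" if t: "\<bar>t\<bar> \<ge> real_of_int B + 2" for t
  proof -
    define k where "k = \<lfloor>t\<rfloor>"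
    define i where "i = nat \<lfloor>(t - of_int k) * real n\<rfloor>"
    have fr: "0 \<le> t - of_int k" "t - of_int k < 1" unfolding k_def by linarith+
    have fl: "of_int \<lfloor>(t - of_int k) * real n\<rfloor> \<le> (t - of_int k) * real n"
      "(t - of_int k) * real n < of_int \<lfloor>(t - of_int k) * real n\<rfloor> + 1" by linarith+
    have i: "real i = of_int \<lfloor>(t - of_int k) * real n\<rfloor>"
      unfolding i_def using fr n0 by (simp add: zero_le_mult_iff)
    have "(t - of_int k) * real n < real n" using fr n0 by simp
    then have "i < n" using fl i by linarith
    have "\<bar>k\<bar> > B" using t unfolding k_def by linarith
    then have "k \<notin> S" using B by force
    then have small: "cmod (f (real i / real n + of_int k)) < \<epsilon> / 2"
      using \<open>i < n\<close> by (auto simp: S_def not_le)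
    have "\<bar>t - (real i / real n + of_int k)\<bar> \<le> 1 / real n"
    proof -
      have "t - (real i / real n + of_int k) = ((t - of_int k) * real n - real i) / real n"
        using n0 by (simp add: field_simps)
      moreover have "\<bar>(t - of_int k) * real n - real i\<bar> \<le> 1" using fl i by linarith
      ultimately show ?thesis using n0 by (simp add: divide_right_mono)
    qed
    then have "cmod (f t - f (real i / real n + of_int k)) \<le> L * (1 / real n)"
      using lip[of t "real i / real n + of_int k"] L0 by (meson mult_left_mono order_trans)
    then have "cmod (f t - f (real i / real n + of_int k)) \<le> L / real n" by simp
    then have "cmod (f t - f (real i / real n + of_int k)) < \<epsilon> / 2" using Ln by linarith
    then show ?thesis
      using small norm_triangle_ineq[of "f t - f (real i / real n + of_int k)" "f (real i / real n + of_int k)"] by simp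
  qed
  then show "\<forall>\<^sub>F t in at_infinity. dist (f t) 0 < \<epsilon>"
    unfolding eventually_at_infinity by (intro exI[of _ "real_of_int B + 2"]) simp
qed

definition truncated_kernel :: "real \<Rightarrow> nat \<Rightarrow> real \<Rightarrow> real" where
  "truncated_kernel \<sigma> m x = cardinal_sine x * gauss_window \<sigma> x * indicator {- real m..real m} x"

lemma truncated_kernel_outside: "\<bar>x\<bar> > real m \<Longrightarrow> truncated_kernel \<sigma> m x = 0"
  by (auto simp: truncated_kernel_def indicator_def)

lemma truncated_kernel_bound: "\<bar>truncated_kernel \<sigma> m x\<bar> \<le> 1"
proof -
  have "\<bar>cardinal_sine x\<bar> \<le> 1"
    using abs_sin_x_le_abs_x[of "pi * x"] by (auto simp: cardinal_sine_def abs_mult divide_le_eq_1)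
  moreover have "\<bar>gauss_window \<sigma> x\<bar> \<le> 1" by (simp add: gauss_window_def)
  ultimately have "\<bar>cardinal_sine x\<bar> * \<bar>gauss_window \<sigma> x\<bar> \<le> 1 * 1" by (intro mult_mono) auto
  then show ?thesis by (auto simp: truncated_kernel_def abs_mult indicator_def)
qed

text \<open>The cutoff creates no jump because the cardinal sine vanishes at the integers \<open>\<plusminus>m\<close>.\<close>

lemma truncated_kernel_continuous: 
  assumes "m > 0"
  shows "continuous_on UNIV (truncated_kernel \<sigma> m)"
proof -
  have cs: "continuous_on UNIV cardinal_sine"
    unfolding cardinal_sine_eq_sinc[abs_def] by (intro continuous_intros)
  have gw: "continuous_on UNIV (gauss_window \<sigma>)"
    unfolding gauss_window_def[abs_def]
    by (cases "\<sigma> = 0") (auto intro!: continuous_intros)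
  have eq: "truncated_kernel \<sigma> m = (\<lambda>x. if x \<in> {- real m..real m} then cardinal_sine x * gauss_window \<sigma> x else 0)"
    by (auto simp: truncated_kernel_def fun_eq_iff)
  have fr: "cardinal_sine x = 0" if "x = real m \<or> x = - real m" for x
    using that assms sin_npi2[of m] by (auto simp: cardinal_sine_def)
  have "continuous_on ({- real m..real m} \<union> ({..- real m} \<union> {real m..}))
      (\<lambda>x. if x \<in> {- real m..real m} then cardinal_sine x * gauss_window \<sigma> x else 0)"
    by (rule continuous_on_If)
       (auto intro!: continuous_intros continuous_on_subset[OF cs] continuous_on_subset[OF gw] simp: fr)
  moreover have "{- real m..real m} \<union> ({..- real m} \<union> {real m..}) = UNIV" by auto
  ultimately show ?thesis unfolding eq by simp
qed

lemma regularized_shannon_finite: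
  assumes K: "finite K" and sup: "\<And>k. k \<notin> K \<Longrightarrow> \<bar>t - of_int k\<bar> > real m"
  shows "regularized_shannon (gauss_window \<sigma>) m f t =
     (\<Sum>k\<in>K. f (of_int k) * complex_of_real (truncated_kernel \<sigma> m (t - of_int k)))"
proof -
  have "regularized_shannon (gauss_window \<sigma>) m f t =
      (\<Sum>\<^sub>\<infinity>k\<in>K. f (of_int k) * complex_of_real (truncated_kernel \<sigma> m (t - of_int k)))"
    unfolding regularized_shannon_def truncated_kernel_def[symmetric]
    by (rule infsum_cong_neutral) (auto simp: sup truncated_kernel_outside)
  then show ?thesis using K by simp
qed

lemma regularized_shannon_continuous:
  assumes "m > 0"
  shows "continuous_on UNIV (regularized_shannon (gauss_window \<sigma>) m f)"
proof -
  have "isCont (regularized_shannon (gauss_window \<sigma>) m f) t0" for t0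
  proof -
    define K where "K = {\<lfloor>t0 - real m\<rfloor> - 1..\<lceil>t0 + real m\<rceil> + 1}"
    have "continuous_on {t0 - 1<..<t0 + 1} (\<lambda>t. \<Sum>k\<in>K. f (of_int k) * complex_of_real (truncated_kernel \<sigma> m (t - of_int k)))"
      by (intro continuous_intros continuous_on_compose2[OF truncated_kernel_continuous[OF assms]]) auto
    moreover have "regularized_shannon (gauss_window \<sigma>) m f t =
        (\<Sum>k\<in>K. f (of_int k) * complex_of_real (truncated_kernel \<sigma> m (t - of_int k)))" if t: "t \<in> {t0 - 1<..<t0 + 1}" for t
    proof (rule regularized_shannon_finite)
      fix k assume "k \<notin> K"
      then have "k < \<lfloor>t0 - real m\<rfloor> - 1 \<or> \<lceil>t0 + real m\<rceil> + 1 < k" by (auto simp: K_def)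
      then show "\<bar>t - of_int k\<bar> > real m" using t by (auto; linarith)
    qed (simp add: K_def)
    ultimately have "continuous_on {t0 - 1<..<t0 + 1} (regularized_shannon (gauss_window \<sigma>) m f)"
      by (subst continuous_on_cong[OF refl])
    then show ?thesis by (simp add: continuous_on_eq_continuous_at)
  qed
  then show ?thesis by (simp add: continuous_on_eq_continuous_at)
qed

lemma regularized_shannon_tendsto_0:
  assumes f: "(f \<longlongrightarrow> 0) at_infinity"
  shows "(regularized_shannon (gauss_window \<sigma>) m f \<longlongrightarrow> 0) at_infinity"
proof (rule tendstoI)
  fix \<epsilon> :: real assume e: "\<epsilon> > 0"
  \<comment> \<open>The sum for the regularized formula has at most \<open>2m + 3\<close> nonzero terms.\<close>
  define \<eta> where "\<eta> = \<epsilon> / (2 * real m + 4)"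
  have \<eta>: "\<eta> > 0" using e by (simp add: \<eta>_def)
  obtain B where B: "\<And>t. \<bar>t\<bar> \<ge> B \<Longrightarrow> cmod (f t) < \<eta>"
    using tendstoD[OF f \<eta>] by (auto simp: eventually_at_infinity)
  have "cmod (regularized_shannon (gauss_window \<sigma>) m f t) < \<epsilon>" if t: "\<bar>t\<bar> \<ge> B + real m" for t
  proof -
    define K where "K = {k. \<bar>t - of_int k\<bar> \<le> real m}"
    have sub: "K \<subseteq> {\<lceil>t - real m\<rceil>..\<lfloor>t + real m\<rfloor>}"
      unfolding K_def
      by (rule subsetI) (simp only: mem_Collect_eq atLeastAtMost_iff ceiling_le_iff le_floor_iff, linarith)
    then have fin: "finite K" by (rule finite_subset) simp
    have "card K \<le> nat (\<lfloor>t + real m\<rfloor> - \<lceil>t - real m\<rceil> + 1)"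
      using card_mono[OF _ sub] by simp
    then have cd: "real (card K) \<le> 2 * real m + 3" by linarith
    have "regularized_shannon (gauss_window \<sigma>) m f t =
        (\<Sum>k\<in>K. f (of_int k) * complex_of_real (truncated_kernel \<sigma> m (t - of_int k)))"
      by (rule regularized_shannon_finite[OF fin]) (auto simp: K_def)
    also have "cmod \<dots> \<le> (\<Sum>k\<in>K. \<eta> * 1)"
    proof (rule sum_norm_le)
      fix k assume "k \<in> K"
      then have "\<bar>real_of_int k\<bar> \<ge> B" using t by (auto simp: K_def)
      then have "cmod (f (of_int k)) * \<bar>truncated_kernel \<sigma> m (t - of_int k)\<bar> \<le> \<eta> * 1"
        by (intro mult_mono truncated_kernel_bound less_imp_le[OF B]) (use \<eta> in auto)
      then show "cmod (f (of_int k) * complex_of_real (truncated_kernel \<sigma> m (t - of_int k))) \<le> \<eta> * 1"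
        by (simp add: norm_mult)
    qed
    also have "\<dots> = real (card K) * \<eta>" by simp
    also have "\<dots> \<le> (2 * real m + 3) * \<eta>" using cd \<eta> by (intro mult_right_mono) auto
    also have "\<dots> < \<epsilon>" using e by (simp add: \<eta>_def field_simps)
    finally show ?thesis .
  qed
  then show "\<forall>\<^sub>F t in at_infinity. dist (regularized_shannon (gauss_window \<sigma>) m f t) 0 < \<epsilon>"
    unfolding eventually_at_infinity by (intro exI[of _ "B + real m"]) simp
qed

section \<open>The error estimate\<close>

text \<open>Let \<open>x = \<pi> - \<delta>\<close>, \<open>s = x/\<pi>\<close>, and let \<open>U E\<close> be half of the right-hand side. The first summand is at most
\<open>\<surd>(1-s) (1+s) U E\<close>, where \<open>\<surd>(1-s)\<close> comes from the bandwidth \<open>\<delta> = \<pi>(1-s)\<close> and the \<open>s\<close> in \<open>1+s\<close> from the tail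
at distance \<open>\<pi>\<close>; this is at most \<open>1.1 U E\<close>. The second one is at most \<open>0.8 U E\<close> because \<open>m \<ge> 2\<close> and
\<open>x < \<pi>\<close>.\<close>

lemma shannon_constants_bound:
  fixes \<delta> :: real and m :: nat
  assumes d: "0 < \<delta>" "\<delta> < pi" and m: "m \<ge> 2" and \<sigma>: "\<sigma> > 0" "\<sigma>\<^sup>2 = real m / (pi - \<delta>)"
  defines "Q \<equiv> (\<lambda>a. (1 / \<sigma>) / (a * sqrt (2 * pi)) * exp (- (a\<^sup>2 / (2 * (1 / \<sigma>)\<^sup>2))))"
  shows "1 / sqrt (2 * pi) * (2 * (Q (pi - \<delta>) + Q pi) * sqrt (2 * \<delta>))
      + sqrt (2 + 1 / (pi - \<delta>)) / (pi * real m) * exp (- (real m * (pi - \<delta>) / 2))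
    \<le> 2 * sqrt 2 / sqrt (pi * real m * (pi - \<delta>)) * exp (- (real m * (pi - \<delta>) / 2))"
proof -
  define x where "x = pi - \<delta>"
  have x: "0 < x" "x < pi" using d by (auto simp: x_def)
  have m0: "0 < real m" using m by simp
  define E where "E = exp (- (real m * x / 2))"
  have E0: "0 < E" by (simp add: E_def)
  define s where "s = x / pi"
  have s: "0 < s" "s < 1" using x by (auto simp: s_def)
  define U where "U = sqrt 2 / sqrt (pi * real m * x)"
  have U0: "0 < U" using m0 x by (simp add: U_def)
  have \<sigma>x: "\<sigma>\<^sup>2 = real m / x" using \<sigma> by (simp add: x_def)
  have \<sigma>x': "\<sigma> * x = sqrt (real m * x)"
  proof -
    have "(\<sigma> * x)\<^sup>2 = real m * x"
      unfolding power_mult_distrib \<sigma>x using x by (simp add: power2_eq_square)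
    then show ?thesis using \<sigma> x by (metis less_eq_real_def mult_nonneg_nonneg real_sqrt_unique)
  qed
  have Qx: "Q x = U / 2 * E"
  proof -
    have "x\<^sup>2 / (2 * (1 / \<sigma>)\<^sup>2) = x\<^sup>2 * \<sigma>\<^sup>2 / 2" by (simp add: power_divide)
    also have "\<dots> = real m * x / 2" unfolding \<sigma>x using x by (simp add: power2_eq_square)
    finally have "x\<^sup>2 / (2 * (1 / \<sigma>)\<^sup>2) = real m * x / 2" .
    moreover have "(1 / \<sigma>) / (x * sqrt (2 * pi)) = U / 2"
    proof -
      have "(1 / \<sigma>) / (x * sqrt (2 * pi)) = 1 / (sqrt (real m * x) * sqrt (2 * pi))"
        using \<sigma>x' by (simp add: mult.assoc[symmetric] mult.commute)
      also have "\<dots> = 1 / (sqrt 2 * sqrt (pi * real m * x))"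
        by (simp add: real_sqrt_mult mult_ac)
      also have "\<dots> = U / 2" unfolding U_def using m0 x by (simp add: field_simps)
      finally show ?thesis .
    qed
    ultimately show ?thesis unfolding Q_def E_def by (simp only:)
  qed
  have Qpi: "Q pi \<le> s * (U / 2 * E)"
  proof -
    have "Q pi \<le> (1 / \<sigma>) / (pi * sqrt (2 * pi)) * exp (- (x\<^sup>2 / (2 * (1 / \<sigma>)\<^sup>2)))"
      unfolding Q_def using x \<sigma> by (intro mult_left_mono) (auto intro!: divide_right_mono power_mono)
    also have "\<dots> = s * Q x" unfolding Q_def s_def using x by simp
    finally show ?thesis by (simp only: Qx)
  qed
  have delta: "\<delta> = pi * (1 - s)" by (simp add: s_def x_def field_simps)
  have sq: "1 / sqrt (2 * pi) * sqrt (2 * \<delta>) = sqrt (1 - s)"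
    unfolding delta by (simp add: real_sqrt_mult)
  have "1 / sqrt (2 * pi) * (2 * (Q x + Q pi) * sqrt (2 * \<delta>)) = sqrt (1 - s) * (2 * (Q x + Q pi))"
    unfolding sq[symmetric] by simp
  also have "\<dots> \<le> sqrt (1 - s) * (2 * (U / 2 * E + s * (U / 2 * E)))"
    using Qx Qpi s by (intro mult_left_mono) auto
  also have "\<dots> = (sqrt (1 - s) * (1 + s)) * (U * E)" by (simp add: algebra_simps)
  also have "\<dots> \<le> 11 / 10 * (U * E)"
  proof (intro mult_right_mono)
    have "(sqrt (1 - s) * (1 + s))\<^sup>2 = (1 - s) * (1 + s)\<^sup>2" using s by (simp add: power_mult_distrib)
    also have "\<dots> \<le> 121 / 100"
    proof -
      \<comment> \<open>The maximum of \<open>(1-s)(1+s)\<^sup>2\<close> on \<open>[0, 1]\<close> is \<open>32/27\<close>, attained at \<open>s = 1/3\<close>; this factors the difference.\<close>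
      have "0 \<le> (s - 1 / 3)\<^sup>2 * (s + 5 / 3)" using s by (intro mult_nonneg_nonneg) auto
      also have "\<dots> = 5 / 27 - s + s\<^sup>2 + s ^ 3" by (simp add: power2_eq_square power3_eq_cube algebra_simps)
      finally have "s - s\<^sup>2 - s ^ 3 \<le> 5 / 27" by simp
      then show ?thesis by (simp add: power2_eq_square power3_eq_cube algebra_simps)
    qed
    also have "\<dots> = (11 / 10)\<^sup>2" by (simp add: power2_eq_square)
    finally show "sqrt (1 - s) * (1 + s) \<le> 11 / 10" by (rule power2_le_imp_le) simp
  qed (use U0 E0 in auto)
  finally have first: "1 / sqrt (2 * pi) * (2 * (Q x + Q pi) * sqrt (2 * \<delta>)) \<le> 11 / 10 * (U * E)" .
  have "sqrt (2 + 1 / x) / (pi * real m) \<le> 8 / 10 * U"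
  proof (rule power2_le_imp_le)
    have "(sqrt (2 + 1 / x) / (pi * real m))\<^sup>2 = (2 + 1 / x) / (pi * real m)\<^sup>2"
      using x by (simp add: power_divide)
    also have "\<dots> = (2 * x + 1) / (2 * pi * real m) * (2 / (pi * real m * x))"
      using x m0 by (simp add: field_simps power2_eq_square)
    also have "\<dots> \<le> 64 / 100 * (2 / (pi * real m * x))"
    proof (intro mult_right_mono)
      have "2 * x + 1 \<le> 2 * pi + 1" using x by simp
      also have "\<dots> \<le> 64 / 100 * (2 * pi * 2)" using pi_gt3 by simp
      also have "\<dots> \<le> 64 / 100 * (2 * pi * real m)" using m by (intro mult_left_mono) auto
      finally show "(2 * x + 1) / (2 * pi * real m) \<le> 64 / 100" using m0 by (simp add: field_simps)
    qed (use x m0 in auto)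
    also have "\<dots> = (8 / 10 * U)\<^sup>2"
      using x m0 by (simp add: U_def power_mult_distrib power_divide)
    finally show "(sqrt (2 + 1 / x) / (pi * real m))\<^sup>2 \<le> (8 / 10 * U)\<^sup>2" .
  qed (use U0 in simp)
  then have second: "sqrt (2 + 1 / x) / (pi * real m) * E \<le> 8 / 10 * U * E"
    by (rule mult_right_mono) (use E0 in simp)
  have "0 \<le> U * E" using U0 E0 by simp
  then have "1 / sqrt (2 * pi) * (2 * (Q x + Q pi) * sqrt (2 * \<delta>)) + sqrt (2 + 1 / x) / (pi * real m) * E
    \<le> 2 * (U * E)" using first second by linarith
  then show ?thesis unfolding E_def U_def x_def by (simp add: mult_ac)
qed

theorem theorem3p1:
  fixes f :: "real \<Rightarrow> complex" and \<delta> \<sigma> :: real and m :: nat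
  assumes "0 < \<delta>" and "\<delta> < pi"
    and "bandlimited \<delta> f"
    and "m \<ge> 2"
    and "\<sigma>\<^sup>2 = real m / (pi - \<delta>)"
  shows "(\<lambda>t. f t - regularized_shannon (gauss_window \<sigma>) m f t) \<in> C0 \<and>
         norm_C0 (\<lambda>t. f t - regularized_shannon (gauss_window \<sigma>) m f t)
           \<le> 2 * sqrt 2 / sqrt (pi * real m * (pi - \<delta>)) * exp (- (real m * (pi - \<delta>) / 2)) * norm_L2 f"
proof -
  define R where "R = regularized_shannon (gauss_window \<sigma>) m f"
  have m0: "m > 0" using assms(4) by simp
  have cont: "continuous_on UNIV f" using assms(3) by (simp add: bandlimited_def)
  obtain g where g: "square_integrable g" "integrable lborel g" and supp: "\<And>\<omega>. \<bar>\<omega>\<bar> \<ge> \<delta> \<Longrightarrow> g \<omega> = 0"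
    and gf: "norm_L2 g \<le> norm_L2 f"
    and f: "\<And>t. f t = complex_of_real (1 / sqrt (2 * pi)) * (LINT \<omega>|lborel. g \<omega> * cis (t * \<omega>))"
    using bandlimited_representation[OF assms(3)] by blast
  have f0: "(f \<longlongrightarrow> 0) at_infinity"
    by (rule bandlimited_tendsto_0[OF g supp assms(1,2) f])
  have C0: "(\<lambda>t. f t - R t) \<in> C0"
    unfolding C0_def R_def
    using tendsto_diff[OF f0 regularized_shannon_tendsto_0[OF f0]]
    by (auto intro!: continuous_intros cont regularized_shannon_continuous m0)
  \<comment> \<open>The statement determines \<open>\<sigma>\<close> only up to its sign.\<close>
  define \<rho> where "\<rho> = \<bar>\<sigma>\<bar>"
  have \<rho>: "\<rho> > 0" "\<rho>\<^sup>2 = real m / (pi - \<delta>)"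
    using assms m0 by (auto simp: \<rho>_def)
  have gw: "gauss_window \<sigma> = gauss_window \<rho>"
    by (simp add: gauss_window_def fun_eq_iff \<rho>_def)
  define Q where "Q = (\<lambda>a. (1 / \<rho>) / (a * sqrt (2 * pi)) * exp (- (a\<^sup>2 / (2 * (1 / \<rho>)\<^sup>2))))"
  define q where "q = Q (pi - \<delta>) + Q pi"
  have q0: "0 \<le> q" using \<rho> assms by (simp add: q_def Q_def)
  have q: "emeasure (gauss_measure (1 / \<rho>)) {\<tau>. \<bar>\<omega> - \<tau>\<bar> \<ge> pi} \<le> ennreal q" if "\<bar>\<omega>\<bar> < \<delta>" for \<omega>
    unfolding q_def Q_def
    by (rule gauss_two_sided_tail[OF _ assms(1,2) that]) (use \<rho> in simp)
  define E2 where "E2 = sqrt (2 + 1 / (pi - \<delta>)) / (pi * real m) * exp (- (real m * (pi - \<delta>) / 2))"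
  define E where "E = 2 * sqrt 2 / sqrt (pi * real m * (pi - \<delta>)) * exp (- (real m * (pi - \<delta>) / 2))"
  have total: "1 / sqrt (2 * pi) * (2 * q * sqrt (2 * \<delta>)) + E2 \<le> E"
    using shannon_constants_bound[OF assms(1,2,4) \<rho>] unfolding q_def Q_def E2_def E_def .
  have E0: "0 \<le> E" using assms m0 by (simp add: E_def)
  have pointwise: "cmod (f t - R t) \<le> E * norm_L2 f" for t
  proof -
    define a where "a = (\<lambda>k::int. f (of_int k) *
       complex_of_real (cardinal_sine (t - of_int k) * gauss_window \<rho> (t - of_int k)))"
    define N0 where "N0 = nat \<lceil>\<bar>t\<bar> + real m\<rceil>"
    define near where "near = {k. \<bar>t - real_of_int k\<bar> \<le> real m}"
    \<comment> \<open>For large \<open>N\<close> the symmetric partial sum contains all terms kept by the truncation.\<close>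
    have bound: "cmod (f t - R t) \<le> (1 / sqrt (2 * pi) * (2 * q * sqrt (2 * \<delta>) + sqrt (4 * pi * sinc_defect t N)) + E2) * norm_L2 g"
      if N: "N \<ge> N0" for N
    proof -
      define A where "A = {- int N..int N}"
      have near: "k \<in> A" if "k \<in> near" for k
      proof -
        have "\<bar>t\<bar> + real m \<le> real N" using N unfolding N0_def by linarith
        moreover have "\<bar>t - real_of_int k\<bar> \<le> real m" using that by (simp add: near_def)
        ultimately have "- real N \<le> of_int k" "of_int k \<le> real N" by linarith+
        then show ?thesis unfolding A_def by auto
      qed
      have "R t = (\<Sum>k\<in>A \<inter> near. f (of_int k) * complex_of_real (truncated_kernel \<sigma> m (t - of_int k)))"
        unfolding R_def
        by (rule regularized_shannon_finite) (use near in \<open>auto simp: A_def near_def not_le[symmetric]\<close>)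
      also have "\<dots> = (\<Sum>k\<in>A \<inter> near. a k)"
        by (intro sum.cong) (auto simp: a_def truncated_kernel_def gw near_def indicator_def)
      finally have R: "R t = (\<Sum>k\<in>A \<inter> near. a k)" .
      have "(\<Sum>k\<in>A. a k) = R t + (\<Sum>k\<in>A - near. a k)"
        unfolding R by (rule sum.Int_Diff) (simp add: A_def)
      then have "f t - R t = (f t - (\<Sum>k\<in>A. a k)) + (\<Sum>k\<in>A - near. a k)" by simp
      then have "cmod (f t - R t) \<le> cmod (f t - (\<Sum>k\<in>A. a k)) + cmod (\<Sum>k\<in>A - near. a k)"
        using norm_triangle_ineq by metis
      also have "\<dots> \<le> 1 / sqrt (2 * pi) * (2 * q * sqrt (2 * \<delta>) + sqrt (4 * pi * sinc_defect t N)) * norm_L2 g + E2 * norm_L2 g"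
        unfolding a_def A_def E2_def
        by (intro add_mono regularization_error[OF g supp assms(1,2) f \<rho>(1) q q0]
            truncation_error[OF g(1) supp assms(2) f m0 \<rho>(2)])
           (auto simp: near_def)
      finally show ?thesis by (simp add: algebra_simps)
    qed
    have lim: "(\<lambda>N. (1 / sqrt (2 * pi) * (2 * q * sqrt (2 * \<delta>) + sqrt (4 * pi * sinc_defect t N)) + E2) * norm_L2 g)
        \<longlonglongrightarrow> (1 / sqrt (2 * pi) * (2 * q * sqrt (2 * \<delta>) + sqrt (4 * pi * 0)) + E2) * norm_L2 g"
      by (intro tendsto_intros sinc_defect_tendsto_0)
    have "cmod (f t - R t) \<le> (1 / sqrt (2 * pi) * (2 * q * sqrt (2 * \<delta>) + sqrt (4 * pi * 0)) + E2) * norm_L2 g"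
      by (rule LIMSEQ_le_const[OF lim]) (use bound in blast)
    also have "\<dots> \<le> E * norm_L2 g"
      by (rule mult_right_mono) (use total in simp_all)
    also have "\<dots> \<le> E * norm_L2 f"
      by (rule mult_left_mono[OF gf E0])
    finally show ?thesis .
  qed
  have "norm_C0 (\<lambda>t. f t - R t) \<le> E * norm_L2 f"
    unfolding norm_C0_def by (rule cSUP_least) (use pointwise in auto)
  with C0 show ?thesis unfolding R_def E_def by simp
qed

end
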